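(* Let $\Omega\subset\mathbb{R}^d$ be a compact set with positive Lebesgue measure and Lipschitz boundary satisfying an interior cone condition. Let $Z$ be a zero-mean stationary Gaussian process with $\mathrm{Cov}(Z(x),Z(x'))=\sigma^2\Psi(x-x')$ and observations $y_k=Z(x_k)+\epsilon_k$, $k=1,\dots,n$, at design $X_n=\{x_1,\dots,x_n\}\subset\Omega$, where the $\epsilon_k$ are i.i.d. mean-zero sub-Gaussian random variables (i.e. $C^2(\mathbb{E}e^{|\epsilon_k|^2/C^2}-1)\le C'$ for some constants $C,C'$), independent of $Z$. Let $\Psi$ and $\Phi$ be two Matérn correlation functions, and suppose $c_1(1+\|\omega\|_2^2)^{-m_0}\le\mathcal{F}(\Psi)(\omega)\le c_2(1+\|\omega\|_2^2)^{-m_0}$ and $c_3(1+\|\omega\|_2^2)^{-m}\le\mathcal{F}(\Phi)(\omega)\le c_4(1+\|\omega\|_2^2)^{-m}$ for all $\omega$, with $d/2<m_0\le m<\infty$. Suppose the fill distance satisfies $h_{X_n,\Omega}\le Cn^{-1/d}$ for all $n$. Let $$\hat f_G(x)=r_m(x)^T(R_m+\mu_m I_n)^{-1}Y,\quad r_m(x)=(\Phi(x-x_1),\dots,\Phi(x-x_n))^T,\ R_m=(\Phi(x_j-x_k))_{jk},\ Y=(y_1,\dots,y_n)^T,$$ with regularization parameter $\mu_m\gtrsim n^{1-\frac{2m}{d}}$. Then there exist constants $C,C_0$ not depending on $n,t_1,t_2$ such that for any $t_1,t_2\ge C_0$ and all $n$, with probability at least $1-\exp(-t_1^2)-\exp(-t_2^2)$,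 $$\|Z-\hat f_G\|_{L_2(\Omega)}^2\le C\Big((1+t_1)^2T+t_2^2\mu_m^{-\frac{d}{2m}}n^{-(1-\frac{d}{2m})}\Big),$$ where $T=\mu_m^{-\frac{m-m_0}{m}}q_{X_n}^{-\frac{(m-m_0)d}{m}}(\mu_m/n)^{1-\frac{d}{2m}}+\mu_m^{\frac{2m_0-d}{2m}}q_{X_n}^{\frac{(2m_0-d)d}{2m}}$.
   Context: Matérn correlation function: $\Psi_M(x;\phi,\nu)=\frac{1}{\Gamma(\nu)2^{\nu-1}}(2\sqrt{\nu}\phi\|x\|_2)^{\nu}K_\nu(2\sqrt{\nu}\phi\|x\|_2)$ with $\phi,\nu>0$ and $K_\nu$ the modified Bessel function of the second kind; its Fourier transform is proportional to $(4\nu\phi^2+\|\omega\|_2^2)^{-(\nu+d/2)}$. Fourier transform: $\mathcal{F}(f)(\omega)=(2\pi)^{-d/2}\int f(x)e^{-ix^T\omega}dx$. Interior cone condition: there exist $\alpha\in(0,\pi/2)$, $\mathcal{R}>0$ such that each $x\in\Omega$ has a unit vector $\xi(x)$ with the cone $\{x+\lambda y:\|y\|=1,y^T\xi(x)\ge\cos\alpha,\lambda\in[0,\mathcal{R}]\}\subset\Omega$. Fill distance $h_{X,\Omega}=\sup_{x\in\Omega}\min_{x_j\in X}\|x-x_j\|_2$; separation radius $q_X=\min_{j\ne k}\|x_j-x_k\|_2/2$. $a_n\gtrsim b_n$ means $a_n\ge cb_n$ for a constant $c>0$ independent of $n$. *)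

theory Defs
  imports "HOL-Probability.Probability" "Jordan_Normal_Form.Gauss_Jordan_Elimination"
begin

definition besselK :: "real \<Rightarrow> real \<Rightarrow> real" where
  "besselK \<nu> z = (LINT t:{0..}|lborel. exp (- z * cosh t) * cosh (\<nu> * t))"

text \<open>Matern correlation; at x = 0 it takes its limiting value 1.\<close>
definition matern :: "real \<Rightarrow> real \<Rightarrow> 'a::euclidean_space \<Rightarrow> real" where
  "matern \<phi> \<nu> x =
     (if x = 0 then 1
      else 1 / (Gamma \<nu> * 2 powr (\<nu> - 1))
           * (2 * sqrt \<nu> * \<phi> * norm x) powr \<nu> * besselK \<nu> (2 * sqrt \<nu> * \<phi> * norm x))"

definition fourier_transform :: "('a::euclidean_space \<Rightarrow> real) \<Rightarrow> 'a \<Rightarrow> complex" where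
  "fourier_transform f \<omega> =
     complex_of_real ((2 * pi) powr (- real DIM('a) / 2))
     * (LINT x|lborel. complex_of_real (f x) * cis (- (x \<bullet> \<omega>)))"

definition interior_cone_condition :: "'a::euclidean_space set \<Rightarrow> bool" where
  "interior_cone_condition \<Omega> \<longleftrightarrow>
     (\<exists>\<alpha> R. 0 < \<alpha> \<and> \<alpha> < pi / 2 \<and> 0 < R \<and>
        (\<forall>x\<in>\<Omega>. \<exists>\<xi>. norm \<xi> = 1 \<and>
           {x + s *\<^sub>R y | s y. norm y = 1 \<and> y \<bullet> \<xi> \<ge> cos \<alpha> \<and> 0 \<le> s \<and> s \<le> R} \<subseteq> \<Omega>))"

text \<open>Lipschitz boundary (for a closed set): near every boundary point the set is,
  in a suitably rotated coordinate system (direction e, hyperplane e-perp), the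
  closed epigraph of a Lipschitz function on the hyperplane.\<close>
definition lipschitz_boundary :: "'a::euclidean_space set \<Rightarrow> bool" where
  "lipschitz_boundary \<Omega> \<longleftrightarrow>
     (\<forall>p\<in>frontier \<Omega>. \<exists>r e g L. 0 < r \<and> norm e = 1 \<and>
        L-lipschitz_on {u. u \<bullet> e = 0} g \<and>
        \<Omega> \<inter> ball p r = {y \<in> ball p r. g (y - (y \<bullet> e) *\<^sub>R e) \<le> y \<bullet> e})"

definition fill_distance :: "'a::euclidean_space set \<Rightarrow> 'a set \<Rightarrow> real" where
  "fill_distance X \<Omega> = (SUP x\<in>\<Omega>. infdist x X)"

definition separation_radius :: "'a::euclidean_space set \<Rightarrow> real" where
  "separation_radius X = Min {dist a b / 2 | a b. a \<in> X \<and> b \<in> X \<and> a \<noteq> b}"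

definition normal_rv :: "'w measure \<Rightarrow> ('w \<Rightarrow> real) \<Rightarrow> real \<Rightarrow> real \<Rightarrow> bool" where
  "normal_rv M X \<mu> v \<longleftrightarrow>
     (v = 0 \<and> X \<in> borel_measurable M \<and> (AE \<omega> in M. X \<omega> = \<mu>)) \<or>
     (0 < v \<and> distributed M lborel X (normal_density \<mu> (sqrt v)))"

definition centered_gaussian_process ::
  "'w measure \<Rightarrow> ('a \<Rightarrow> 'w \<Rightarrow> real) \<Rightarrow> ('a \<Rightarrow> 'a \<Rightarrow> real) \<Rightarrow> bool" where
  "centered_gaussian_process M Z K \<longleftrightarrow>
     (\<forall>F c. finite F \<longrightarrow>
        normal_rv M (\<lambda>\<omega>. \<Sum>x\<in>F. c x * Z x \<omega>) 0 (\<Sum>x\<in>F. \<Sum>y\<in>F. c x * c y * K x y))"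

definition kernel_predictor ::
  "('a::real_vector \<Rightarrow> real) \<Rightarrow> real \<Rightarrow> nat \<Rightarrow> (nat \<Rightarrow> 'a) \<Rightarrow> (nat \<Rightarrow> real) \<Rightarrow> 'a \<Rightarrow> real" where
  "kernel_predictor \<Phi> \<mu> n xs y x =
     (let R = mat n n (\<lambda>(j, k). \<Phi> (xs j - xs k));
          A = R + \<mu> \<cdot>\<^sub>m 1\<^sub>m n;
          coef = the (mat_inverse A) *\<^sub>v vec n y
      in \<Sum>k<n. \<Phi> (x - xs k) * coef $ k)"

end

theory Submission
  imports Defs "HOL-Real_Asymp.Real_Asymp" "Jordan_Normal_Form.Determinant"
begin

text \<open>
  With w(x) solving (R + \<mu> I) w(x) = r(x), the error splits as
  Z(x) - f(x) = (Z(x) - \<Sum> w_k(x) Z(x_k)) - \<Sum> w_k(x) \<epsilon>_k, so everything reduces to two deterministic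
  pointwise bounds: one for the variance of the first bracket and one for |w(x)|^2.

  The quantity J(x) = \<Phi>(0) - \<Sum> w_k(x) \<Phi>(x - x_k) equals P(x) + \<mu> |w(x)|^2, where P(x) is the squared
  norm of the functional g \<mapsto> g(x) - \<Sum> w_k(x) g(x_k) on the native space of \<Phi>. It is also the value at
  x of a function u in the native space with u(x_k) = \<mu> w_k, so a pointwise sampling inequality for u at
  the length scale h = (\<mu>/n)^(1/2m) improves itself to J(x) = O(h^(2m-d)). That inequality follows by
  comparing u with the Taylor polynomial of its part of frequency at most 1/h.

  For the misspecified covariance, \<F>(\<Psi>) is for \<delta> \<le> 1 at most a constant times
  \<delta>^(-2(m-m_0)) \<F>(\<Phi>) + (\<delta>^(-2) + |.|^2)^(-m_0). The second density belongs to a Matern kernel of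
  length scale \<delta>, whose row sums over a 2q-separated design are O(1 + (\<delta>/q)^d), and the choice
  \<delta> = min(1, (\<mu> q^d)^(1/2m)) gives T. All Fourier analysis is done through the representation of the Matern
  kernel as a Gamma mixture of Gaussians.

  Finally both error fields are subgaussian pointwise, and E exp(Y^2/4V) \<le> sqrt 2 turns pointwise variance
  bounds V into tail bounds for the integral of Y^2.
\<close>

no_notation Matrix.scalar_prod (infix "\<bullet>" 70)

section \<open>Gaussian integrals and Gamma mixtures\<close>

text \<open>The weights are tuned to \<open>\<Phi>\<close>, the error is measured by
  \<open>\<Psi>\<close>, and the ratio of the two spectral densities may be unbounded at high
  frequency. Up to frequency 1/\<delta> the ratio costs a factor \<delta>^(-2(m-m_0)) in front of
  P(x). Beyond it the only information on the weights is |w|^2 <= J/\<mu>, which the separation of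
  the design turns into an energy bound. At \<delta>^(2m) = \<mu> q^d that energy, multiplied by
  \<delta>^(2 m_0 - d), is again of the order of the first term of T, and the contribution of the
  point x itself gives the second term.

  The length h comes from a balance as well. At scale H the polynomial comparison leaves an error
  H^(2m-d), while a ball of that size holds at least about n H^d design points, at which the squares
  of u sum to at most \<mu> J; this contributes \<mu>/(n H^d). Both agree at H^(2m) = \<mu>/n, and
  the assumed lower bound on \<mu> says exactly that this h is at least a multiple of n^(-1/d), the
  resolution of the design.\<close>

lemma borel_measurable_cis [measurable (raw)]:
  "f \<in> borel_measurable M \<Longrightarrow> (\<lambda>x. cis (f x)) \<in> borel_measurable M"
  by (simp add: cis_conv_exp)

text \<open>The characteristic function of the standard normal law at
  \<open>y / sqrt (2 * s)\<close>, rescaled by \<open>sqrt (2 * s)\<close>; it takes the place of a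
  contour shift.\<close>

lemma has_bochner_integral_gauss_cis_real:
  fixes s y :: real
  assumes s: "s > 0"
  shows "has_bochner_integral lborel (\<lambda>t. exp (- s * t\<^sup>2) *\<^sub>R cis (t * y))
    (complex_of_real (sqrt (pi / s) * exp (- y\<^sup>2 / (4 * s))))"
proof -
  define \<tau> where "\<tau> = y / sqrt (2 * s)"
  interpret real_distribution std_normal_distribution
    by (rule real_dist_normal_dist)
  have "integrable std_normal_distribution (\<lambda>x. iexp (\<tau> * x))"
    by (intro integrable_const_bound[where B=1]) (auto simp: norm_exp_i_times)
  hence 1: "integrable lborel (\<lambda>x. std_normal_density x *\<^sub>R iexp (\<tau> * x))"
    by (subst (asm) integrable_density) auto
  have "integral\<^sup>L lborel (\<lambda>x. std_normal_density x *\<^sub>R iexp (\<tau> * x)) = char std_normal_distribution \<tau>"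
    unfolding char_def by (subst integral_density) auto
  also have "\<dots> = complex_of_real (exp (- \<tau>\<^sup>2 / 2))"
    by (simp add: char_std_normal_distribution)
  finally have "has_bochner_integral lborel (\<lambda>x. std_normal_density x *\<^sub>R iexp (\<tau> * x))
      (complex_of_real (exp (- \<tau>\<^sup>2 / 2)))"
    using 1 by (simp add: has_bochner_integral_iff)
  hence "has_bochner_integral lborel (\<lambda>x. std_normal_density (0 + sqrt (2 * s) * x) *\<^sub>R iexp (\<tau> * (0 + sqrt (2 * s) * x)))
      (complex_of_real (exp (- \<tau>\<^sup>2 / 2)) /\<^sub>R \<bar>sqrt (2 * s)\<bar>)"
    using s by (subst (asm) lborel_has_bochner_integral_real_affine_iff[where c="sqrt (2 * s)" and t=0]) auto
  moreover have "iexp (\<tau> * (0 + sqrt (2 * s) * x)) = cis (x * y)" for x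
    using s by (simp add: \<tau>_def cis_conv_exp field_simps)
  moreover have "std_normal_density (0 + sqrt (2 * s) * x) = (1 / sqrt (2*pi)) * exp (- s * x\<^sup>2)" for x
    using s by (simp add: normal_density_def power_mult_distrib)
  ultimately have "has_bochner_integral lborel (\<lambda>x. ((1 / sqrt (2*pi)) * exp (- s * x\<^sup>2)) *\<^sub>R cis (x * y))
      (complex_of_real (exp (- \<tau>\<^sup>2 / 2)) /\<^sub>R \<bar>sqrt (2 * s)\<bar>)" by simp
  hence "has_bochner_integral lborel (\<lambda>x. sqrt (2*pi) *\<^sub>R (((1 / sqrt (2*pi)) * exp (- s * x\<^sup>2)) *\<^sub>R cis (x * y)))
      (sqrt (2*pi) *\<^sub>R (complex_of_real (exp (- \<tau>\<^sup>2 / 2)) /\<^sub>R \<bar>sqrt (2 * s)\<bar>))"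
    by (intro has_bochner_integral_scaleR_right) auto
  moreover have "sqrt (2*pi) *\<^sub>R (((1 / sqrt (2*pi)) * exp (- s * x\<^sup>2)) *\<^sub>R cis (x * y)) = exp (- s * x\<^sup>2) *\<^sub>R cis (x * y)" for x
    by (simp only: scaleR_scaleR) simp
  moreover have "sqrt (2*pi) *\<^sub>R (complex_of_real (exp (- \<tau>\<^sup>2 / 2)) /\<^sub>R \<bar>sqrt (2 * s)\<bar>) =
      complex_of_real (sqrt (pi / s) * exp (- y\<^sup>2 / (4 * s)))"
  proof -
    have e: "exp (- \<tau>\<^sup>2 / 2) = exp (- y\<^sup>2 / (4 * s))"
      using s by (simp add: \<tau>_def power_divide)
    have r: "sqrt (2*pi) / \<bar>sqrt (2 * s)\<bar> = sqrt (pi / s)"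
      using s by (simp add: real_sqrt_mult real_sqrt_divide)
    have "sqrt (2*pi) *\<^sub>R (complex_of_real E /\<^sub>R q) = complex_of_real ((sqrt (2*pi) / q) * E)" for q E
      by (simp add: scaleR_conv_of_real field_simps)
    from this[of "\<bar>sqrt (2 * s)\<bar>" "exp (- \<tau>\<^sup>2 / 2)"] show ?thesis
      unfolding r by (simp only: e)
  qed
  ultimately show ?thesis by (simp only:)
qed

lemma cis_sum: "finite I \<Longrightarrow> cis (\<Sum>i\<in>I. f i) = (\<Prod>i\<in>I. cis (f i))"
  by (induction I rule: finite_induct) (auto simp: cis_mult[symmetric])

text \<open>The Gaussian and the plane wave both factor over the coordinates, so this is a product
  of one-dimensional integrals, transported from the product measure over \<open>Basis\<close> to
  \<open>lborel\<close>.\<close>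

lemma has_bochner_integral_gauss_cis:
  fixes y :: "'a::euclidean_space" and s :: real
  assumes s: "s > 0"
  shows "has_bochner_integral lborel (\<lambda>v::'a. exp (- s * (norm v)\<^sup>2) *\<^sub>R cis (v \<bullet> y))
    (complex_of_real ((pi / s) powr (real DIM('a) / 2) * exp (- (norm y)\<^sup>2 / (4 * s))))"
proof -
  interpret product_sigma_finite "\<lambda>_::'a. lborel :: real measure" by standard
  let ?g = "\<lambda>b t. exp (- s * t\<^sup>2) *\<^sub>R cis (t * (y \<bullet> b))"
  have split: "exp (- s * (norm v)\<^sup>2) *\<^sub>R cis (v \<bullet> y) = (\<Prod>b\<in>Basis. ?g b (v \<bullet> b))" for v :: 'a
  proof -
    have "exp (- s * (norm v)\<^sup>2) = (\<Prod>b\<in>Basis. exp (- s * (v \<bullet> b)\<^sup>2))"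
      unfolding norm_eq_sqrt_inner
      by (subst euclidean_inner) (simp add: sum_nonneg exp_sum[symmetric] sum_distrib_left power2_eq_square)
    moreover have "cis (v \<bullet> y) = (\<Prod>b\<in>Basis. cis ((v \<bullet> b) * (y \<bullet> b)))"
      by (subst euclidean_inner) (simp add: cis_sum)
    ultimately show ?thesis
      by (simp add: scaleR_conv_of_real prod.distrib)
  qed
  have g: "has_bochner_integral lborel (?g b) (complex_of_real (sqrt (pi / s) * exp (- (y \<bullet> b)\<^sup>2 / (4 * s))))" for b
    by (rule has_bochner_integral_gauss_cis_real[OF s])
  have "has_bochner_integral (Pi\<^sub>M Basis (\<lambda>_::'a. lborel)) (\<lambda>x. \<Prod>b\<in>Basis. ?g b (x b))
      (\<Prod>b\<in>(Basis::'a set). complex_of_real (sqrt (pi / s) * exp (- (y \<bullet> b)\<^sup>2 / (4 * s))))"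
    unfolding has_bochner_integral_iff
  proof
    show "integrable (Pi\<^sub>M Basis (\<lambda>_::'a. lborel)) (\<lambda>x. \<Prod>b\<in>Basis. ?g b (x b))"
      by (rule product_integrable_prod) (use g in \<open>auto simp: has_bochner_integral_iff\<close>)
    show "(\<integral>x. (\<Prod>b\<in>Basis. ?g b (x b)) \<partial>(Pi\<^sub>M Basis (\<lambda>_::'a. lborel))) =
       (\<Prod>b\<in>(Basis::'a set). complex_of_real (sqrt (pi / s) * exp (- (y \<bullet> b)\<^sup>2 / (4 * s))))"
      by (subst product_integral_prod) (use g in \<open>auto simp: has_bochner_integral_iff\<close>)
  qed
  also have "(\<lambda>x. \<Prod>b\<in>Basis. ?g b (x b)) =
      (\<lambda>x. \<Prod>b\<in>Basis. ?g b ((\<Sum>b'\<in>Basis. x b' *\<^sub>R b') \<bullet> b))"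
    by (intro ext prod.cong) auto
  also have "(\<Prod>b\<in>(Basis::'a set). complex_of_real (sqrt (pi / s) * exp (- (y \<bullet> b)\<^sup>2 / (4 * s)))) =
      complex_of_real ((pi / s) powr (real DIM('a) / 2) * exp (- (norm y)\<^sup>2 / (4 * s)))"
  proof -
    have "sqrt (pi / s) ^ DIM('a) = (pi / s) powr (real DIM('a) / 2)"
      using s by (simp add: powr_half_sqrt[symmetric] powr_powr powr_realpow[symmetric])
    moreover have "(\<Prod>b\<in>(Basis::'a set). exp (- (y \<bullet> b)\<^sup>2 / (4 * s))) = exp (- (norm y)\<^sup>2 / (4 * s))"
      unfolding norm_eq_sqrt_inner
      by (subst (2) euclidean_inner)
         (simp add: exp_sum[symmetric] sum_nonneg sum_negf sum_divide_distrib power2_eq_square)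
    ultimately show ?thesis
      by (simp add: prod.distrib of_real_prod[symmetric] del: of_real_prod of_real_mult of_real_power)
  qed
  finally have *: "has_bochner_integral (Pi\<^sub>M Basis (\<lambda>_::'a. lborel))
     (\<lambda>x. \<Prod>b\<in>Basis. ?g b ((\<Sum>b'\<in>Basis. x b' *\<^sub>R b') \<bullet> b)) 
     (complex_of_real ((pi / s) powr (real DIM('a) / 2) * exp (- (norm y)\<^sup>2 / (4 * s))))" .
  show ?thesis
    unfolding split
    by (subst lborel_eq, rule has_bochner_integral_distr) (use * in \<open>auto intro!: borel_measurable_prod\<close>)
qed

lemma has_bochner_integral_gauss:
  fixes s :: real
  assumes s: "s > 0"
  shows "has_bochner_integral lborel (\<lambda>v::'a::euclidean_space. exp (- s * (norm v)\<^sup>2))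
    ((pi / s) powr (real DIM('a) / 2))"
  using has_bochner_integral_Re[OF has_bochner_integral_gauss_cis[OF s, where y="0::'a"]] by simp

text \<open>Fubini. For each \<open>u\<close> the \<open>v\<close>-integral of the modulus is w(u)
  (pi / s(u))^(d/2), so \<open>int\<close> is precisely the absolute integrability required. Asking
  for \<open>s u > 0\<close> only where \<open>w u \<noteq> 0\<close> lets weights supported on a
  half-line be integrated over the whole line.\<close>

lemma has_bochner_integral_gauss_mixture_cis:
  fixes w s :: "real \<Rightarrow> real" and y :: "'a::euclidean_space"
  assumes [measurable]: "w \<in> borel_measurable borel" "s \<in> borel_measurable borel"
    and w0: "\<And>u. w u \<ge> 0" and s0: "\<And>u. w u \<noteq> 0 \<Longrightarrow> s u > 0"
    and int: "integrable lborel (\<lambda>u. w u * (pi / s u) powr (real DIM('a) / 2))"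
  shows "has_bochner_integral lborel
      (\<lambda>v::'a. (LINT u|lborel. w u * exp (- s u * (norm v)\<^sup>2)) *\<^sub>R cis (v \<bullet> y))
      (complex_of_real (LINT u|lborel. w u * (pi / s u) powr (real DIM('a) / 2) * exp (- (norm y)\<^sup>2 / (4 * s u))))"
proof -
  let ?f = "\<lambda>u v. (w u * exp (- s u * (norm v)\<^sup>2)) *\<^sub>R cis (v \<bullet> y)"
  have inner: "has_bochner_integral lborel (?f u)
      (complex_of_real (w u * (pi / s u) powr (real DIM('a) / 2) * exp (- (norm y)\<^sup>2 / (4 * s u))))" for u
  proof (cases "w u = 0")
    case False
    have "has_bochner_integral lborel (\<lambda>v. w u *\<^sub>R (exp (- s u * (norm v)\<^sup>2) *\<^sub>R cis (v \<bullet> y)))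
      (w u *\<^sub>R (complex_of_real ((pi / s u) powr (real DIM('a) / 2) * exp (- (norm y)\<^sup>2 / (4 * s u)))))"
      by (intro has_bochner_integral_scaleR_right impI has_bochner_integral_gauss_cis s0 False)
    thus ?thesis by (simp add: scaleR_conv_of_real mult.assoc)
  qed (simp add: has_bochner_integral_iff)
  have nrm: "(LINT v|lborel. norm (?f u v)) = w u * (pi / s u) powr (real DIM('a) / 2)" for u
  proof (cases "w u = 0")
    case False
    have "has_bochner_integral lborel (\<lambda>v::'a. w u * exp (- s u * (norm v)\<^sup>2)) 
        (w u * (pi / s u) powr (real DIM('a) / 2))"
      by (intro has_bochner_integral_mult_right impI has_bochner_integral_gauss s0 False)
    thus ?thesis using w0[of u] by (simp add: has_bochner_integral_iff)
  qed auto
  have prod: "integrable (lborel \<Otimes>\<^sub>M lborel) (case_prod ?f)"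
  proof (rule lborel_pair.Fubini_integrable)
    show "case_prod ?f \<in> borel_measurable (lborel \<Otimes>\<^sub>M lborel)" by measurable
    show "integrable lborel (\<lambda>u. LINT v|lborel. norm (case (u, v) of (u, v) \<Rightarrow> ?f u v))"
      unfolding prod.case nrm by (rule int)
    show "AE u in lborel. integrable lborel (\<lambda>v. case (u, v) of (u, v) \<Rightarrow> ?f u v)"
      using inner by (auto simp: has_bochner_integral_iff)
  qed
  have eq: "(LINT u|lborel. ?f u v) = (LINT u|lborel. w u * exp (- s u * (norm v)\<^sup>2)) *\<^sub>R cis (v \<bullet> y)" for v
    unfolding scaleR_conv_of_real integral_mult_left_zero integral_complex_of_real ..
  have "integrable lborel (\<lambda>v. LINT u|lborel. ?f u v)"
    by (rule lborel_pair.integrable_snd[OF prod])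
  moreover have "(LINT v|lborel. LINT u|lborel. ?f u v) = (LINT u|lborel. LINT v|lborel. ?f u v)"
    by (rule lborel_pair.Fubini_integral[OF prod])
  moreover have "(LINT v|lborel. ?f u v) =
      complex_of_real (w u * (pi / s u) powr (real DIM('a) / 2) * exp (- (norm y)\<^sup>2 / (4 * s u)))" for u
    using inner by (simp add: has_bochner_integral_iff)
  ultimately show ?thesis
    unfolding has_bochner_integral_iff eq by (simp only:) (simp only: integral_complex_of_real)
qed

section \<open>Gamma integrals and the Matern spectral density\<close>

lemma has_bochner_integral_Gamma_scaled:
  fixes p c :: real
  assumes "p > 0" "c > 0"
  shows "has_bochner_integral lborel (\<lambda>u. indicator {0<..} u * (u powr (p - 1) * exp (- c * u))) (Gamma p / c powr p)"
proof -
  \<comment> \<open>\<open>0 powr r\<close> is 0, so the open and the closed half-line give the same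
    function even at \<open>u = 0\<close>.\<close>
  have eq: "indicator {0<..} u * (u powr (p - 1) * exp (- u)) = indicator {0..} u * u powr (p - 1) / exp u" for u :: real
    by (cases "u = 0") (auto simp: indicator_def exp_minus field_simps)
  have "(\<integral>\<^sup>+u. ennreal (indicator {0<..} u * (u powr (p - 1) * exp (- u))) \<partial>lborel) = ennreal (Gamma p)"
    unfolding eq by (rule Gamma_conv_nn_integral_real[symmetric]) fact
  hence "has_bochner_integral lborel (\<lambda>u. indicator {0<..} u * (u powr (p - 1) * exp (- u))) (Gamma p)"
    using assms by (intro has_bochner_integral_nn_integral) (auto intro: Gamma_real_nonneg less_imp_le)
  hence "has_bochner_integral lborel (\<lambda>u. indicator {0<..} (0 + c * u) * ((0 + c * u) powr (p - 1) * exp (- (0 + c * u)))) (Gamma p /\<^sub>R \<bar>c\<bar>)"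
    using assms by (subst (asm) lborel_has_bochner_integral_real_affine_iff[where c=c and t=0]) auto
  hence "has_bochner_integral lborel (\<lambda>u. c powr (1 - p) * (indicator {0<..} (0 + c * u) * ((0 + c * u) powr (p - 1) * exp (- (0 + c * u))))) (c powr (1 - p) * (Gamma p /\<^sub>R \<bar>c\<bar>))"
    by (intro has_bochner_integral_mult_right) auto
  moreover have "c powr (1 - p) * (indicator {0<..} (0 + c * u) * ((0 + c * u) powr (p - 1) * exp (- (0 + c * u)))) =
    indicator {0<..} u * (u powr (p - 1) * exp (- c * u))" for u
    using assms by (cases "u > 0") (auto simp: indicator_def powr_mult zero_less_mult_iff powr_diff field_simps)
  moreover have "c powr (1 - p) * (Gamma p /\<^sub>R \<bar>c\<bar>) = Gamma p / c powr p"
    using assms by (simp add: powr_diff field_simps)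
  ultimately show ?thesis by (simp only:)
qed

text \<open>The density of the Gamma law with shape \<open>\<nu>\<close> and rate 1.\<close>

definition gamma_weight :: "real \<Rightarrow> real \<Rightarrow> real" where
  "gamma_weight \<nu> u = indicator {0<..} u * (u powr (\<nu> - 1) * exp (- u)) / Gamma \<nu>"

text \<open>The Matern kernel with inverse length \<open>a\<close>; the component with parameter
  \<open>u\<close> is a Gaussian of variance 2u/a^2 per coordinate. Fourier representations and row
  sums over a design are both computed component by component.\<close>

definition gauss_mix :: "real \<Rightarrow> real \<Rightarrow> 'a::euclidean_space \<Rightarrow> real" where
  "gauss_mix a \<nu> y = (LINT u|lborel. gamma_weight \<nu> u * exp (- (a * norm y)\<^sup>2 / (4 * u)))"

text \<open>Up to scale a multivariate Student density with \<open>2 * \<nu>\<close> degrees of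
  freedom. It is normalised to mass 1, so that pairing it with a bare \<open>cis\<close> yields
  \<open>gauss_mix a \<nu>\<close> without powers of 2 pi. The parameter \<open>a\<close> stays free
  because auxiliary kernels of small length scale are needed too.\<close>

definition matern_density :: "real \<Rightarrow> real \<Rightarrow> 'a::euclidean_space \<Rightarrow> real" where
  "matern_density a \<nu> \<omega> = Gamma (\<nu> + real DIM('a) / 2) / (Gamma \<nu> * pi powr (real DIM('a) / 2)) *
     a powr (2 * \<nu>) * (a\<^sup>2 + (norm \<omega>)\<^sup>2) powr (- (\<nu> + real DIM('a) / 2))"

lemma gamma_weight_measurable [measurable]: "gamma_weight \<nu> \<in> borel_measurable borel"
  unfolding gamma_weight_def by measurable

lemma gamma_weight_nonneg: "\<nu> > 0 \<Longrightarrow> gamma_weight \<nu> u \<ge> 0"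
  unfolding gamma_weight_def by (auto intro!: divide_nonneg_pos Gamma_real_pos)

lemma gamma_weight_eq_0: "u \<le> 0 \<Longrightarrow> gamma_weight \<nu> u = 0"
  unfolding gamma_weight_def by auto

text \<open>Moments and Laplace transform of the Gamma law in one formula. With p = d/2 and c =
  |\<omega>|^2/a^2 the right-hand side is the Matern spectral decay; with c = 0 it is the moment
  that enters the row sums.\<close>

lemma has_bochner_integral_gamma_weight:
  fixes \<nu> p c :: real
  assumes "\<nu> > 0" "p \<ge> 0" "c \<ge> 0"
  shows "has_bochner_integral lborel (\<lambda>u. gamma_weight \<nu> u * (u powr p * exp (- c * u)))
           (Gamma (\<nu> + p) / Gamma \<nu> * (1 + c) powr (- (\<nu> + p)))"
proof -
  have "has_bochner_integral lborel (\<lambda>u. (1 / Gamma \<nu>) * (indicator {0<..} u * (u powr (\<nu> + p - 1) * exp (- (1 + c) * u))))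
      ((1 / Gamma \<nu>) * (Gamma (\<nu> + p) / (1 + c) powr (\<nu> + p)))"
    using assms by (intro has_bochner_integral_mult_right has_bochner_integral_Gamma_scaled) auto
  moreover have "(1 / Gamma \<nu>) * (indicator {0<..} u * (u powr (\<nu> + p - 1) * exp (- (1 + c) * u))) =
     gamma_weight \<nu> u * (u powr p * exp (- c * u))" for u
    by (cases "u > 0") (auto simp: gamma_weight_def powr_add powr_diff exp_add[symmetric] algebra_simps)
  moreover have "(1 / Gamma \<nu>) * (Gamma (\<nu> + p) / (1 + c) powr (\<nu> + p)) = Gamma (\<nu> + p) / Gamma \<nu> * (1 + c) powr (- (\<nu> + p))"
    by (simp only: powr_minus divide_inverse mult_1_left ac_simps)
  ultimately show ?thesis by (simp only:)
qed

lemma power2_powr: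
  assumes "a > (0::real)"
  shows "(a\<^sup>2) powr p = a powr (2 * p)"
proof -
  have "a\<^sup>2 = a powr 2" using assms by simp
  thus ?thesis by (simp only: powr_powr)
qed

text \<open>Built from the frequency side: \<open>matern_density\<close> is itself a mixture of
  Gaussians in frequency, and each of them transforms to a Gaussian in space. No inversion theorem
  is involved.\<close>

lemma gauss_mix_spectral:
  fixes y :: "'a::euclidean_space"
  assumes a: "a > 0" and \<nu>: "\<nu> > 0"
  shows "has_bochner_integral lborel (\<lambda>\<omega>::'a. matern_density a \<nu> \<omega> *\<^sub>R cis (\<omega> \<bullet> y)) (complex_of_real (gauss_mix a \<nu> y))"
proof -
  define d where "d = real DIM('a)"
  have d0: "d \<ge> 0" by (simp add: d_def)
  \<comment> \<open>The extra power of \<open>u\<close> cancels the factor (pi / s)^(d/2) produced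
    by the frequency Gaussians, so that exactly \<open>gamma_weight\<close> is left in
    space.\<close>
  define w where "w u = gamma_weight \<nu> u * (u / (a\<^sup>2 * pi)) powr (d / 2)" for u
  define s where "s u = u / a\<^sup>2" for u :: real
  have ws: "w u * (pi / s u) powr (d / 2) = gamma_weight \<nu> u" for u
  proof (cases "u > 0")
    case True
    have "(u / (a\<^sup>2 * pi)) powr (d / 2) * (pi / s u) powr (d / 2) = ((u / (a\<^sup>2 * pi)) * (pi / s u)) powr (d/2)"
      by (rule powr_mult[symmetric])
    also have "(u / (a\<^sup>2 * pi)) * (pi / s u) = 1"
      using True a by (simp add: s_def field_simps)
    finally show ?thesis using True by (simp add: w_def)
  qed (auto simp: w_def gamma_weight_eq_0)
  have gw: "integrable lborel (gamma_weight \<nu>)"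
    using has_bochner_integral_gamma_weight[OF \<nu>, of 0 0] unfolding has_bochner_integral_iff
    by (auto simp: gamma_weight_def elim!: Bochner_Integration.integrable_cong[THEN iffD1, rotated -1])
  have "has_bochner_integral lborel
      (\<lambda>v::'a. (LINT u|lborel. w u * exp (- s u * (norm v)\<^sup>2)) *\<^sub>R cis (v \<bullet> y))
      (complex_of_real (LINT u|lborel. w u * (pi / s u) powr (d / 2) * exp (- (norm y)\<^sup>2 / (4 * s u))))"
    unfolding d_def
  proof (rule has_bochner_integral_gauss_mixture_cis)
    show "w \<in> borel_measurable borel" "s \<in> borel_measurable borel"
      unfolding w_def s_def by measurable
    show "w u \<ge> 0" for u using gamma_weight_nonneg[OF \<nu>] by (simp add: w_def)
    show "s u > 0" if "w u \<noteq> 0" for u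
      using that a gamma_weight_eq_0[of u \<nu>] by (cases "u > 0") (auto simp: w_def s_def)
    show "integrable lborel (\<lambda>u. w u * (pi / s u) powr (real DIM('a) / 2))"
      using gw unfolding d_def[symmetric] ws by simp
  qed
  moreover have "(LINT u|lborel. w u * exp (- s u * (norm v)\<^sup>2)) = matern_density a \<nu> v" for v :: 'a
  proof -
    have "has_bochner_integral lborel (\<lambda>u. (1 / (a\<^sup>2 * pi)) powr (d / 2) * (gamma_weight \<nu> u * (u powr (d/2) * exp (- ((norm v)\<^sup>2 / a\<^sup>2) * u))))
       ((1 / (a\<^sup>2 * pi)) powr (d / 2) * (Gamma (\<nu> + d/2) / Gamma \<nu> * (1 + (norm v)\<^sup>2 / a\<^sup>2) powr (- (\<nu> + d/2))))"
      using \<nu> d0 by (intro has_bochner_integral_mult_right has_bochner_integral_gamma_weight) auto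
    moreover have "(1 / (a\<^sup>2 * pi)) powr (d / 2) * (gamma_weight \<nu> u * (u powr (d/2) * exp (- ((norm v)\<^sup>2 / a\<^sup>2) * u))) =
       w u * exp (- s u * (norm v)\<^sup>2)" for u
      using a by (cases "u > 0") (auto simp: w_def s_def gamma_weight_eq_0 powr_divide powr_mult field_simps)
    ultimately have "has_bochner_integral lborel (\<lambda>u. w u * exp (- s u * (norm v)\<^sup>2))
       ((1 / (a\<^sup>2 * pi)) powr (d / 2) * (Gamma (\<nu> + d/2) / Gamma \<nu> * (1 + (norm v)\<^sup>2 / a\<^sup>2) powr (- (\<nu> + d/2))))"
      by (simp only:)
    hence "(LINT u|lborel. w u * exp (- s u * (norm v)\<^sup>2)) =
       (1 / (a\<^sup>2 * pi)) powr (d / 2) * (Gamma (\<nu> + d/2) / Gamma \<nu> * (1 + (norm v)\<^sup>2 / a\<^sup>2) powr (- (\<nu> + d/2)))"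
      by (rule has_bochner_integral_integral_eq)
    also have "1 + (norm v)\<^sup>2 / a\<^sup>2 = (a\<^sup>2 + (norm v)\<^sup>2) / a\<^sup>2"
      using a by (simp add: field_simps)
    also have "\<dots> powr (- (\<nu> + d/2)) = (a\<^sup>2 + (norm v)\<^sup>2) powr (- (\<nu> + d/2)) * a powr (2 * \<nu> + d)"
    proof -
      have "(a\<^sup>2) powr (- (\<nu> + d/2)) = a powr (- (2 * \<nu> + d))"
        unfolding power2_powr[OF a] by (rule arg_cong[where f="\<lambda>p. a powr p"]) simp
      thus ?thesis by (simp only: powr_divide) (simp only: powr_minus[of a] divide_inverse inverse_inverse_eq)
    qed
    also have "(1 / (a\<^sup>2 * pi)) powr (d / 2) = a powr (- d) * pi powr (- (d / 2))"
    proof -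
      have "(a\<^sup>2) powr (d/2) = a powr d"
        using a by (simp add: power2_powr)
      thus ?thesis using a by (simp add: powr_divide powr_mult powr_minus divide_simps)
    qed
    finally have L: "(LINT u|lborel. w u * exp (- s u * (norm v)\<^sup>2)) = a powr (- d) * pi powr (- (d / 2)) *
        (Gamma (\<nu> + d / 2) / Gamma \<nu> * ((a\<^sup>2 + (norm v)\<^sup>2) powr (- (\<nu> + d / 2)) * a powr (2 * \<nu> + d)))" .
    have "a powr (2 * \<nu>) = a powr (- d) * a powr (2 * \<nu> + d)"
      by (simp flip: powr_add)
    thus ?thesis
      unfolding L matern_density_def d_def[symmetric] by (simp add: powr_minus[of pi] field_simps)
  qed
  moreover have "(LINT u|lborel. w u * (pi / s u) powr (d / 2) * exp (- (norm y)\<^sup>2 / (4 * s u))) = gauss_mix a \<nu> y"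
    unfolding gauss_mix_def ws by (intro Bochner_Integration.integral_cong) (auto simp: s_def power_mult_distrib)
  ultimately show ?thesis by simp
qed

text \<open>The opposite direction, starting from the mixture in space; it gives access to the
  hypotheses stated through \<open>fourier_transform\<close>.\<close>

lemma gauss_mix_fourier:
  fixes y :: "'a::euclidean_space"
  assumes a: "a > 0" and \<nu>: "\<nu> > 0"
  shows "has_bochner_integral lborel (\<lambda>x::'a. gauss_mix a \<nu> x *\<^sub>R cis (x \<bullet> y))
     (complex_of_real ((4 * pi / a\<^sup>2) powr (real DIM('a) / 2) * Gamma (\<nu> + real DIM('a) / 2) / Gamma \<nu> *
        (1 + (norm y)\<^sup>2 / a\<^sup>2) powr (- (\<nu> + real DIM('a) / 2))))"
proof -
  define d where "d = real DIM('a)"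
  have d0: "d \<ge> 0" by (simp add: d_def)
  define s where "s u = a\<^sup>2 / (4 * u)" for u :: real
  have ws: "gamma_weight \<nu> u * (pi / s u) powr (d / 2) = (4 * pi / a\<^sup>2) powr (d / 2) * (gamma_weight \<nu> u * u powr (d/2))" for u
    using a by (cases "u > 0") (auto simp: gamma_weight_eq_0 s_def powr_divide powr_mult divide_simps)
  have I: "has_bochner_integral lborel (\<lambda>u. (4 * pi / a\<^sup>2) powr (d / 2) * (gamma_weight \<nu> u * (u powr (d/2) * exp (- c * u))))
     ((4 * pi / a\<^sup>2) powr (d / 2) * (Gamma (\<nu> + d/2) / Gamma \<nu> * (1 + c) powr (- (\<nu> + d/2))))" if "c \<ge> 0" for c
    using \<nu> d0 that by (intro has_bochner_integral_mult_right has_bochner_integral_gamma_weight) auto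
  have "has_bochner_integral lborel
      (\<lambda>v::'a. (LINT u|lborel. gamma_weight \<nu> u * exp (- s u * (norm v)\<^sup>2)) *\<^sub>R cis (v \<bullet> y))
      (complex_of_real (LINT u|lborel. gamma_weight \<nu> u * (pi / s u) powr (d / 2) * exp (- (norm y)\<^sup>2 / (4 * s u))))"
    unfolding d_def
  proof (rule has_bochner_integral_gauss_mixture_cis)
    show "s \<in> borel_measurable borel" unfolding s_def by measurable
    show "gamma_weight \<nu> u \<ge> 0" for u using gamma_weight_nonneg[OF \<nu>] by simp
    show "s u > 0" if "gamma_weight \<nu> u \<noteq> 0" for u
      using that a gamma_weight_eq_0[of u \<nu>] by (cases "u > 0") (auto simp: s_def)
    show "integrable lborel (\<lambda>u. gamma_weight \<nu> u * (pi / s u) powr (real DIM('a) / 2))"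
      unfolding d_def[symmetric] ws using I[of 0] by (simp add: has_bochner_integral_iff)
  qed measurable
  moreover have "(LINT u|lborel. gamma_weight \<nu> u * exp (- s u * (norm v)\<^sup>2)) = gauss_mix a \<nu> v" for v :: 'a
    unfolding gauss_mix_def by (intro Bochner_Integration.integral_cong) (auto simp: s_def power_mult_distrib)
  moreover have "(LINT u|lborel. gamma_weight \<nu> u * (pi / s u) powr (d / 2) * exp (- (norm y)\<^sup>2 / (4 * s u))) =
     ((4 * pi / a\<^sup>2) powr (d / 2) * (Gamma (\<nu> + d/2) / Gamma \<nu> * (1 + (norm y)\<^sup>2 / a\<^sup>2) powr (- (\<nu> + d/2))))"
  proof -
    have "gamma_weight \<nu> u * (pi / s u) powr (d / 2) * exp (- (norm y)\<^sup>2 / (4 * s u)) =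
      (4 * pi / a\<^sup>2) powr (d / 2) * (gamma_weight \<nu> u * (u powr (d/2) * exp (- ((norm y)\<^sup>2 / a\<^sup>2) * u)))" for u
      unfolding ws using a by (simp add: s_def)
    thus ?thesis using has_bochner_integral_integral_eq[OF I[of "(norm y)\<^sup>2 / a\<^sup>2"]] by (simp only:) simp
  qed
  ultimately show ?thesis
    unfolding d_def[symmetric] by (simp only: times_divide_eq_left times_divide_eq_right mult.assoc)
qed

section \<open>The Bessel function as a mixture integral\<close>

lemma besselK_eq_whole_line:
  assumes int: "integrable lborel (\<lambda>t. exp (\<nu> * t - z * cosh t))"
  shows "besselK \<nu> z = (LINT t|lborel. exp (\<nu> * t - z * cosh t)) / 2"
proof -
  let ?f = "\<lambda>t. exp (\<nu> * t - z * cosh t)"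
  have fm: "integrable lborel (\<lambda>t. ?f (- t))"
    using lborel_integrable_real_affine[OF int, of "-1" 0] by simp
  have 1: "integrable lborel (\<lambda>t. indicator {0..} t * ?f t)"
    using integrable_real_mult_indicator[OF _ int, of "{0..}"] by (simp add: mult.commute)
  have 2: "integrable lborel (\<lambda>t. indicator {0..} t * ?f (- t))"
    using integrable_real_mult_indicator[OF _ fm, of "{0..}"] by (simp add: mult.commute)
  have 3: "integrable lborel (\<lambda>t. indicator {..0} t * ?f t)"
    using integrable_real_mult_indicator[OF _ int, of "{..0}"] by (simp add: mult.commute)
  have "(LINT t|lborel. indicator {0..} t * ?f (- t)) = (LINT t|lborel. indicator {..0} t * ?f t)"
    using lborel_integral_real_affine[of "-1" "\<lambda>t. indicator {..0} t * ?f t" 0]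
    by (simp add: indicator_def)
  hence "(LINT t|lborel. indicator {0..} t * ?f t) + (LINT t|lborel. indicator {0..} t * ?f (- t)) =
     (LINT t|lborel. indicator {0..} t * ?f t + indicator {..0} t * ?f t)"
    using 1 3 by simp
  also have "\<dots> = (LINT t|lborel. ?f t)"
  \<comment> \<open>The two closed half-lines overlap in 0, so the integrands agree only off a null
    set.\<close>
  proof (rule integral_cong_AE)
    have "AE t in lborel. t \<noteq> (0::real)" by (rule AE_lborel_singleton)
    thus "AE t in lborel. indicator {0..} t * ?f t + indicator {..0} t * ?f t = ?f t"
      by eventually_elim (auto simp: indicator_def)
  qed (use 1 3 int in auto)
  finally have "(LINT t|lborel. ?f t) = (LINT t|lborel. indicator {0..} t * ?f t + indicator {0..} t * ?f (- t))"
    using 1 2 by simp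
  also have "\<dots> = (LINT t|lborel. 2 * (indicator {0..} t *\<^sub>R (exp (- z * cosh t) * cosh (\<nu> * t))))"
  proof (intro Bochner_Integration.integral_cong refl)
    fix t :: real
    have "exp (p - q) + exp (- p - q) = 2 * (exp (- q) * cosh p)" for p q :: real
      by (simp add: cosh_def exp_diff exp_minus field_simps)
    from this[of "\<nu> * t" "z * cosh t"]
    show "indicator {0..} t * ?f t + indicator {0..} t * ?f (- t) =
      2 * (indicator {0..} t *\<^sub>R (exp (- z * cosh t) * cosh (\<nu> * t)))"
      by (simp add: distrib_left[symmetric])
  qed
  also have "\<dots> = 2 * besselK \<nu> z"
    by (simp add: besselK_def set_lebesgue_integral_def)
  finally show ?thesis by simp
qed

text \<open>The substitution u = (z/2) e^t turns Basset's integral into a Gamma-type integral.\<close>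
lemma besselK_eq_gamma_integral:
  assumes z: "z > 0" and \<nu>: "\<nu> > 0"
  shows "z powr \<nu> * besselK \<nu> z =
    2 powr (\<nu> - 1) * (LINT u|lborel. indicator {0<..} u * (u powr (\<nu> - 1) * exp (- u - z\<^sup>2 / (4 * u))))"
proof -
  let ?F = "\<lambda>t. exp (\<nu> * t - z * cosh t)"
  let ?G = "\<lambda>u. u powr (\<nu> - 1) * exp (- u - z\<^sup>2 / (4 * u))"
  define g where "g u = ln (2 * u / z)" for u
  define g' where "g' u = 1 / u" for u :: real
  \<comment> \<open>Under this substitution z cosh(t) becomes u + z^2/(4u), exp(\<nu> t) becomes
    (2u/z)^\<nu>, and the derivative 1/u lowers the exponent of u to \<nu> - 1.\<close>
  have Fg: "?F (g u) * g' u = (2 / z) powr \<nu> * ?G u" if "u > 0" for u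
  proof -
    have "cosh (g u) = (2 * u / z + z / (2 * u)) / 2"
      using that z unfolding g_def by (subst cosh_ln_real) (auto simp: field_simps)
    hence "z * cosh (g u) = u + z\<^sup>2 / (4 * u)"
      using that z by (simp add: field_simps power2_eq_square)
    moreover have "exp (\<nu> * g u) = (2 / z) powr \<nu> * u powr \<nu>"
      using that z by (simp add: g_def powr_def exp_add[symmetric] ln_mult ln_div algebra_simps)
    moreover have "- u - z\<^sup>2 / (4 * u) = - (u + z\<^sup>2 / (4 * u))" by simp
    ultimately show ?thesis
      using that by (simp only: exp_diff exp_minus g'_def powr_diff) (simp add: field_simps)
  qed
  have intG: "integrable lborel (\<lambda>u. indicator {0<..} u * ?G u)"
  proof (rule Bochner_Integration.integrable_bound)
    show "integrable lborel (\<lambda>u. indicator {0<..} u * (u powr (\<nu> - 1) * exp (- 1 * u)))"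
      using has_bochner_integral_Gamma_scaled[OF \<nu>, of 1] by (simp add: has_bochner_integral_iff)
  qed (auto simp: indicator_def intro!: AE_I2 mult_left_mono)
  have ei: "einterval 0 \<infinity> = {0<..}" "einterval (-\<infinity>) \<infinity> = (UNIV :: real set)"
    by (auto simp: einterval_def)
  have int: "set_integrable lborel (einterval 0 \<infinity>) (\<lambda>u. ?F (g u) * g' u)"
    unfolding set_integrable_def ei
  proof (rule Bochner_Integration.integrable_cong[THEN iffD1, OF refl])
    show "integrable lborel (\<lambda>u. (2 / z) powr \<nu> * (indicator {0<..} u * ?G u))"
      by (intro integrable_mult_right intG)
    fix u :: real
    show "(2 / z) powr \<nu> * (indicator {0<..} u * ?G u) = indicator {0<..} u *\<^sub>R (?F (g u) * g' u)"
      by (cases "u > 0") (simp_all add: Fg)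
  qed
  have A: "((ereal \<circ> g \<circ> real_of_ereal) \<longlongrightarrow> -\<infinity>) (at_right 0)"
    unfolding zero_ereal_def ereal_tendsto_simps g_def using z by real_asymp
  have B: "((ereal \<circ> g \<circ> real_of_ereal) \<longlongrightarrow> \<infinity>) (at_left \<infinity>)"
    unfolding ereal_tendsto_simps g_def using z by real_asymp
  note subst = interval_integral_substitution_nonneg[where f="?F" and g=g and g'=g' and a=0 and b="\<infinity>", OF _ _ _ _ _ _ A B int]
  have deriv: "DERIV g u :> g' u" if "0 < u" for u
    using that z unfolding g_def g'_def by (auto intro!: derivative_eq_intros simp: field_simps)
  have contg': "isCont g' u" if "0 < u" for u
    using that unfolding g'_def by (auto intro!: continuous_intros)
  have contF: "isCont ?F v" for v
    by (intro continuous_intros)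
  have "set_integrable lborel (einterval (-\<infinity>) \<infinity>) ?F"
    by (rule subst(1)) (use deriv contg' contF in \<open>auto simp: g'_def\<close>)
  hence intF: "integrable lborel ?F" by (simp add: ei set_integrable_def)
  have "(LBINT t=-\<infinity>..\<infinity>. ?F t) = (LBINT u=0..\<infinity>. ?F (g u) * g' u)"
    by (rule subst(2)) (use deriv contg' contF in \<open>auto simp: g'_def\<close>)
  hence "(LINT t|lborel. ?F t) = (LINT u|lborel. indicator {0<..} u *\<^sub>R (?F (g u) * g' u))"
    by (simp add: interval_lebesgue_integral_def ei set_lebesgue_integral_def)
  also have "\<dots> = (LINT u|lborel. (2 / z) powr \<nu> * (indicator {0<..} u * ?G u))"
    by (intro Bochner_Integration.integral_cong) (auto simp: Fg indicator_def)
  also have "\<dots> = (2 / z) powr \<nu> * (LINT u|lborel. indicator {0<..} u * ?G u)" by simp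
  finally have "besselK \<nu> z = (2 / z) powr \<nu> * (LINT u|lborel. indicator {0<..} u * ?G u) / 2"
    unfolding besselK_eq_whole_line[OF intF] by simp
  thus ?thesis
    using z by (simp add: powr_divide powr_diff)
qed

lemma has_bochner_integral_gamma_weight_1:
  assumes "\<nu> > 0"
  shows "has_bochner_integral lborel (gamma_weight \<nu>) 1"
proof -
  have "gamma_weight \<nu> u * (u powr 0 * exp (- 0 * u)) = gamma_weight \<nu> u" for u
    by (simp add: gamma_weight_def)
  hence "has_bochner_integral lborel (gamma_weight \<nu>) (Gamma (\<nu> + 0) / Gamma \<nu> * (1 + 0) powr - (\<nu> + 0))"
    using has_bochner_integral_gamma_weight[of \<nu> 0 0] assms by (simp only: order_refl)
  moreover have "Gamma \<nu> \<noteq> 0" using Gamma_real_pos[OF assms] by linarith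
  ultimately show ?thesis by simp
qed

lemma gauss_mix_0 [simp]: "\<nu> > 0 \<Longrightarrow> gauss_mix a \<nu> 0 = 1"
  using has_bochner_integral_integral_eq[OF has_bochner_integral_gamma_weight_1] by (simp add: gauss_mix_def)

text \<open>The value 1 prescribed at the origin is the total mass of the Gamma weight, so the
  identity has no exceptional point and all analysis can be done on
  \<open>gauss_mix\<close>.\<close>

lemma matern_eq_gauss_mix:
  fixes x :: "'a::euclidean_space"
  assumes "\<phi> > 0" "\<nu> > 0"
  shows "matern \<phi> \<nu> x = gauss_mix (2 * sqrt \<nu> * \<phi>) \<nu> x"
proof (cases "x = 0")
  case False
  define z where "z = 2 * sqrt \<nu> * \<phi> * norm x"
  have z: "z > 0" using assms False by (simp add: z_def)
  have "matern \<phi> \<nu> x = (LINT u|lborel. indicator {0<..} u * (u powr (\<nu> - 1) * exp (- u - z\<^sup>2 / (4 * u)))) / Gamma \<nu>"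
    using False besselK_eq_gamma_integral[OF z assms(2)] by (simp add: matern_def z_def[symmetric])
  also have "\<dots> = gauss_mix (2 * sqrt \<nu> * \<phi>) \<nu> x"
    unfolding gauss_mix_def integral_divide_zero[symmetric]
  proof (intro Bochner_Integration.integral_cong refl)
    fix u :: real
    have "exp (- u - z\<^sup>2 / (4 * u)) = exp (- u) * exp (- (2 * sqrt \<nu> * \<phi> * norm x)\<^sup>2 / (4 * u))"
      by (simp add: z_def flip: exp_add)
    thus "indicator {0<..} u * (u powr (\<nu> - 1) * exp (- u - z\<^sup>2 / (4 * u))) / Gamma \<nu> =
      gamma_weight \<nu> u * exp (- (2 * sqrt \<nu> * \<phi> * norm x)\<^sup>2 / (4 * u))"
      by (simp add: gamma_weight_def)
  qed
  finally show ?thesis .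
qed (use assms in \<open>simp add: matern_def\<close>)

section \<open>Spectral representation of quadratic forms\<close>

lemma integrable_matern_density:
  assumes "a > 0" "\<nu> > 0"
  shows "has_bochner_integral lborel (matern_density a \<nu> :: 'a::euclidean_space \<Rightarrow> real) 1"
  using has_bochner_integral_Re[OF gauss_mix_spectral[OF assms, of "0::'a"]] assms by simp

lemma matern_density_nonneg: "\<nu> > 0 \<Longrightarrow> matern_density a \<nu> \<omega> \<ge> 0"
  unfolding matern_density_def
  by (intro mult_nonneg_nonneg divide_nonneg_nonneg Gamma_real_nonneg add_nonneg_nonneg) auto

lemma matern_density_measurable [measurable]: "matern_density a \<nu> \<in> borel_measurable borel"
  unfolding matern_density_def by measurable

section \<open>Fourier decay determines the smoothness exponent\<close>

lemma norm_surj: "r \<ge> 0 \<Longrightarrow> \<exists>x::'a::euclidean_space. norm x = r"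
  using norm_Basis SOME_Basis by (metis abs_of_nonneg mult.right_neutral norm_scaleR)

lemma powr_bounded_imp_nonpos:
  fixes e K :: real
  assumes "\<And>s. s \<ge> 1 \<Longrightarrow> s powr e \<le> K"
  shows "e \<le> 0"
proof (rule ccontr)
  assume "\<not> e \<le> 0"
  hence "e > 0" by simp
  define s where "s = (max 1 (K + 1)) powr (1 / e)"
  have "s \<ge> 1" unfolding s_def using \<open>e > 0\<close> by (intro ge_one_powr_ge_zero) auto
  moreover have "s powr e = max 1 (K + 1)" using \<open>e > 0\<close> by (simp add: s_def powr_powr)
  ultimately show False using assms[of s] by simp
qed

lemma fourier_transform_matern:
  fixes \<omega> :: "'a::euclidean_space"
  assumes "\<phi> > 0" "\<nu> > 0"
  defines "a \<equiv> 2 * sqrt \<nu> * \<phi>"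
  obtains k where "k > 0" "\<And>\<omega>::'a. Re (fourier_transform (matern \<phi> \<nu>) \<omega>) = k * (1 + (norm \<omega>)\<^sup>2 / a\<^sup>2) powr (- (\<nu> + real DIM('a) / 2))"
proof -
  have a: "a > 0" using assms by (simp add: a_def)
  define k where "k = (2 * pi) powr (- real DIM('a) / 2) * ((4 * pi / a\<^sup>2) powr (real DIM('a) / 2) * Gamma (\<nu> + real DIM('a) / 2) / Gamma \<nu>)"
  have "k > 0" using a assms by (auto simp: k_def intro!: mult_pos_pos divide_pos_pos Gamma_real_pos add_pos_pos)
  moreover have "Re (fourier_transform (matern \<phi> \<nu>) \<omega>) = k * (1 + (norm \<omega>)\<^sup>2 / a\<^sup>2) powr (- (\<nu> + real DIM('a) / 2))" for \<omega> :: 'a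
  proof -
    have "matern \<phi> \<nu> = (gauss_mix a \<nu> :: 'a \<Rightarrow> real)"
      unfolding a_def using assms by (intro ext matern_eq_gauss_mix)
    hence "(LINT x|lborel. complex_of_real (matern \<phi> \<nu> x) * cis (- (x \<bullet> \<omega>))) =
       complex_of_real ((4 * pi / a\<^sup>2) powr (real DIM('a) / 2) * Gamma (\<nu> + real DIM('a) / 2) / Gamma \<nu> *
        (1 + (norm \<omega>)\<^sup>2 / a\<^sup>2) powr (- (\<nu> + real DIM('a) / 2)))"
      using has_bochner_integral_integral_eq[OF gauss_mix_fourier[OF a assms(2), of "- \<omega>"]]
      by (simp add: scaleR_conv_of_real)
    thus ?thesis
      unfolding fourier_transform_def k_def
      by (simp only: Re_complex_of_real mult.assoc flip: of_real_mult)
  qed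
  ultimately show ?thesis by (rule that)
qed

text \<open>The transform decays exactly like |\<omega>|^(-2\<nu>-d); letting |\<omega>| grow in
  each of the two assumed inequalities forces the exponents to agree. This ties the exponents
  assumed in the theorem to the Matern parameters.\<close>

lemma matern_smoothness_unique:
  fixes m \<phi> \<nu> c1 c2 :: real
  assumes "\<phi> > 0" "\<nu> > 0" "c1 > 0" "c2 > 0"
   and lo: "\<And>\<omega>::'a::euclidean_space. c1 * (1 + (norm \<omega>)\<^sup>2) powr (- m) \<le> Re (fourier_transform (matern \<phi> \<nu>) \<omega>)"
   and up: "\<And>\<omega>::'a. Re (fourier_transform (matern \<phi> \<nu>) \<omega>) \<le> c2 * (1 + (norm \<omega>)\<^sup>2) powr (- m)"
  shows "m = \<nu> + real DIM('a) / 2"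
proof -
  define a where "a = 2 * sqrt \<nu> * \<phi>"
  define p where "p = \<nu> + real DIM('a) / 2"
  have a: "a > 0" using assms by (simp add: a_def)
  have p: "p > 0" using assms by (simp add: p_def add_pos_pos)
  obtain k where k: "k > 0" "\<And>\<omega>::'a. Re (fourier_transform (matern \<phi> \<nu>) \<omega>) = k * (1 + (norm \<omega>)\<^sup>2 / a\<^sup>2) powr (- p)"
    using fourier_transform_matern[OF assms(1,2), where 'a='a] unfolding a_def p_def by blast
  \<comment> \<open>With s = 1 + |\<omega>|^2, these constants sandwich 1 + |\<omega>|^2/a^2 between
    \<open>b1 * s\<close> and \<open>b2 * s\<close>.\<close>
  define b1 b2 where "b1 = min 1 (1 / a\<^sup>2)" and "b2 = max 1 (1 / a\<^sup>2)"
  have b: "b1 > 0" "b2 > 0" using a by (auto simp: b1_def b2_def)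
  have bounds: "c1 * s powr (- m) \<le> k * (b1 * s) powr (- p)" "k * (b2 * s) powr (- p) \<le> c2 * s powr (- m)"
    if s: "s \<ge> 1" for s
  proof -
    obtain \<omega> :: 'a where "norm \<omega> = sqrt (s - 1)" using norm_surj[of "sqrt (s - 1)"] s by auto
    hence w: "1 + (norm \<omega>)\<^sup>2 = s" "1 + (norm \<omega>)\<^sup>2 / a\<^sup>2 = 1 + (s - 1) / a\<^sup>2" using s by auto
    have "b1 * s \<le> 1 + (s - 1) / a\<^sup>2"
    proof -
      have "b1 * 1 + b1 * (s - 1) \<le> 1 * 1 + (1 / a\<^sup>2) * (s - 1)"
        using s by (intro add_mono mult_right_mono) (auto simp: b1_def)
      thus ?thesis by (simp add: algebra_simps)
    qed
    hence "(1 + (s - 1) / a\<^sup>2) powr (- p) \<le> (b1 * s) powr (- p)"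
      using p b s by (intro powr_mono2') auto
    hence "k * (1 + (s - 1) / a\<^sup>2) powr (- p) \<le> k * (b1 * s) powr (- p)" using k by simp
    thus "c1 * s powr (- m) \<le> k * (b1 * s) powr (- p)"
      using lo[of \<omega>] unfolding k w by linarith
    have "1 + (s - 1) / a\<^sup>2 \<le> b2 * s"
    proof -
      have "1 * 1 + (1 / a\<^sup>2) * (s - 1) \<le> b2 * 1 + b2 * (s - 1)"
        using s by (intro add_mono mult_right_mono) (auto simp: b2_def)
      thus ?thesis by (simp add: algebra_simps)
    qed
    moreover have "1 + (s - 1) / a\<^sup>2 > 0" using s a by (intro add_pos_nonneg) auto
    ultimately have "(b2 * s) powr (- p) \<le> (1 + (s - 1) / a\<^sup>2) powr (- p)"
      using p b s by (intro powr_mono2') auto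
    hence "k * (b2 * s) powr (- p) \<le> k * (1 + (s - 1) / a\<^sup>2) powr (- p)" using k by simp
    thus "k * (b2 * s) powr (- p) \<le> c2 * s powr (- m)"
      using up[of \<omega>] unfolding k w by linarith
  qed
  have "s powr (p - m) \<le> k * b1 powr (- p) / c1" if s: "s \<ge> 1" for s
  proof -
    have "s powr p * (c1 * s powr (- m)) \<le> s powr p * (k * (b1 powr (- p) * s powr (- p)))"
      using bounds(1)[OF s] by (intro mult_left_mono) (auto simp: powr_mult)
    also have "\<dots> = k * b1 powr (- p) * (s powr p * s powr (-p))" by simp
    also have "s powr p * s powr (-p) = 1" using s by (simp flip: powr_add)
    also have "s powr p * (c1 * s powr (- m)) = c1 * s powr (p - m)"
      using s by (simp add: powr_diff powr_minus divide_inverse)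
    finally show ?thesis using assms(3) by (simp add: field_simps)
  qed
  hence "p - m \<le> 0" by (rule powr_bounded_imp_nonpos)
  moreover have "s powr (m - p) \<le> c2 / (k * b2 powr (- p))" if s: "s \<ge> 1" for s
  proof -
    have "s powr m * (k * (b2 powr (- p) * s powr (- p))) \<le> s powr m * (c2 * s powr (- m))"
      using bounds(2)[OF s] by (intro mult_left_mono) (auto simp: powr_mult)
    also have "\<dots> = c2 * (s powr m * s powr (-m))" by simp
    also have "s powr m * s powr (-m) = 1" using s by (simp flip: powr_add)
    also have "s powr m * (k * (b2 powr (- p) * s powr (- p))) = (k * b2 powr (- p)) * s powr (m - p)"
      using s by (simp add: powr_diff powr_minus[of s] divide_inverse)
    finally show ?thesis using k b by (simp add: pos_le_divide_eq mult.commute)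
  qed
  hence "m - p \<le> 0" by (rule powr_bounded_imp_nonpos)
  ultimately show ?thesis by (simp add: p_def)
qed

section \<open>Prediction variances in frequency space\<close>

definition quad_form :: "('a::euclidean_space \<Rightarrow> real) \<Rightarrow> nat \<Rightarrow> (nat \<Rightarrow> 'a) \<Rightarrow> (nat \<Rightarrow> real) \<Rightarrow> real" where
  "quad_form K n p w = (\<Sum>j<n. \<Sum>k<n. w j * w k * K (p j - p k))"

text \<open>The variance of Z(x) - \<Sum> w_k Z(p_k) under the stationary covariance K. The weights
  are arbitrary, so the same expression serves both kernels and the auxiliary one of short length
  scale.\<close>

definition pred_var :: "('a::euclidean_space \<Rightarrow> real) \<Rightarrow> nat \<Rightarrow> (nat \<Rightarrow> 'a) \<Rightarrow> (nat \<Rightarrow> real) \<Rightarrow> 'a \<Rightarrow> real" where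
  "pred_var K n p w x = K 0 - 2 * (\<Sum>k<n. w k * K (x - p k)) + quad_form K n p w"

text \<open>The Fourier symbol of the functional g \<mapsto> \<Sum> w_k g(p_k).\<close>

definition exp_sum :: "nat \<Rightarrow> (nat \<Rightarrow> 'a::euclidean_space) \<Rightarrow> (nat \<Rightarrow> real) \<Rightarrow> 'a \<Rightarrow> complex" where
  "exp_sum n p w \<omega> = (\<Sum>k<n. w k *\<^sub>R cis (\<omega> \<bullet> p k))"

lemma exp_sum_measurable [measurable]: "exp_sum n p w \<in> borel_measurable borel"
  unfolding exp_sum_def[abs_def] by measurable

lemma gauss_mix_spectral_Re:
  fixes y :: "'a::euclidean_space"
  assumes "a > 0" "\<nu> > 0"
  shows "has_bochner_integral lborel (\<lambda>\<omega>. matern_density a \<nu> \<omega> * Re (cis (\<omega> \<bullet> y))) (gauss_mix a \<nu> y)"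
  using has_bochner_integral_Re[OF gauss_mix_spectral[OF assms, of y]] by simp

lemma quad_form_spectral:
  fixes p :: "nat \<Rightarrow> 'a::euclidean_space"
  assumes "a > 0" "\<nu> > 0"
  shows "has_bochner_integral lborel (\<lambda>\<omega>. matern_density a \<nu> \<omega> * (cmod (exp_sum n p w \<omega>))\<^sup>2)
           (quad_form (gauss_mix a \<nu>) n p w)"
proof -
  have "has_bochner_integral lborel (\<lambda>\<omega>. \<Sum>j<n. \<Sum>k<n. w j * w k * (matern_density a \<nu> \<omega> * Re (cis (\<omega> \<bullet> (p j - p k)))))
           (quad_form (gauss_mix a \<nu>) n p w)"
    unfolding quad_form_def
    by (intro has_bochner_integral_sum has_bochner_integral_mult_right gauss_mix_spectral_Re assms)
  moreover have "(\<Sum>j<n. \<Sum>k<n. w j * w k * (matern_density a \<nu> \<omega> * Re (cis (\<omega> \<bullet> (p j - p k))))) =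
     matern_density a \<nu> \<omega> * (cmod (exp_sum n p w \<omega>))\<^sup>2" for \<omega>
  proof -
    have "(cmod (exp_sum n p w \<omega>))\<^sup>2 = Re (exp_sum n p w \<omega> * cnj (exp_sum n p w \<omega>))"
      by (simp add: complex_mult_cnj cmod_power2)
    also have "exp_sum n p w \<omega> * cnj (exp_sum n p w \<omega>) = (\<Sum>j<n. \<Sum>k<n. (w j * w k) *\<^sub>R cis (\<omega> \<bullet> (p j - p k)))"
      unfolding exp_sum_def cnj_sum sum_product
      by (intro sum.cong refl) (auto simp: scaleR_conv_of_real cis_cnj inner_diff_right cis_mult algebra_simps)
    finally show ?thesis by (simp add: sum_distrib_left algebra_simps)
  qed
  ultimately show ?thesis by simp
qed

text \<open>Expanding the squared modulus gives the three terms of \<open>pred_var\<close>. That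
  modulus does not involve the kernel, so a pointwise comparison of spectral densities becomes a
  comparison of prediction variances with the same weights.\<close>

lemma pred_var_spectral:
  fixes p :: "nat \<Rightarrow> 'a::euclidean_space"
  assumes "a > 0" "\<nu> > 0"
  shows "has_bochner_integral lborel (\<lambda>\<omega>. matern_density a \<nu> \<omega> * (cmod (cis (\<omega> \<bullet> x) - exp_sum n p w \<omega>))\<^sup>2)
           (pred_var (gauss_mix a \<nu>) n p w x)"
proof -
  have "has_bochner_integral lborel (\<lambda>\<omega>. matern_density a \<nu> \<omega> - 2 * (\<Sum>k<n. w k * (matern_density a \<nu> \<omega> * Re (cis (\<omega> \<bullet> (x - p k)))))
      + matern_density a \<nu> \<omega> * (cmod (exp_sum n p w \<omega>))\<^sup>2)
           (1 - 2 * (\<Sum>k<n. w k * gauss_mix a \<nu> (x - p k)) + quad_form (gauss_mix a \<nu>) n p w)"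
    by (intro has_bochner_integral_sum has_bochner_integral_mult_right has_bochner_integral_add 
        has_bochner_integral_diff gauss_mix_spectral_Re quad_form_spectral integrable_matern_density assms)
  moreover have "matern_density a \<nu> \<omega> - 2 * (\<Sum>k<n. w k * (matern_density a \<nu> \<omega> * Re (cis (\<omega> \<bullet> (x - p k)))))
      + matern_density a \<nu> \<omega> * (cmod (exp_sum n p w \<omega>))\<^sup>2 =
     matern_density a \<nu> \<omega> * (cmod (cis (\<omega> \<bullet> x) - exp_sum n p w \<omega>))\<^sup>2" for \<omega>
  proof -
    have "(cmod (u - v))\<^sup>2 = (cmod u)\<^sup>2 - 2 * Re (u * cnj v) + (cmod v)\<^sup>2" for u v :: complex
      unfolding cmod_power2 by (simp add: power2_eq_square algebra_simps)
    from this[of "cis (\<omega> \<bullet> x)" "exp_sum n p w \<omega>"]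
    have "(cmod (cis (\<omega> \<bullet> x) - exp_sum n p w \<omega>))\<^sup>2 = 1 - 2 * Re (cis (\<omega> \<bullet> x) * cnj (exp_sum n p w \<omega>)) + (cmod (exp_sum n p w \<omega>))\<^sup>2"
      by simp
    also have "cis (\<omega> \<bullet> x) * cnj (exp_sum n p w \<omega>) = (\<Sum>k<n. w k *\<^sub>R cis (\<omega> \<bullet> (x - p k)))"
      unfolding exp_sum_def cnj_sum sum_distrib_left
      by (intro sum.cong refl) (auto simp: scaleR_conv_of_real cis_cnj inner_diff_right cis_mult algebra_simps)
    finally have E: "(cmod (cis (\<omega> \<bullet> x) - exp_sum n p w \<omega>))\<^sup>2 =
      1 - 2 * Re (\<Sum>k<n. w k *\<^sub>R cis (\<omega> \<bullet> (x - p k))) + (cmod (exp_sum n p w \<omega>))\<^sup>2" .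
    show ?thesis unfolding E by (simp add: sum_distrib_left algebra_simps)
  qed
  ultimately show ?thesis using assms by (simp add: pred_var_def)
qed

lemma has_bochner_integral_nonneg:
  fixes f :: "'a \<Rightarrow> real"
  shows "has_bochner_integral M f i \<Longrightarrow> (\<And>x. f x \<ge> 0) \<Longrightarrow> i \<ge> 0"
  by (auto simp: has_bochner_integral_iff)

lemma has_bochner_integral_mono:
  fixes f g :: "'a \<Rightarrow> real"
  shows "has_bochner_integral M f i \<Longrightarrow> has_bochner_integral M g j \<Longrightarrow> (\<And>x. f x \<le> g x) \<Longrightarrow> i \<le> j"
  by (auto simp: has_bochner_integral_iff intro!: integral_mono)

lemma pred_var_nonneg: "a > 0 \<Longrightarrow> \<nu> > 0 \<Longrightarrow> pred_var (gauss_mix a \<nu>) n p w x \<ge> 0"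
  by (rule has_bochner_integral_nonneg[OF pred_var_spectral]) (auto simp: matern_density_nonneg)

lemma quad_form_nonneg: "a > 0 \<Longrightarrow> \<nu> > 0 \<Longrightarrow> quad_form (gauss_mix a \<nu>) n p w \<ge> 0"
  by (rule has_bochner_integral_nonneg[OF quad_form_spectral]) (auto simp: matern_density_nonneg)

text \<open>(|u| + |v|)^2 <= 2|u|^2 + 2|v|^2 under a density of mass 1. It is meant for the kernel
  of short length scale, where no cancellation between Z(x) and its prediction is exploited.\<close>

lemma pred_var_le_quad_form:
  assumes "a > 0" "\<nu> > 0"
  shows "pred_var (gauss_mix a \<nu>) n p w x \<le> 2 + 2 * quad_form (gauss_mix a \<nu>) n p w"
proof (rule has_bochner_integral_mono)
  show "has_bochner_integral lborel (\<lambda>\<omega>. 2 * matern_density a \<nu> \<omega> + 2 * (matern_density a \<nu> \<omega> * (cmod (exp_sum n p w \<omega>))\<^sup>2))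
     (2 + 2 * quad_form (gauss_mix a \<nu>) n p w)"
    using has_bochner_integral_add[OF has_bochner_integral_mult_right[OF integrable_matern_density[OF assms]] 
       has_bochner_integral_mult_right[OF quad_form_spectral[OF assms]], of 2 2] by simp
  show "matern_density a \<nu> \<omega> * (cmod (cis (\<omega> \<bullet> x) - exp_sum n p w \<omega>))\<^sup>2 \<le>
    2 * matern_density a \<nu> \<omega> + 2 * (matern_density a \<nu> \<omega> * (cmod (exp_sum n p w \<omega>))\<^sup>2)" for \<omega>
  proof -
    have "cmod (cis (\<omega> \<bullet> x) - exp_sum n p w \<omega>) \<le> 1 + cmod (exp_sum n p w \<omega>)"
      by (rule order.trans[OF norm_triangle_ineq4]) simp
    hence "(cmod (cis (\<omega> \<bullet> x) - exp_sum n p w \<omega>))\<^sup>2 \<le> (1 + cmod (exp_sum n p w \<omega>))\<^sup>2"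
      by (intro power_mono) auto
    also have "\<dots> \<le> 2 + 2 * (cmod (exp_sum n p w \<omega>))\<^sup>2"
      using sum_squares_bound[of 1 "cmod (exp_sum n p w \<omega>)"] by (simp add: power2_eq_square algebra_simps)
    finally show ?thesis
      using mult_left_mono[OF _ matern_density_nonneg[OF assms(2)]] by (fastforce simp: algebra_simps)
  qed
qed (rule pred_var_spectral[OF assms])

text \<open>Split at |\<omega>| = 1/\<delta>. Above it, 1/\<delta>^2 + |\<omega>|^2 is at most
  2|\<omega>|^2, so the second density has the decay of the left-hand side. Below it, the missing
  power (a0^2 + |\<omega>|^2)^(m-m0) is at most a constant times \<delta>^(-2(m-m0)). The constant
  is uniform in \<delta>.\<close>

lemma matern_density_compare:
  fixes a0 a \<nu>0 \<nu> :: real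
  assumes pos: "a0 > 0" "a > 0" "\<nu>0 > 0" "\<nu>0 \<le> \<nu>"
  obtains C where "C > 0" "\<And>(\<delta>::real) \<omega>. 0 < \<delta> \<Longrightarrow> \<delta> \<le> 1 \<Longrightarrow> matern_density a0 \<nu>0 (\<omega>::'a::euclidean_space) \<le>
    C * (\<delta> powr (- 2 * (\<nu> - \<nu>0)) * matern_density a \<nu> \<omega> + \<delta> powr (2 * \<nu>0) * matern_density (1 / \<delta>) \<nu>0 \<omega>)"
proof -
  define d where "d = real DIM('a)"
  define m0 m where "m0 = \<nu>0 + d / 2" and "m = \<nu> + d / 2"
  have m: "m0 > 0" "m0 \<le> m" "m > 0" using pos by (auto simp: m0_def m_def d_def add_pos_nonneg)
  define \<kappa> where "\<kappa> \<nu> = Gamma (\<nu> + d / 2) / (Gamma \<nu> * pi powr (d / 2))" for \<nu>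
  have \<kappa>: "\<kappa> \<nu> > 0" if "\<nu> > 0" for \<nu>
    unfolding \<kappa>_def using that by (auto intro!: divide_pos_pos mult_pos_pos Gamma_real_pos add_pos_nonneg simp: d_def)
  have \<nu>: "\<nu> > 0" using pos by simp
  define c where "c = min 1 (a0\<^sup>2 / a\<^sup>2)"
  have c: "c > 0" using pos by (simp add: c_def)
  define C1 where "C1 = \<kappa> \<nu>0 * a0 powr (2 * \<nu>0) * (2 powr m0 / \<kappa> \<nu>0)"
  define C2 where "C2 = \<kappa> \<nu>0 * a0 powr (2 * \<nu>0) * ((a0\<^sup>2 + 1) powr (m - m0) * c powr (- m) / (\<kappa> \<nu> * a powr (2 * \<nu>)))"
  have C12: "C1 > 0" "C2 > 0" unfolding C1_def C2_def
    using pos \<kappa> \<nu> c by (auto intro!: mult_pos_pos divide_pos_pos add_pos_pos simp: add_pos_pos less_imp_neq[symmetric])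
  show ?thesis
  proof (rule that[of "C1 + C2"])
    fix \<delta> :: real and \<omega> :: 'a
    assume \<delta>: "0 < \<delta>" "\<delta> \<le> 1"
    have D: "matern_density a \<nu> \<omega> = \<kappa> \<nu> * a powr (2 * \<nu>) * (a\<^sup>2 + (norm \<omega>)\<^sup>2) powr (- (\<nu> + d / 2))" for a \<nu>
      by (simp add: matern_density_def \<kappa>_def d_def)
    let ?A = "\<delta> powr (- 2 * (\<nu> - \<nu>0)) * matern_density a \<nu> \<omega>"
    let ?B = "\<delta> powr (2 * \<nu>0) * matern_density (1 / \<delta>) \<nu>0 \<omega>"
    have nn: "?A \<ge> 0" "?B \<ge> 0" using matern_density_nonneg[of \<nu> a \<omega>] matern_density_nonneg[of \<nu>0 "1 / \<delta>" \<omega>] pos \<nu> by auto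
    \<comment> \<open>The factor \<delta>^(2\<nu>0) undoes the normalisation of the density with
      \<open>a = 1 / \<delta>\<close>.\<close>
    have B: "?B = \<kappa> \<nu>0 * ((1 / \<delta>)\<^sup>2 + (norm \<omega>)\<^sup>2) powr (- m0)"
      using \<delta> by (simp add: D m0_def powr_divide)
    have "matern_density a0 \<nu>0 \<omega> \<le> C1 * ?B \<or> matern_density a0 \<nu>0 \<omega> \<le> C2 * ?A"
    proof (cases "norm \<omega> \<ge> 1 / \<delta>")
      case True
      have w: "norm \<omega> > 0" using True \<delta> divide_pos_pos[of 1 \<delta>] by linarith
      have "(1 / \<delta>)\<^sup>2 \<le> (norm \<omega>)\<^sup>2" using True \<delta> by (intro power_mono) auto
      hence "((1 / \<delta>)\<^sup>2 + (norm \<omega>)\<^sup>2) / 2 \<le> a0\<^sup>2 + (norm \<omega>)\<^sup>2"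
      proof -
        have "(X + Y) / 2 \<le> A + Y" if "X \<le> Y" "0 \<le> A" for X Y A :: real using that by simp
        thus ?thesis using \<open>(1 / \<delta>)\<^sup>2 \<le> (norm \<omega>)\<^sup>2\<close> by (metis zero_le_power2)
      qed
      hence "(a0\<^sup>2 + (norm \<omega>)\<^sup>2) powr (- m0) \<le> (((1 / \<delta>)\<^sup>2 + (norm \<omega>)\<^sup>2) / 2) powr (- m0)"
        using w m by (intro powr_mono2') (auto intro!: add_nonneg_pos divide_pos_pos)
      also have "\<dots> = 2 powr m0 * ((1 / \<delta>)\<^sup>2 + (norm \<omega>)\<^sup>2) powr (- m0)"
        by (simp add: powr_divide powr_minus divide_simps)
      finally have "matern_density a0 \<nu>0 \<omega> \<le> \<kappa> \<nu>0 * a0 powr (2 * \<nu>0) * (2 powr m0 * ((1 / \<delta>)\<^sup>2 + (norm \<omega>)\<^sup>2) powr (- m0))"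
        unfolding D m0_def[symmetric] using \<kappa>[OF pos(3)] by (intro mult_left_mono) auto
      also have "\<dots> = C1 * ?B"
        unfolding B C1_def using \<kappa>[OF pos(3)] by simp
      finally show ?thesis by simp
    next
      case False
      have p0: "a0\<^sup>2 + (norm \<omega>)\<^sup>2 > 0" "a\<^sup>2 + (norm \<omega>)\<^sup>2 > 0" using pos by (auto intro!: add_pos_nonneg)
      have "(norm \<omega>)\<^sup>2 \<le> (1 / \<delta>)\<^sup>2" using False by (intro power_mono) auto
      moreover have "a0\<^sup>2 * 1 \<le> a0\<^sup>2 * (1 / \<delta>)\<^sup>2" using \<delta> by (intro mult_left_mono) (auto simp: power_le_one)
      ultimately have "a0\<^sup>2 + (norm \<omega>)\<^sup>2 \<le> (a0\<^sup>2 + 1) * (1 / \<delta>)\<^sup>2" by (simp add: algebra_simps)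
      hence "(a0\<^sup>2 + (norm \<omega>)\<^sup>2) powr (m - m0) \<le> ((a0\<^sup>2 + 1) * (1 / \<delta>)\<^sup>2) powr (m - m0)"
        using m p0 by (intro powr_mono2) auto
      also have "\<dots> = (a0\<^sup>2 + 1) powr (m - m0) * \<delta> powr (- 2 * (\<nu> - \<nu>0))"
      proof -
        have "((1 / \<delta>)\<^sup>2) powr (m - m0) = (1 / \<delta>) powr (2 * (m - m0))"
          using \<delta> by (intro power2_powr) auto
        also have "\<dots> = \<delta> powr (- 2 * (\<nu> - \<nu>0))"
          using \<delta> by (simp add: powr_divide powr_minus_divide[symmetric] m_def m0_def)
        finally show ?thesis by (simp add: powr_mult)
      qed
      finally have 1: "(a0\<^sup>2 + (norm \<omega>)\<^sup>2) powr (m - m0) \<le> (a0\<^sup>2 + 1) powr (m - m0) * \<delta> powr (- 2 * (\<nu> - \<nu>0))" .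
      have "c * (a\<^sup>2 + (norm \<omega>)\<^sup>2) \<le> a0\<^sup>2 + (norm \<omega>)\<^sup>2"
      proof -
        have "c * a\<^sup>2 \<le> (a0\<^sup>2 / a\<^sup>2) * a\<^sup>2" "c * (norm \<omega>)\<^sup>2 \<le> 1 * (norm \<omega>)\<^sup>2"
          by (intro mult_right_mono; simp add: c_def)+
        moreover have "(a0\<^sup>2 / a\<^sup>2) * a\<^sup>2 = a0\<^sup>2" using pos by simp
        ultimately show ?thesis by (simp add: distrib_left)
      qed
      hence "(a0\<^sup>2 + (norm \<omega>)\<^sup>2) powr (- m) \<le> (c * (a\<^sup>2 + (norm \<omega>)\<^sup>2)) powr (- m)"
        using m c p0 by (intro powr_mono2') auto
      hence 2: "(a0\<^sup>2 + (norm \<omega>)\<^sup>2) powr (- m) \<le> c powr (- m) * (a\<^sup>2 + (norm \<omega>)\<^sup>2) powr (- m)"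
        by (simp add: powr_mult)
      have "(a0\<^sup>2 + (norm \<omega>)\<^sup>2) powr (- m0) = (a0\<^sup>2 + (norm \<omega>)\<^sup>2) powr (m - m0) * (a0\<^sup>2 + (norm \<omega>)\<^sup>2) powr (- m)"
        by (simp flip: powr_add)
      also have "\<dots> \<le> ((a0\<^sup>2 + 1) powr (m - m0) * \<delta> powr (- 2 * (\<nu> - \<nu>0))) * (c powr (- m) * (a\<^sup>2 + (norm \<omega>)\<^sup>2) powr (- m))"
        by (intro mult_mono 1 2) auto
      finally have "matern_density a0 \<nu>0 \<omega> \<le> \<kappa> \<nu>0 * a0 powr (2 * \<nu>0) * (((a0\<^sup>2 + 1) powr (m - m0) * \<delta> powr (- 2 * (\<nu> - \<nu>0))) * (c powr (- m) * (a\<^sup>2 + (norm \<omega>)\<^sup>2) powr (- m)))"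
        unfolding D m0_def[symmetric] using \<kappa>[OF pos(3)] by (intro mult_left_mono) auto
      also have "\<dots> = C2 * ?A"
        unfolding C2_def D m_def[symmetric] using \<kappa>[OF \<nu>] pos by simp
      finally show ?thesis by simp
    qed
    moreover have "C1 * ?B \<le> (C1 + C2) * (?A + ?B)" "C2 * ?A \<le> (C1 + C2) * (?A + ?B)"
      by (intro mult_mono; use C12 nn in simp)+
    ultimately show "matern_density a0 \<nu>0 \<omega> \<le> (C1 + C2) * (?A + ?B)" by linarith
  qed (use C12 in simp)
qed

lemma pred_var_compare:
  fixes a0 a \<nu>0 \<nu> :: real
  assumes pos: "a0 > 0" "a > 0" "\<nu>0 > 0" "\<nu>0 \<le> \<nu>"
  obtains C where "C > 0" "\<And>(\<delta>::real) n p w (x::'a::euclidean_space). 0 < \<delta> \<Longrightarrow> \<delta> \<le> 1 \<Longrightarrow> pred_var (gauss_mix a0 \<nu>0) n p w x \<le>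
    C * (\<delta> powr (- 2 * (\<nu> - \<nu>0)) * pred_var (gauss_mix a \<nu>) n p w x + \<delta> powr (2 * \<nu>0) * pred_var (gauss_mix (1 / \<delta>) \<nu>0) n p w x)"
proof -
  obtain C where C: "C > 0" "\<And>(\<delta>::real) \<omega>. 0 < \<delta> \<Longrightarrow> \<delta> \<le> 1 \<Longrightarrow> matern_density a0 \<nu>0 (\<omega>::'a) \<le>
    C * (\<delta> powr (- 2 * (\<nu> - \<nu>0)) * matern_density a \<nu> \<omega> + \<delta> powr (2 * \<nu>0) * matern_density (1 / \<delta>) \<nu>0 \<omega>)"
    using matern_density_compare[OF pos, where 'a='a] by blast
  show ?thesis
  proof (rule that[OF C(1)])
    fix \<delta> :: real and n p w and x :: 'a
    assume \<delta>: "0 < \<delta>" "\<delta> \<le> 1"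
    let ?e = "\<lambda>\<omega>. (cmod (cis (\<omega> \<bullet> x) - exp_sum n p w \<omega>))\<^sup>2"
    show "pred_var (gauss_mix a0 \<nu>0) n p w x \<le>
    C * (\<delta> powr (- 2 * (\<nu> - \<nu>0)) * pred_var (gauss_mix a \<nu>) n p w x + \<delta> powr (2 * \<nu>0) * pred_var (gauss_mix (1 / \<delta>) \<nu>0) n p w x)"
    proof (rule has_bochner_integral_mono)
      show "has_bochner_integral lborel (\<lambda>\<omega>. matern_density a0 \<nu>0 \<omega> * ?e \<omega>) (pred_var (gauss_mix a0 \<nu>0) n p w x)"
        by (rule pred_var_spectral) (use pos in auto)
      show "has_bochner_integral lborel (\<lambda>\<omega>. C * (\<delta> powr (- 2 * (\<nu> - \<nu>0)) * (matern_density a \<nu> \<omega> * ?e \<omega>) + \<delta> powr (2 * \<nu>0) * (matern_density (1 / \<delta>) \<nu>0 \<omega> * ?e \<omega>)))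
        (C * (\<delta> powr (- 2 * (\<nu> - \<nu>0)) * pred_var (gauss_mix a \<nu>) n p w x + \<delta> powr (2 * \<nu>0) * pred_var (gauss_mix (1 / \<delta>) \<nu>0) n p w x))"
        by (intro has_bochner_integral_mult_right has_bochner_integral_add pred_var_spectral) (use pos \<delta> in auto)
      fix \<omega> :: 'a
      have "matern_density a0 \<nu>0 \<omega> * ?e \<omega> \<le> C * (\<delta> powr (- 2 * (\<nu> - \<nu>0)) * matern_density a \<nu> \<omega> + \<delta> powr (2 * \<nu>0) * matern_density (1 / \<delta>) \<nu>0 \<omega>) * ?e \<omega>"
        by (intro mult_right_mono C \<delta>) auto
      thus "matern_density a0 \<nu>0 \<omega> * ?e \<omega> \<le> C * (\<delta> powr (- 2 * (\<nu> - \<nu>0)) * (matern_density a \<nu> \<omega> * ?e \<omega>) + \<delta> powr (2 * \<nu>0) * (matern_density (1 / \<delta>) \<nu>0 \<omega> * ?e \<omega>))"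
        by (simp add: algebra_simps)
    qed
  qed
qed

section \<open>Row sums over separated designs\<close>

lemma sqrt_power_eq_powr: "x > 0 \<Longrightarrow> sqrt x ^ n = x powr (real n / 2)"
  by (simp add: powr_half_sqrt[symmetric] powr_powr powr_realpow[symmetric])

lemma has_bochner_integral_lborel_translate:
  fixes f :: "'a::euclidean_space \<Rightarrow> real"
  assumes "has_bochner_integral lborel f v"
  shows "has_bochner_integral lborel (\<lambda>y. f (c + y)) v"
proof -
  have [measurable]: "f \<in> borel_measurable borel"
    using assms by (auto simp: has_bochner_integral_iff)
  have "has_bochner_integral (distr lborel borel ((+) c)) f v"
    unfolding lborel_distr_plus by (rule assms)
  thus ?thesis
    by (simp add: has_bochner_integral_iff integrable_distr_eq integral_distr)
qed

text \<open>Each summand is dominated by the average, over the ball of radius q about p_j, of a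
  Gaussian with twice the variance; s >= q^2 makes this cost only a constant factor. The balls are
  disjoint, so the sum is at most the full integral of that Gaussian divided by the volume of one
  ball.\<close>

lemma gauss_packing_sum_large:
  fixes p :: "nat \<Rightarrow> 'a::euclidean_space"
  assumes sep: "\<And>j k. j < n \<Longrightarrow> k < n \<Longrightarrow> j \<noteq> k \<Longrightarrow> dist (p j) (p k) \<ge> 2 * q" and q: "q > 0" and s: "s \<ge> q\<^sup>2"
  shows "(\<Sum>j<n. exp (- (norm (x - p j))\<^sup>2 / (4 * s))) \<le>
     exp 1 * (8 * pi) powr (real DIM('a) / 2) / unit_ball_vol (real DIM('a)) * (sqrt s / q) ^ DIM('a)"
proof -
  define V where "V = unit_ball_vol (real DIM('a))"
  have V: "V > 0" by (simp add: V_def)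
  have s0: "s > 0" using s zero_less_power[OF q, of 2] by linarith
  define G where "G y = exp (- (1 / (8 * s)) * (norm (x - y))\<^sup>2)" for y :: 'a
  have G: "has_bochner_integral lborel G ((8 * pi * s) powr (real DIM('a) / 2))"
    using has_bochner_integral_lborel_translate[OF has_bochner_integral_gauss[of "1 / (8 * s)", where 'a='a], of "- x"] s0 
    by (simp add: G_def[abs_def] norm_minus_commute mult_ac)
  have intG: "integrable lborel G" using G by (simp add: has_bochner_integral_iff)
  let ?B = "\<lambda>j. ball (p j) q"
  have intB: "integrable lborel (\<lambda>y. indicator (?B j) y * (exp 1 * G y))" for j
    using integrable_real_mult_indicator[of "?B j" lborel "\<lambda>y. exp 1 * G y"] intG by (simp add: mult.commute)
  have 1: "V * q ^ DIM('a) * exp (- (norm (x - p j))\<^sup>2 / (4 * s)) \<le> (LINT y|lborel. indicator (?B j) y * (exp 1 * G y))" for j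
  proof -
    have le: "exp (- (norm (x - p j))\<^sup>2 / (4 * s)) \<le> exp 1 * G y" if "y \<in> ?B j" for y
    proof -
      have "norm (p j - y) \<le> q" using that by (simp add: dist_norm)
      hence "norm (x - y) \<le> norm (x - p j) + q"
        using norm_triangle_ineq[of "x - p j" "p j - y"] by simp
      hence "(norm (x - y))\<^sup>2 \<le> (norm (x - p j) + q)\<^sup>2" by (intro power_mono) auto
      also have "\<dots> \<le> 2 * (norm (x - p j))\<^sup>2 + 2 * q\<^sup>2"
        using sum_squares_bound[of "norm (x - p j)" q] by (simp add: power2_eq_square algebra_simps)
      also have "\<dots> \<le> 2 * (norm (x - p j))\<^sup>2 + 2 * s" using s by simp
      finally have "(norm (x - y))\<^sup>2 / (8 * s) \<le> (2 * (norm (x - p j))\<^sup>2 + 2 * s) / (8 * s)"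
        using s0 by (intro divide_right_mono) auto
      also have "\<dots> = (norm (x - p j))\<^sup>2 / (4 * s) + 1 / 4" using s0 by (simp add: field_simps)
      finally have "- (norm (x - p j))\<^sup>2 / (4 * s) \<le> 1 + (- (1 / (8 * s)) * (norm (x - y))\<^sup>2)" by simp
      thus ?thesis unfolding G_def exp_add[symmetric] by simp
    qed
    have "V * q ^ DIM('a) * exp (- (norm (x - p j))\<^sup>2 / (4 * s)) = (LINT y|lborel. indicator (?B j) y * exp (- (norm (x - p j))\<^sup>2 / (4 * s)))"
      using q by (simp add: content_ball V_def)
    also have "\<dots> \<le> (LINT y|lborel. indicator (?B j) y * (exp 1 * G y))"
    proof (rule integral_mono)
      show "integrable lborel (\<lambda>y. indicator (?B j) y * exp (- (norm (x - p j))\<^sup>2 / (4 * s)))"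
        by (intro integrable_mult_left integrable_real_indicator) (use emeasure_lborel_ball_finite[of "p j" q] in auto)
      show "integrable lborel (\<lambda>y. indicator (?B j) y * (exp 1 * G y))" by (rule intB)
    qed (use le in \<open>auto simp: indicator_def\<close>)
    finally show ?thesis .
  qed
  have disj: "disjoint_family_on ?B {..<n}"
    unfolding disjoint_family_on_def
  proof (intro ballI impI)
    fix j k assume "j \<in> {..<n}" "k \<in> {..<n}" "j \<noteq> k"
    hence "dist (p j) (p k) \<ge> 2 * q" by (intro sep) auto
    thus "?B j \<inter> ?B k = {}" by (intro disjoint_ballI) auto
  qed
  have "V * q ^ DIM('a) * (\<Sum>j<n. exp (- (norm (x - p j))\<^sup>2 / (4 * s))) \<le> (\<Sum>j<n. LINT y|lborel. indicator (?B j) y * (exp 1 * G y))"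
    unfolding sum_distrib_left by (intro sum_mono 1)
  also have "\<dots> = (LINT y|lborel. (\<Sum>j<n. indicator (?B j) y * (exp 1 * G y)))"
    by (intro Bochner_Integration.integral_sum[symmetric] intB)
  also have "\<dots> \<le> (LINT y|lborel. exp 1 * G y)"
  proof (rule integral_mono)
    show "integrable lborel (\<lambda>y. \<Sum>j<n. indicator (?B j) y * (exp 1 * G y))"
      by (intro Bochner_Integration.integrable_sum intB)
    show "integrable lborel (\<lambda>y. exp 1 * G y)" using intG by simp
    fix y
    have "(\<Sum>j<n. indicator (?B j) y) = (indicator (\<Union>j<n. ?B j) y :: real)"
      by (rule indicator_UN_disjoint[symmetric]) (use disj in auto)
    hence "(\<Sum>j<n. indicator (?B j) y) \<le> (1::real)" by (simp add: indicator_def)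
    hence "(\<Sum>j<n. indicator (?B j) y) * (exp 1 * G y) \<le> 1 * (exp 1 * G y)"
      by (intro mult_right_mono) (auto simp: G_def)
    thus "(\<Sum>j<n. indicator (?B j) y * (exp 1 * G y)) \<le> exp 1 * G y" by (simp add: sum_distrib_right)
  qed
  also have "\<dots> = exp 1 * (8 * pi * s) powr (real DIM('a) / 2)" using G by (simp add: has_bochner_integral_iff)
  also have "\<dots> = exp 1 * (8 * pi) powr (real DIM('a) / 2) * sqrt s ^ DIM('a)"
  proof -
    show ?thesis using s0 by (simp add: powr_mult sqrt_power_eq_powr)
  qed
  finally have "(\<Sum>j<n. exp (- (norm (x - p j))\<^sup>2 / (4 * s))) \<le> exp 1 * (8 * pi) powr (real DIM('a) / 2) * sqrt s ^ DIM('a) / (V * q ^ DIM('a))"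
    using V q by (subst pos_le_divide_eq) (auto simp: mult.commute)
  thus ?thesis by (simp add: V_def power_divide)
qed

text \<open>Each term increases with s, so for s < q^2 the value at q^2 is an upper bound; this
  accounts for the summand 1.\<close>

lemma gauss_packing_sum:
  fixes p :: "nat \<Rightarrow> 'a::euclidean_space"
  assumes sep: "\<And>j k. j < n \<Longrightarrow> k < n \<Longrightarrow> j \<noteq> k \<Longrightarrow> dist (p j) (p k) \<ge> 2 * q" and q: "q > 0" and s: "s > 0"
  shows "(\<Sum>j<n. exp (- (norm (x - p j))\<^sup>2 / (4 * s))) \<le>
     exp 1 * (8 * pi) powr (real DIM('a) / 2) / unit_ball_vol (real DIM('a)) * (1 + (sqrt s / q) ^ DIM('a))"
proof -
  let ?C = "exp 1 * (8 * pi) powr (real DIM('a) / 2) / unit_ball_vol (real DIM('a))"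
  have C: "?C \<ge> 0" by simp
  show ?thesis
  proof (cases "s \<ge> q\<^sup>2")
    case True
    have "(\<Sum>j<n. exp (- (norm (x - p j))\<^sup>2 / (4 * s))) \<le> ?C * (sqrt s / q) ^ DIM('a)"
      by (rule gauss_packing_sum_large[OF sep q True])
    also have "\<dots> \<le> ?C * (1 + (sqrt s / q) ^ DIM('a))" by (intro mult_left_mono C) simp
    finally show ?thesis .
  next
    case False
    have "(\<Sum>j<n. exp (- (norm (x - p j))\<^sup>2 / (4 * s))) \<le> (\<Sum>j<n. exp (- (norm (x - p j))\<^sup>2 / (4 * q\<^sup>2)))"
      using s q False by (intro sum_mono) (auto intro!: divide_left_mono)
    also have "\<dots> \<le> ?C * (sqrt (q\<^sup>2) / q) ^ DIM('a)"
      by (rule gauss_packing_sum_large[OF sep q]) auto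
    also have "\<dots> \<le> ?C * (1 + (sqrt s / q) ^ DIM('a))"
      using q s by (intro mult_left_mono C) simp
    finally show ?thesis .
  qed
qed

lemma integrable_gauss_mix:
  assumes "\<nu> > 0"
  shows "integrable lborel (\<lambda>u. gamma_weight \<nu> u * exp (- (a * norm y)\<^sup>2 / (4 * u)))"
proof (rule Bochner_Integration.integrable_bound)
  show "integrable lborel (gamma_weight \<nu>)"
    using has_bochner_integral_gamma_weight_1[OF assms] by (simp add: has_bochner_integral_iff)
  show "AE u in lborel. norm (gamma_weight \<nu> u * exp (- (a * norm y)\<^sup>2 / (4 * u))) \<le> norm (gamma_weight \<nu> u)"
  proof (intro AE_I2)
    fix u :: real
    show "norm (gamma_weight \<nu> u * exp (- (a * norm y)\<^sup>2 / (4 * u))) \<le> norm (gamma_weight \<nu> u)"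
      by (cases "u > 0") (auto simp: gamma_weight_eq_0 abs_mult intro!: mult_left_le)
  qed
qed measurable

lemma gauss_mix_nonneg: "\<nu> > 0 \<Longrightarrow> gauss_mix a \<nu> y \<ge> 0"
  unfolding gauss_mix_def by (intro integral_nonneg_AE) (auto simp: gamma_weight_nonneg)

lemma gauss_mix_uminus: "gauss_mix a \<nu> (- y) = gauss_mix a \<nu> y"
  by (simp add: gauss_mix_def)

lemma gauss_mix_packing_sum:
  fixes p :: "nat \<Rightarrow> 'a::euclidean_space" and \<nu> q \<delta> :: real
  defines "C \<equiv> exp 1 * (8 * pi) powr (real DIM('a) / 2) / unit_ball_vol (real DIM('a))"
  assumes sep: "\<And>j k. j < n \<Longrightarrow> k < n \<Longrightarrow> j \<noteq> k \<Longrightarrow> dist (p j) (p k) \<ge> 2 * q" and q: "q > 0" and \<delta>: "\<delta> > 0" and \<nu>: "\<nu> > 0"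
  shows "(\<Sum>j<n. gauss_mix (1 / \<delta>) \<nu> (x - p j)) \<le>
     C * (1 + Gamma (\<nu> + real DIM('a) / 2) / Gamma \<nu> * (\<delta> / q) ^ DIM('a))"
proof -
  let ?g = "\<lambda>u. gamma_weight \<nu> u * (u powr (real DIM('a) / 2) * exp (- 0 * u))"
  have g: "has_bochner_integral lborel ?g (Gamma (\<nu> + real DIM('a) / 2) / Gamma \<nu>)"
    using has_bochner_integral_gamma_weight[OF \<nu>, of "real DIM('a) / 2" 0] by simp
  have I: "has_bochner_integral lborel (\<lambda>u. C * (gamma_weight \<nu> u + (\<delta> / q) ^ DIM('a) * ?g u))
      (C * (1 + (\<delta> / q) ^ DIM('a) * (Gamma (\<nu> + real DIM('a) / 2) / Gamma \<nu>)))"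
    by (intro has_bochner_integral_mult_right has_bochner_integral_add has_bochner_integral_gamma_weight_1[OF \<nu>] g)
  have S: "has_bochner_integral lborel (\<lambda>u. \<Sum>j<n. gamma_weight \<nu> u * exp (- (1 / \<delta> * norm (x - p j))\<^sup>2 / (4 * u))) 
      (\<Sum>j<n. gauss_mix (1 / \<delta>) \<nu> (x - p j))"
    unfolding gauss_mix_def
    by (intro has_bochner_integral_sum) (simp only: has_bochner_integral_iff integrable_gauss_mix[OF \<nu>] simp_thms)
  have "(\<Sum>j<n. gauss_mix (1 / \<delta>) \<nu> (x - p j)) \<le> C * (1 + (\<delta> / q) ^ DIM('a) * (Gamma (\<nu> + real DIM('a) / 2) / Gamma \<nu>))"
  proof (rule has_bochner_integral_mono[OF S I])
    fix u :: real
    show "(\<Sum>j<n. gamma_weight \<nu> u * exp (- (1 / \<delta> * norm (x - p j))\<^sup>2 / (4 * u))) \<le> C * (gamma_weight \<nu> u + (\<delta> / q) ^ DIM('a) * ?g u)"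
    proof (cases "u > 0")
      case True
      \<comment> \<open>A component of the kernel of length \<delta> is a Gaussian with parameter u
        \<delta>^2; averaging u^(d/2) over the Gamma weight produces the quotient of Gamma
        values.\<close>
      have "(\<Sum>j<n. exp (- (norm (x - p j))\<^sup>2 / (4 * (u * \<delta>\<^sup>2)))) \<le> C * (1 + (sqrt (u * \<delta>\<^sup>2) / q) ^ DIM('a))"
        unfolding C_def by (rule gauss_packing_sum[OF sep q]) (use True \<delta> in auto)
      also have "sqrt (u * \<delta>\<^sup>2) / q = sqrt u * (\<delta> / q)" using \<delta> by (simp add: real_sqrt_mult)
      also have "(sqrt u * (\<delta> / q)) ^ DIM('a) = u powr (real DIM('a) / 2) * (\<delta> / q) ^ DIM('a)"
        using True by (simp only: power_mult_distrib sqrt_power_eq_powr)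
      finally have "gamma_weight \<nu> u * (\<Sum>j<n. exp (- (norm (x - p j))\<^sup>2 / (4 * (u * \<delta>\<^sup>2)))) \<le> gamma_weight \<nu> u * (C * (1 + u powr (real DIM('a) / 2) * (\<delta> / q) ^ DIM('a)))"
        by (intro mult_left_mono gamma_weight_nonneg \<nu>)
      thus ?thesis
        by (simp add: sum_distrib_left power_divide algebra_simps)
    qed (simp add: gamma_weight_eq_0)
  qed
  thus ?thesis by (simp only: mult.commute)
qed

text \<open>Schur's test: w_j w_k <= (w_j^2 + w_k^2)/2, symmetry, and the uniform row sum bound for
  a nonnegative kernel.\<close>

lemma quad_form_gauss_mix_le:
  fixes p :: "nat \<Rightarrow> 'a::euclidean_space" and \<nu> q \<delta> :: real
  defines "C \<equiv> exp 1 * (8 * pi) powr (real DIM('a) / 2) / unit_ball_vol (real DIM('a))"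
  assumes sep: "\<And>j k. j < n \<Longrightarrow> k < n \<Longrightarrow> j \<noteq> k \<Longrightarrow> dist (p j) (p k) \<ge> 2 * q" and q: "q > 0" and \<delta>: "\<delta> > 0" and \<nu>: "\<nu> > 0"
  shows "quad_form (gauss_mix (1 / \<delta>) \<nu>) n p w \<le>
     C * (1 + Gamma (\<nu> + real DIM('a) / 2) / Gamma \<nu> * (\<delta> / q) ^ DIM('a)) * (\<Sum>j<n. (w j)\<^sup>2)"
proof -
  let ?K = "\<lambda>j k. gauss_mix (1 / \<delta>) \<nu> (p j - p k)"
  let ?B = "C * (1 + Gamma (\<nu> + real DIM('a) / 2) / Gamma \<nu> * (\<delta> / q) ^ DIM('a))"
  have sym: "?K j k = ?K k j" for j k
    using gauss_mix_uminus[of "1 / \<delta>" \<nu> "p j - p k"] by simp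
  have "quad_form (gauss_mix (1 / \<delta>) \<nu>) n p w \<le> (\<Sum>j<n. \<Sum>k<n. ((w j)\<^sup>2 / 2 + (w k)\<^sup>2 / 2) * ?K j k)"
    unfolding quad_form_def
  proof (intro sum_mono mult_right_mono gauss_mix_nonneg[OF \<nu>])
    show "w j * w k \<le> (w j)\<^sup>2 / 2 + (w k)\<^sup>2 / 2" for j k
      using sum_squares_bound[of "w j" "w k"] by simp
  qed
  also have "\<dots> = (\<Sum>j<n. \<Sum>k<n. (w j)\<^sup>2 / 2 * ?K j k) + (\<Sum>j<n. \<Sum>k<n. (w k)\<^sup>2 / 2 * ?K j k)"
    by (simp add: distrib_right sum.distrib)
  also have "(\<Sum>j<n. \<Sum>k<n. (w k)\<^sup>2 / 2 * ?K j k) = (\<Sum>j<n. \<Sum>k<n. (w j)\<^sup>2 / 2 * ?K j k)"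
    by (subst sum.swap) (intro sum.cong refl arg_cong2[where f="(*)"] sym)
  also have "(\<Sum>j<n. \<Sum>k<n. (w j)\<^sup>2 / 2 * ?K j k) + (\<Sum>j<n. \<Sum>k<n. (w j)\<^sup>2 / 2 * ?K j k) = (\<Sum>j<n. (w j)\<^sup>2 * (\<Sum>k<n. ?K j k))"
    by (simp add: sum_distrib_left flip: sum.distrib)
  also have "\<dots> \<le> (\<Sum>j<n. (w j)\<^sup>2 * ?B)"
    unfolding C_def by (intro sum_mono mult_left_mono gauss_mix_packing_sum sep q \<delta> \<nu>) auto
  also have "\<dots> = ?B * (\<Sum>j<n. (w j)\<^sup>2)"
    by (subst mult.commute) (simp only: sum_distrib_right)
  finally show ?thesis .
qed

section \<open>Polynomials along lines\<close>

text \<open>The nodes are 1/l, ..., 1, so samples along b + t v lie between b and b + v; the base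
  point itself is not a node.\<close>

definition lagrange_node :: "nat \<Rightarrow> nat \<Rightarrow> real" where
  "lagrange_node l i = real (Suc i) / real l"

definition lagrange_basis :: "nat \<Rightarrow> nat \<Rightarrow> real \<Rightarrow> real" where
  "lagrange_basis l i t = (\<Prod>j\<in>{..<l} - {i}. (t - lagrange_node l j) / (lagrange_node l i - lagrange_node l j))"

lemma lagrange_node_bounds:
  assumes "i < l" shows "0 < lagrange_node l i" "lagrange_node l i \<le> 1"
  using assms by (auto simp: lagrange_node_def field_simps)

lemma lagrange_node_inj: "l > 0 \<Longrightarrow> lagrange_node l i = lagrange_node l j \<longleftrightarrow> i = j"
  by (auto simp: lagrange_node_def)

lemma lagrange_basis_node:
  assumes "i < l" "j < l"
  shows "lagrange_basis l i (lagrange_node l j) = (if i = j then 1 else 0)"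
proof (cases "i = j")
  case True
  thus ?thesis using assms unfolding lagrange_basis_def
    by (auto intro!: prod.neutral simp: lagrange_node_inj)
next
  case False
  hence "\<exists>k\<in>{..<l} - {i}. (lagrange_node l j - lagrange_node l k) / (lagrange_node l i - lagrange_node l k) = 0"
    using assms by (intro bexI[of _ j]) auto
  thus ?thesis using False unfolding lagrange_basis_def by (simp add: prod_zero_iff)
qed

lemma lagrange_interpolation:
  fixes q :: "real poly"
  assumes deg: "degree q < l"
  shows "poly q t = (\<Sum>i<l. lagrange_basis l i t * poly q (lagrange_node l i))"
proof -
  define L where "L i = (\<Prod>j\<in>{..<l} - {i}. [:- lagrange_node l j / (lagrange_node l i - lagrange_node l j), 1 / (lagrange_node l i - lagrange_node l j):])" for i
  have polyL: "poly (L i) s = lagrange_basis l i s" for i s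
    unfolding L_def lagrange_basis_def poly_prod by (intro prod.cong) (auto simp: diff_divide_distrib)
  have degL: "degree (L i) < l" if "i < l" for i
  proof -
    have deg1: "degree [:a, b:] \<le> 1" for a b :: real
      by (rule order.trans[OF degree_pCons_le]) simp
    have "degree (L i) \<le> (\<Sum>j\<in>{..<l} - {i}. 1)"
      unfolding L_def by (rule order.trans[OF degree_prod_sum_le sum_mono]) (simp, unfold o_def, rule deg1)
    also have "\<dots> < l" using that by (simp add: card_Diff_subset)
    finally show ?thesis .
  qed
  define Q where "Q = (\<Sum>i<l. Polynomial.smult (poly q (lagrange_node l i)) (L i))"
  have "q = Q"
  proof (rule poly_eqI_degree[where A="lagrange_node l ` {..<l}"])
    fix x assume "x \<in> lagrange_node l ` {..<l}"
    then obtain j where j: "j < l" "x = lagrange_node l j" by auto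
    have "poly Q x = (\<Sum>i<l. if i = j then poly q (lagrange_node l i) else 0)"
      unfolding Q_def poly_sum poly_smult polyL j(2) 
      by (intro sum.cong refl) (use j in \<open>auto simp: lagrange_basis_node\<close>)
    also have "\<dots> = poly q x" using j by simp
    finally show "poly q x = poly Q x" by simp
  next
    have card: "card (lagrange_node l ` {..<l}) = l"
      using deg by (subst card_image) (auto intro!: inj_onI simp: lagrange_node_inj)
    show "degree q < card (lagrange_node l ` {..<l})" using deg card by simp
    have "degree Q \<le> l - 1"
      unfolding Q_def using deg degL
      by (intro degree_sum_le) (auto intro!: order.trans[OF degree_smult_le] simp: less_eq_Suc_le[symmetric] Suc_le_eq le_diff_conv2 
           dest: degL intro: Nat.le_diff_conv2[THEN iffD2])
    thus "degree Q < card (lagrange_node l ` {..<l})" using deg card by simp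
  qed
  hence "poly q t = poly Q t" by simp
  thus ?thesis by (simp add: Q_def poly_sum polyL mult.commute)
qed

text \<open>Polynomial behaviour is only ever needed along lines, and in this linear form it survives integration
  over a parameter.\<close>
definition line_poly :: "nat \<Rightarrow> ('a::real_vector \<Rightarrow> real) \<Rightarrow> bool" where
  "line_poly l P \<longleftrightarrow> (\<forall>b v t. P (b + t *\<^sub>R v) = (\<Sum>i<l. lagrange_basis l i t * P (b + lagrange_node l i *\<^sub>R v)))"

lemma line_poly_bound:
  assumes P: "line_poly l P" and S: "\<And>i. i < l \<Longrightarrow> \<bar>P (b + lagrange_node l i *\<^sub>R v)\<bar> \<le> S"
  shows "\<bar>P (b + t *\<^sub>R v)\<bar> \<le> (\<Sum>i<l. \<bar>lagrange_basis l i t\<bar>) * S"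
    and "\<bar>P (b + t *\<^sub>R v) - P b\<bar> \<le> (\<Sum>i<l. \<bar>lagrange_basis l i t - lagrange_basis l i 0\<bar>) * S"
proof -
  have "\<bar>P (b + t *\<^sub>R v)\<bar> = \<bar>\<Sum>i<l. lagrange_basis l i t * P (b + lagrange_node l i *\<^sub>R v)\<bar>"
    using P unfolding line_poly_def by (intro arg_cong[where f=abs]) blast
  also have "\<dots> \<le> (\<Sum>i<l. \<bar>lagrange_basis l i t\<bar> * S)"
    by (rule order.trans[OF sum_abs]) (auto intro!: sum_mono mult_left_mono S simp: abs_mult)
  finally show "\<bar>P (b + t *\<^sub>R v)\<bar> \<le> (\<Sum>i<l. \<bar>lagrange_basis l i t\<bar>) * S" by (simp add: sum_distrib_right)
  have "P (b + 0 *\<^sub>R v) = (\<Sum>i<l. lagrange_basis l i 0 * P (b + lagrange_node l i *\<^sub>R v))"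
    using P unfolding line_poly_def by blast
  hence "P b = (\<Sum>i<l. lagrange_basis l i 0 * P (b + lagrange_node l i *\<^sub>R v))" by simp
  moreover have "P (b + t *\<^sub>R v) = (\<Sum>i<l. lagrange_basis l i t * P (b + lagrange_node l i *\<^sub>R v))"
    using P unfolding line_poly_def by blast
  ultimately have "\<bar>P (b + t *\<^sub>R v) - P b\<bar> = \<bar>\<Sum>i<l. (lagrange_basis l i t - lagrange_basis l i 0) * P (b + lagrange_node l i *\<^sub>R v)\<bar>"
    by (simp add: left_diff_distrib flip: sum_subtractf)
  also have "\<dots> \<le> (\<Sum>i<l. \<bar>lagrange_basis l i t - lagrange_basis l i 0\<bar> * S)"
    by (rule order.trans[OF sum_abs]) (auto intro!: sum_mono mult_left_mono S simp: abs_mult)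
  finally show "\<bar>P (b + t *\<^sub>R v) - P b\<bar> \<le> (\<Sum>i<l. \<bar>lagrange_basis l i t - lagrange_basis l i 0\<bar>) * S"
    by (simp add: sum_distrib_right)
qed

text \<open>Continuity of the basis at 0. The tolerance 1/10 is spent twice in the norming argument,
  where 9/10 - 1/10 - 1/10 still exceeds 1/2.\<close>

lemma lagrange_basis_near_0:
  obtains \<tau> where "0 < \<tau>" "\<tau> < 1" "(\<Sum>i<l. \<bar>lagrange_basis l i \<tau> - lagrange_basis l i 0\<bar>) \<le> 1 / 10"
proof -
  let ?g = "\<lambda>t. \<Sum>i<l. \<bar>lagrange_basis l i t - lagrange_basis l i 0\<bar>"
  have "isCont ?g 0"
    unfolding lagrange_basis_def divide_inverse by (intro continuous_intros)
  hence "(?g \<longlongrightarrow> 0) (at 0)" unfolding isCont_def by simp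
  hence "eventually (\<lambda>t. ?g t < 1 / 10) (at_right 0)"
    by (intro order_tendstoD(2)[OF tendsto_mono[OF at_le[OF subset_UNIV]]]) auto
  moreover have "eventually (\<lambda>t::real. 0 < t \<and> t < 1) (at_right 0)"
    using eventually_at_right_real[of 0 1] by simp
  ultimately have "eventually (\<lambda>t. ?g t < 1 / 10 \<and> 0 < t \<and> t < 1) (at_right 0)" by eventually_elim auto
  hence "\<exists>t. ?g t < 1 / 10 \<and> 0 < t \<and> t < 1"
    using eventually_happens'[OF trivial_limit_at_right_real[of "0::real"]] by blast
  thus ?thesis using that by (auto intro: less_imp_le)
qed

text \<open>A substitute for Markov's inequality: if P nearly attains its supremum S over the ball
  at \<open>y0\<close>, then it changes little over short steps, as measured by
  \<open>lagrange_basis\<close> near 0, and stays above S/2 on a ball of proportional radius. The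
  value at \<open>x\<close> follows by extrapolation along the line through \<open>z\<close>. The
  bound \<open>A\<close> makes the supremum finite; \<tau> and \<Lambda> are chosen independently of
  it.\<close>

lemma line_poly_norming:
  fixes \<kappa> :: real
  assumes \<kappa>: "\<kappa> > 0"
  obtains \<tau> \<Lambda> where "0 < \<tau>" "\<tau> < 1" "\<Lambda> > 0"
    "\<And>(P :: 'a::euclidean_space \<Rightarrow> real) z r x A. line_poly l P \<Longrightarrow> r > 0 \<Longrightarrow> (\<And>y. y \<in> cball z r \<Longrightarrow> \<bar>P y\<bar> \<le> A) \<Longrightarrow>
       norm (z - x) = r / \<kappa> \<Longrightarrow>
       \<exists>y1 S. S \<ge> 0 \<and> cball y1 (\<tau> * r) \<subseteq> cball z r \<and> (\<forall>y\<in>cball y1 (\<tau> * r). S / 2 \<le> \<bar>P y\<bar>) \<and> \<bar>P x\<bar> \<le> \<Lambda> * S"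
proof -
  obtain \<tau> where \<tau>: "0 < \<tau>" "\<tau> < 1" "(\<Sum>i<l. \<bar>lagrange_basis l i \<tau> - lagrange_basis l i 0\<bar>) \<le> 1 / 10"
    by (rule lagrange_basis_near_0)
  \<comment> \<open>With v = \<kappa> (z - x), of length r, the point x has parameter -1/\<kappa> on
    the line from z.\<close>
  define \<Lambda> where "\<Lambda> = (\<Sum>i<l. \<bar>lagrange_basis l i (- 1 / \<kappa>)\<bar>) + 1"
  have \<Lambda>: "\<Lambda> > 0" unfolding \<Lambda>_def by (intro add_nonneg_pos sum_nonneg) auto
  show ?thesis
  \<comment> \<open>One factor \<tau> moves \<open>y0\<close> towards the centre, which clears a
    margin \<tau> r to the sphere; the other shrinks the ball about \<open>y1\<close> well inside
    this margin.\<close>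
  proof (rule that[of "\<tau>\<^sup>2" \<Lambda>])
    show "0 < \<tau>\<^sup>2" "\<tau>\<^sup>2 < 1" using \<tau> power_less_one_iff[of \<tau> 2] by auto
    show "\<Lambda> > 0" by fact
    fix P :: "'a \<Rightarrow> real" and z r x A
    assume P: "line_poly l P" and r: "r > 0" and A: "\<And>y. y \<in> cball z r \<Longrightarrow> \<bar>P y\<bar> \<le> A" and x: "norm (z - x) = r / \<kappa>"
    define S where "S = (SUP y\<in>cball z r. \<bar>P y\<bar>)"
    have bdd: "bdd_above ((\<lambda>y. \<bar>P y\<bar>) ` cball z r)" using A by (intro bdd_aboveI2) auto
    have SU: "\<bar>P y\<bar> \<le> S" if "y \<in> cball z r" for y
      unfolding S_def by (rule cSUP_upper[OF that bdd])
    have zin: "z \<in> cball z r" using r by simp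
    have S0: "S \<ge> 0" using SU[OF zin] by linarith
    \<comment> \<open>P is not known to be continuous, so a near-maximiser replaces a
      maximiser.\<close>
    have "\<exists>y0\<in>cball z r. \<bar>P y0\<bar> \<ge> 9 / 10 * S"
    proof (cases "S = 0")
      case True thus ?thesis using zin by (intro bexI[of _ z]) simp_all
    next
      case False
      hence "9 / 10 * S < S" using S0 by simp
      thus ?thesis unfolding S_def using less_cSUP_iff[OF _ bdd] zin by (metis empty_iff less_imp_le)
    qed
    then obtain y0 where y0: "y0 \<in> cball z r" "\<bar>P y0\<bar> \<ge> 9 / 10 * S" by auto
    define y1 where "y1 = y0 + \<tau> *\<^sub>R (z - y0)"
    have y0z: "norm (y0 - z) \<le> r" using y0 by (simp add: dist_norm norm_minus_commute)
    have y1z: "norm (y1 - z) \<le> (1 - \<tau>) * r"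
    proof -
      have "y1 - z = (1 - \<tau>) *\<^sub>R (y0 - z)" by (simp add: y1_def algebra_simps)
      thus ?thesis using y0z \<tau> by (simp add: mult_left_mono)
    qed
    have "\<bar>P y1 - P y0\<bar> \<le> (1 / 10) * S"
    proof -
      have "\<bar>P (y0 + lagrange_node l i *\<^sub>R (z - y0))\<bar> \<le> S" if "i < l" for i
      proof (rule SU)
        let ?t = "lagrange_node l i"
        have "(y0 + ?t *\<^sub>R (z - y0)) - z = (1 - ?t) *\<^sub>R (y0 - z)" by (simp add: algebra_simps)
        hence "norm ((y0 + ?t *\<^sub>R (z - y0)) - z) \<le> 1 * r"
          using lagrange_node_bounds[OF that] y0z r mult_mono[of "1 - ?t" 1 "norm (y0 - z)" r] by simp
        thus "y0 + ?t *\<^sub>R (z - y0) \<in> cball z r" by (simp add: dist_norm norm_minus_commute)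
      qed
      from line_poly_bound(2)[OF P this, of \<tau>] have "\<bar>P y1 - P y0\<bar> \<le> (\<Sum>i<l. \<bar>lagrange_basis l i \<tau> - lagrange_basis l i 0\<bar>) * S"
        by (simp add: y1_def)
      also have "\<dots> \<le> (1 / 10) * S" using \<tau> S0 by (intro mult_right_mono) auto
      finally show ?thesis .
    qed
    have near: "norm (y1 + u - z) \<le> r" if "norm u \<le> \<tau> * r" for u
      using norm_triangle_ineq[of "y1 - z" u] y1z that by (simp add: algebra_simps)
    have "cball y1 (\<tau>\<^sup>2 * r) \<subseteq> cball z r"
    proof
      fix y assume "y \<in> cball y1 (\<tau>\<^sup>2 * r)"
      hence "norm (y - y1) \<le> \<tau>\<^sup>2 * r" by (simp add: dist_norm norm_minus_commute)
      also have "\<dots> \<le> \<tau> * r" using \<tau> r by (simp add: power2_eq_square)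
      finally show "y \<in> cball z r" using near[of "y - y1"] by (simp add: dist_norm norm_minus_commute)
    qed
    moreover have "\<forall>y\<in>cball y1 (\<tau>\<^sup>2 * r). S / 2 \<le> \<bar>P y\<bar>"
    proof
      fix y assume "y \<in> cball y1 (\<tau>\<^sup>2 * r)"
      hence yy: "norm (y - y1) \<le> \<tau> * (\<tau> * r)" by (simp add: dist_norm norm_minus_commute power2_eq_square)
      \<comment> \<open>Scaled so that y has parameter \<tau> on the segment from \<open>y1\<close>
        to \<open>y1 + v\<close>, which lies entirely in the large ball.\<close>
      define v where "v = (1 / \<tau>) *\<^sub>R (y - y1)"
      have v: "norm v \<le> \<tau> * r" using yy \<tau> unfolding v_def norm_scaleR by (simp add: field_simps)
      have "\<bar>P (y1 + lagrange_node l i *\<^sub>R v)\<bar> \<le> S" if "i < l" for i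
      proof (rule SU)
        have "norm (lagrange_node l i *\<^sub>R v) \<le> 1 * (\<tau> * r)"
          using lagrange_node_bounds[OF that] v r \<tau> mult_mono[of "lagrange_node l i" 1 "norm v" "\<tau> * r"] by simp
        from near[of "lagrange_node l i *\<^sub>R v"] this
        show "y1 + lagrange_node l i *\<^sub>R v \<in> cball z r" by (simp add: dist_norm norm_minus_commute)
      qed
      from line_poly_bound(2)[OF P this, of \<tau>] have "\<bar>P y - P y1\<bar> \<le> (\<Sum>i<l. \<bar>lagrange_basis l i \<tau> - lagrange_basis l i 0\<bar>) * S"
        using \<tau> by (simp add: v_def)
      also have "\<dots> \<le> (1 / 10) * S" using \<tau> S0 by (intro mult_right_mono) auto
      finally show "S / 2 \<le> \<bar>P y\<bar>" using y0(2) \<open>\<bar>P y1 - P y0\<bar> \<le> (1 / 10) * S\<close> S0 by linarith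
    qed
    moreover have "\<bar>P x\<bar> \<le> \<Lambda> * S"
    proof -
      define v where "v = \<kappa> *\<^sub>R (z - x)"
      have v: "norm v = r" using x \<kappa> by (simp add: v_def)
      have "\<bar>P (z + lagrange_node l i *\<^sub>R v)\<bar> \<le> S" if "i < l" for i
      proof (rule SU)
        have "norm (lagrange_node l i *\<^sub>R v) \<le> 1 * r"
          using lagrange_node_bounds[OF that] v r by (auto intro!: mult_mono)
        thus "z + lagrange_node l i *\<^sub>R v \<in> cball z r" by (simp add: dist_norm)
      qed
      from line_poly_bound(1)[OF P this, of "- 1 / \<kappa>"] have "\<bar>P x\<bar> \<le> (\<Sum>i<l. \<bar>lagrange_basis l i (- 1 / \<kappa>)\<bar>) * S"
        using \<kappa> by (simp add: v_def)
      also have "\<dots> \<le> \<Lambda> * S" using S0 by (intro mult_right_mono) (auto simp: \<Lambda>_def)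
      finally show ?thesis .
    qed
    ultimately show "\<exists>y1 S. S \<ge> 0 \<and> cball y1 (\<tau>\<^sup>2 * r) \<subseteq> cball z r \<and> (\<forall>y\<in>cball y1 (\<tau>\<^sup>2 * r). S / 2 \<le> \<bar>P y\<bar>) \<and> \<bar>P x\<bar> \<le> \<Lambda> * S"
      using S0 by blast
  qed
qed

text \<open>The concentric ball of half the radius is covered by \<rho>-balls about design points,
  and \<rho> <= r/2 keeps those points inside the full ball; comparing volumes bounds their number
  from below.\<close>

lemma card_cover_lower_bound:
  fixes p :: "nat \<Rightarrow> 'a::euclidean_space"
  assumes cover: "\<And>y. y \<in> cball c r \<Longrightarrow> \<exists>k<n. dist y (p k) \<le> \<rho>" and \<rho>: "0 < \<rho>" "\<rho> \<le> r / 2"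
  shows "(r / (2 * \<rho>)) ^ DIM('a) \<le> real (card {k. k < n \<and> p k \<in> cball c r})"
proof -
  define N where "N = {k. k < n \<and> p k \<in> cball c r}"
  define V where "V = unit_ball_vol (real DIM('a))"
  have V: "V > 0" by (simp add: V_def)
  have sub: "cball c (r / 2) \<subseteq> (\<Union>k\<in>N. cball (p k) \<rho>)"
  proof
    fix y assume y: "y \<in> cball c (r / 2)"
    then obtain k where k: "k < n" "dist y (p k) \<le> \<rho>" using cover[of y] \<rho> by auto
    have "dist c (p k) \<le> r" using dist_triangle[of c "p k" y] y k \<rho> by simp
    thus "y \<in> (\<Union>k\<in>N. cball (p k) \<rho>)" using k by (auto simp: N_def dist_commute)
  qed
  have fin: "finite N" by (simp add: N_def)
  have "V * (r / 2) ^ DIM('a) = measure lborel (cball c (r / 2))"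
    using \<rho> by (simp add: content_cball V_def)
  also have "\<dots> \<le> measure lborel (\<Union>k\<in>N. cball (p k) \<rho>)"
    using sub fin emeasure_lborel_cball_finite
    by (intro measure_mono_fmeasurable fmeasurable.finite_UN fmeasurableI) auto
  also have "\<dots> \<le> (\<Sum>k\<in>N. measure lborel (cball (p k) \<rho>))"
    by (intro measure_UNION_le fin) auto
  also have "\<dots> = real (card N) * (V * \<rho> ^ DIM('a))"
    using \<rho> by (simp add: content_cball V_def)
  finally have "(r / 2) ^ DIM('a) \<le> real (card N) * \<rho> ^ DIM('a)" using V by simp
  hence "(r / 2) ^ DIM('a) / \<rho> ^ DIM('a) \<le> real (card N)" using \<rho> by (subst pos_divide_le_eq) auto
  thus ?thesis by (simp add: N_def power_divide[symmetric])
qed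

text \<open>Along a line the inner product is affine in the parameter, which leaves a polynomial of
  degree below \<open>l\<close>. Taylor polynomials of plane waves have this shape.\<close>

lemma line_poly_ridge:
  fixes \<omega> x :: "'a::euclidean_space" and c :: "nat \<Rightarrow> real"
  shows "line_poly l (\<lambda>y. \<Sum>j<l. c j * (\<omega> \<bullet> (y - x)) ^ j)"
  unfolding line_poly_def
proof (intro allI)
  fix b v :: 'a and t :: real
  define q where "q = (\<Sum>j<l. Polynomial.smult (c j) ([:\<omega> \<bullet> (b - x), \<omega> \<bullet> v:] ^ j))"
  have q: "poly q s = (\<Sum>j<l. c j * (\<omega> \<bullet> (b + s *\<^sub>R v - x)) ^ j)" for s
    by (simp add: q_def poly_sum inner_diff_right inner_add_right algebra_simps)
  show "(\<Sum>j<l. c j * (\<omega> \<bullet> (b + t *\<^sub>R v - x)) ^ j) =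
     (\<Sum>i<l. lagrange_basis l i t * (\<Sum>j<l. c j * (\<omega> \<bullet> (b + lagrange_node l i *\<^sub>R v - x)) ^ j))"
  proof (cases "l = 0")
    case False
    have "degree q \<le> l - 1"
      unfolding q_def
    proof (intro degree_sum_le)
      fix j assume "j \<in> {..<l}"
      have "degree [:\<omega> \<bullet> (b - x), \<omega> \<bullet> v:] \<le> 1" by (rule order.trans[OF degree_pCons_le]) simp
      hence "degree ([:\<omega> \<bullet> (b - x), \<omega> \<bullet> v:] ^ j) \<le> 1 * j"
        by (intro order.trans[OF degree_power_le] mult_right_mono) auto
      also have "\<dots> \<le> l - 1" using \<open>j \<in> {..<l}\<close> by auto
      finally show "degree (Polynomial.smult (c j) ([:\<omega> \<bullet> (b - x), \<omega> \<bullet> v:] ^ j)) \<le> l - 1"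
        by (rule order.trans[OF degree_smult_le])
    qed simp
    hence "degree q < l" using False by simp
    from lagrange_interpolation[OF this, of t] show ?thesis unfolding q .
  qed simp
qed

lemma line_poly_integral:
  fixes f :: "'b \<Rightarrow> 'a::real_vector \<Rightarrow> real"
  assumes "\<And>\<omega>. line_poly l (f \<omega>)" and int: "\<And>y. integrable M (\<lambda>\<omega>. f \<omega> y)"
  shows "line_poly l (\<lambda>y. LINT \<omega>|M. f \<omega> y)"
  unfolding line_poly_def
proof (intro allI)
  fix b v t
  have "(LINT \<omega>|M. f \<omega> (b + t *\<^sub>R v)) = (LINT \<omega>|M. (\<Sum>i<l. lagrange_basis l i t * f \<omega> (b + lagrange_node l i *\<^sub>R v)))"
    using assms(1) unfolding line_poly_def by (intro Bochner_Integration.integral_cong refl) blast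
  also have "\<dots> = (\<Sum>i<l. lagrange_basis l i t * (LINT \<omega>|M. f \<omega> (b + lagrange_node l i *\<^sub>R v)))"
    by (subst Bochner_Integration.integral_sum) (auto intro!: int)
  finally show "(LINT \<omega>|M. f \<omega> (b + t *\<^sub>R v)) = (\<Sum>i<l. lagrange_basis l i t * (LINT \<omega>|M. f \<omega> (b + lagrange_node l i *\<^sub>R v)))" .
qed

text \<open>The Taylor polynomial of \<open>cis (- \<theta>)\<close>; the sign matches the phases
  -\<omega>.(y - x) of the residual function.\<close>

definition cis_taylor :: "nat \<Rightarrow> real \<Rightarrow> complex" where
  "cis_taylor l \<theta> = (\<Sum>j<l. (- \<i> * \<theta>) ^ j / fact j)"

lemma cis_taylor_bound: "cmod (cis_taylor l \<theta>) \<le> exp \<bar>\<theta>\<bar>"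
proof -
  have "cmod (cis_taylor l \<theta>) \<le> (\<Sum>j<l. \<bar>\<theta>\<bar> ^ j / fact j)"
    unfolding cis_taylor_def by (rule order.trans[OF norm_sum]) (simp add: norm_divide norm_power norm_mult)
  also have "\<dots> = (\<Sum>j<l. \<bar>\<theta>\<bar> ^ j /\<^sub>R fact j)" by (simp add: divide_inverse mult.commute)
  also have "\<dots> \<le> exp \<bar>\<theta>\<bar>"
    unfolding exp_def using summable_exp_generic[of "\<bar>\<theta>\<bar>"] by (intro sum_le_suminf) auto
  finally show ?thesis .
qed

lemma cis_taylor_error:
  assumes "l > 0"
  shows "cmod (cis (- \<theta>) - cis_taylor l \<theta>) \<le> \<bar>\<theta>\<bar> ^ l"
proof -
  obtain n where n: "l = Suc n" using assms by (cases l) auto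
  have "cmod (iexp (- \<theta>) - (\<Sum>k \<le> n. (\<i> * (- \<theta>))^k / fact k)) \<le> \<bar>- \<theta>\<bar>^(Suc n) / fact (Suc n)"
    using iexp_approx1[of "- \<theta>" n] by simp
  also have "\<dots> \<le> \<bar>\<theta>\<bar> ^ l / 1" unfolding n by (intro divide_left_mono frac_le) (auto simp: fact_ge_1 simp del: fact_Suc)
  finally show ?thesis by (simp add: n cis_taylor_def cis_conv_exp lessThan_Suc_atMost)
qed

text \<open>Brings the real part into the form with real coefficients that
  \<open>line_poly_ridge\<close> covers.\<close>

lemma Re_mult_cis_taylor: "Re (F * cis_taylor l \<theta>) = (\<Sum>j<l. Re (F * ((- \<i>) ^ j / fact j)) * \<theta> ^ j)"
proof -
  have "F * cis_taylor l \<theta> = (\<Sum>j<l. (\<theta> ^ j) *\<^sub>R (F * ((- \<i>) ^ j / fact j)))"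
    unfolding cis_taylor_def sum_distrib_left
    by (intro sum.cong refl) (simp only: power_mult_distrib scaleR_conv_of_real of_real_power mult_ac times_divide_eq_left times_divide_eq_right)
  thus ?thesis by (simp add: mult.commute)
qed

lemma cis_taylor_measurable [measurable (raw)]: "f \<in> borel_measurable M \<Longrightarrow> (\<lambda>x. cis_taylor l (f x)) \<in> borel_measurable M"
proof -
  have "continuous_on UNIV (cis_taylor l)"
    unfolding cis_taylor_def by (intro continuous_intros) auto
  hence "cis_taylor l \<in> borel_measurable borel" by (rule borel_measurable_continuous_onI)
  thus "f \<in> borel_measurable M \<Longrightarrow> (\<lambda>x. cis_taylor l (f x)) \<in> borel_measurable M"
    by measurable
qed

text \<open>The weight (2 H |\<omega>|)^l bounds the Taylor remainder of a frequency \<omega> below the cut-off 1/H at distance at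
  most 2 H; frequencies above the cut-off do not enter the Taylor polynomial.\<close>
lemma matern_density_taylor_weight:
  fixes a \<nu> :: real
  assumes a: "a > 0" and \<nu>: "\<nu> > 0" and l: "real l \<ge> \<nu> + real DIM('a) / 2"
  obtains C where "C > 0" "\<And>(H::real) \<omega>. H > 0 \<Longrightarrow>
      matern_density a \<nu> (\<omega>::'a::euclidean_space) * (if norm \<omega> \<le> 1 / H then (2 * H * norm \<omega>) ^ l else 1)\<^sup>2 \<le>
      C * H powr (2 * \<nu>) * matern_density (1 / H) \<nu> \<omega>"
proof -
  define m where "m = \<nu> + real DIM('a) / 2"
  define \<kappa> where "\<kappa> = Gamma m / (Gamma \<nu> * pi powr (real DIM('a) / 2))"
  have m: "m > 0" using \<nu> by (simp add: m_def add_pos_nonneg)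
  have \<kappa>: "\<kappa> > 0"
    unfolding \<kappa>_def using \<nu> m by (auto intro!: divide_pos_pos mult_pos_pos Gamma_real_pos)
  have D: "matern_density a \<nu> \<omega> = \<kappa> * a powr (2 * \<nu>) * (a\<^sup>2 + (norm \<omega>)\<^sup>2) powr (- m)" for a and \<omega> :: 'a
    by (simp add: matern_density_def \<kappa>_def m_def)
  have l0: "l > 0" using l m by (cases l) (auto simp: m_def)
  define C where "C = a powr (2 * \<nu>) * (4 ^ l * 2 powr m)"
  show ?thesis
  proof (rule that[of C])
    show "C > 0" using a by (simp add: C_def)
    fix H :: real and \<omega> :: 'a
    assume H: "H > 0"
    let ?G = "if norm \<omega> \<le> 1 / H then (2 * H * norm \<omega>) ^ l else 1"
    define W where "W = ((1 / H)\<^sup>2 + (norm \<omega>)\<^sup>2) powr (- m)"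
    have R: "H powr (2 * \<nu>) * matern_density (1 / H) \<nu> \<omega> = \<kappa> * W"
      using H by (simp add: D W_def powr_divide)
    have "(a\<^sup>2 + (norm \<omega>)\<^sup>2) powr (- m) * ?G\<^sup>2 \<le> 4 ^ l * 2 powr m * W"
    \<comment> \<open>At frequency 0 the comparison with |\<omega>|^(-2m) would fail, since
      \<open>0 powr r\<close> is 0; there the weight vanishes because \<open>l > 0\<close>.\<close>
    proof (cases "\<omega> = 0")
      case True
      thus ?thesis using l0 H by (auto simp: W_def power_0_left)
    next
      case False
      have w2: "(norm \<omega>)\<^sup>2 > 0" using False by simp
      have le1: "(a\<^sup>2 + (norm \<omega>)\<^sup>2) powr (- m) \<le> ((norm \<omega>)\<^sup>2) powr (- m)"
        using w2 m by (intro powr_mono2') auto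
      have two: "(2 * X) powr (- m) = X powr (- m) / 2 powr m" for X :: real
        by (simp only: powr_mult powr_minus divide_inverse inverse_mult_distrib mult.commute)
      have div: "X \<le> 2 powr m * W" if "X / 2 powr m \<le> W" for X
      proof -
        have "2 powr m > 0" by simp
        thus ?thesis using that by (simp only: pos_divide_le_eq mult.commute)
      qed
      show ?thesis
      proof (cases "norm \<omega> \<le> 1 / H")
        case True
        let ?N = "((norm \<omega>)\<^sup>2) powr (- m)"
        \<comment> \<open>The place where the degree matters: H |\<omega>| <= 1 together with l >=
          m.\<close>
        have pow: "((H * norm \<omega>)\<^sup>2) ^ l \<le> ((H * norm \<omega>)\<^sup>2) powr m"
        proof -
          have "((H * norm \<omega>)\<^sup>2) ^ l = ((H * norm \<omega>)\<^sup>2) powr (real l)"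
            using H False by (simp add: powr_realpow)
          also have "\<dots> \<le> ((H * norm \<omega>)\<^sup>2) powr m"
          proof (rule powr_mono')
            have "H * norm \<omega> \<le> 1" using True H by (simp add: field_simps)
            thus "(H * norm \<omega>)\<^sup>2 \<le> 1" using H by (simp add: power_le_one)
          qed (use l in \<open>auto simp: m_def\<close>)
          finally show ?thesis .
        qed
        have "((2 * H * norm \<omega>) ^ l)\<^sup>2 = ((2 * H * norm \<omega>)\<^sup>2) ^ l"
          by (simp only: mult.commute flip: power_mult)
        also have "(2 * H * norm \<omega>)\<^sup>2 = 4 * (H * norm \<omega>)\<^sup>2" by (simp add: power_mult_distrib)
        finally have "?N * ((2 * H * norm \<omega>) ^ l)\<^sup>2 = 4 ^ l * (?N * ((H * norm \<omega>)\<^sup>2) ^ l)"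
          by (simp only: power_mult_distrib mult_ac)
        also have "\<dots> \<le> 4 ^ l * (?N * ((H * norm \<omega>)\<^sup>2) powr m)"
          by (intro mult_left_mono pow) auto
        also have "((norm \<omega>)\<^sup>2) powr (- m) * ((H * norm \<omega>)\<^sup>2) powr m = (H\<^sup>2) powr m"
          using w2 by (simp only: power_mult_distrib powr_mult powr_minus) simp
        also have "(H\<^sup>2) powr m = ((1 / H)\<^sup>2) powr (- m)"
          by (simp only: powr_minus power_one_over powr_divide powr_one_eq_one inverse_eq_divide) simp
        also have "4 ^ l * ((1 / H)\<^sup>2) powr (- m) \<le> 4 ^ l * (2 powr m * W)"
        proof (intro mult_left_mono)
          have "(norm \<omega>)\<^sup>2 \<le> (1 / H)\<^sup>2" using True by (intro power_mono) auto
          hence "(2 * (1 / H)\<^sup>2) powr (- m) \<le> W" unfolding W_def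
            using H m by (intro powr_mono2') (auto intro!: add_pos_nonneg)
          thus "((1 / H)\<^sup>2) powr (- m) \<le> 2 powr m * W"
            unfolding two by (rule div)
        qed simp
        finally have "?N * ((2 * H * norm \<omega>) ^ l)\<^sup>2 \<le> 4 ^ l * (2 powr m * W)" .
        moreover have "(a\<^sup>2 + (norm \<omega>)\<^sup>2) powr (- m) * ?G\<^sup>2 \<le> ((norm \<omega>)\<^sup>2) powr (- m) * ((2 * H * norm \<omega>) ^ l)\<^sup>2"
          using True by (auto intro!: mult_right_mono le1)
        ultimately show ?thesis by simp
      next
        case F2: False
        have "(1 / H)\<^sup>2 \<le> (norm \<omega>)\<^sup>2" using F2 H by (intro power_mono) auto
        hence "(2 * (norm \<omega>)\<^sup>2) powr (- m) \<le> W" unfolding W_def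
          using w2 m H by (intro powr_mono2') (auto intro!: add_pos_nonneg)
        hence "((norm \<omega>)\<^sup>2) powr (- m) \<le> 2 powr m * W"
          unfolding two by (rule div)
        also have "\<dots> \<le> 4 ^ l * (2 powr m * W)"
          using mult_right_mono[of 1 "4 ^ l" "2 powr m * W"] by (simp add: W_def)
        finally show ?thesis using le1 F2 by simp
      qed
    qed
    hence "\<kappa> * a powr (2 * \<nu>) * ((a\<^sup>2 + (norm \<omega>)\<^sup>2) powr (- m) * ?G\<^sup>2) \<le> \<kappa> * a powr (2 * \<nu>) * (4 ^ l * 2 powr m * W)"
      using \<kappa> by (intro mult_left_mono) auto
    moreover have "C * H powr (2 * \<nu>) * matern_density (1 / H) \<nu> \<omega> = \<kappa> * a powr (2 * \<nu>) * (4 ^ l * 2 powr m * W)"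
      unfolding mult.assoc[of C] R by (simp add: C_def)
    ultimately show "matern_density a \<nu> \<omega> * ?G\<^sup>2 \<le> C * H powr (2 * \<nu>) * matern_density (1 / H) \<nu> \<omega>"
      unfolding D[of a] by (simp only: mult.assoc)
  qed
qed

section \<open>Local error bound for kernel interpolation\<close>

lemma has_bochner_integral_abs_le:
  fixes f g :: "'a \<Rightarrow> real"
  assumes f: "has_bochner_integral M f i" and g: "has_bochner_integral M g j" and le: "\<And>x. \<bar>f x\<bar> \<le> g x"
  shows "\<bar>i\<bar> \<le> j"
proof -
  have "f x \<le> g x" "- f x \<le> g x" for x using le[of x] by linarith+
  thus ?thesis
    using has_bochner_integral_mono[OF f g] has_bochner_integral_mono[OF has_bochner_integral_minus[OF f] g]
    by (simp add: abs_le_iff)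
qed

text \<open>Cauchy-Schwarz recovered from its weighted AM-GM form by the choice s = B/e. Only linear
  inequalities between integrals have to be supplied, and Q = 0 is covered.\<close>

lemma square_le_of_am_gm:
  fixes e Q B :: real
  assumes "e \<ge> 0" "Q \<ge> 0" "B > 0" and le: "\<And>s. s > 0 \<Longrightarrow> e \<le> (s * Q + B / s) / 2"
  shows "e\<^sup>2 \<le> B * Q"
proof (cases "e = 0")
  case False
  hence e: "e > 0" using assms by simp
  have "e \<le> (B / e * Q + B / (B / e)) / 2" using e assms by (intro le) simp
  hence "e \<le> B * Q / e" using e assms(3) by simp
  thus ?thesis using e by (simp add: pos_le_divide_eq power2_eq_square)
qed (use assms in simp)

text \<open>In the spectral measure the symbol E of the residual function has squared norm
  \<open>pred_var\<close>. Replacing the plane waves of frequency at most 1/H by Taylor polynomials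
  at x and dropping the others leaves an error factor whose square integrates to O(H^(2\<nu>)), and
  Cauchy-Schwarz gives the product. The bound \<open>A\<close> may depend on the weights; it
  expresses mere finiteness.\<close>

lemma band_limited_approx:
  fixes a \<nu> :: real
  assumes a: "a > 0" and \<nu>: "\<nu> > 0" and l: "real l \<ge> \<nu> + real DIM('a) / 2"
  obtains B where "B > 0" "\<And>(n::nat) p w (x::'a::euclidean_space) (H::real). H > 0 \<Longrightarrow>
     \<exists>P A. line_poly l P \<and> (\<forall>y\<in>cball x (2 * H). \<bar>P y\<bar> \<le> A) \<and>
       (\<forall>y\<in>cball x (2 * H). (gauss_mix a \<nu> (x - y) - (\<Sum>k<n. w k * gauss_mix a \<nu> (p k - y)) - P y)\<^sup>2
           \<le> B * H powr (2 * \<nu>) * pred_var (gauss_mix a \<nu>) n p w x)"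
proof -
  obtain B where B: "B > 0" "\<And>(H::real) \<omega>. H > 0 \<Longrightarrow>
      matern_density a \<nu> (\<omega>::'a) * (if norm \<omega> \<le> 1 / H then (2 * H * norm \<omega>) ^ l else 1)\<^sup>2 \<le>
      B * H powr (2 * \<nu>) * matern_density (1 / H) \<nu> \<omega>"
    using matern_density_taylor_weight[OF a \<nu> l] by blast
  have l0: "l > 0" using l \<nu> by (cases l) (auto simp: add_pos_nonneg not_le)
  show ?thesis
  proof (rule that[OF B(1)])
    fix n :: nat and p w and x :: 'a and H :: real
    assume H: "H > 0"
    let ?D = "matern_density a \<nu> :: 'a \<Rightarrow> real"
    let ?f = "\<lambda>y. gauss_mix a \<nu> (x - y) - (\<Sum>k<n. w k * gauss_mix a \<nu> (p k - y))"
    define E where "E \<omega> = cis (\<omega> \<bullet> x) - exp_sum n p w \<omega>" for \<omega>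
    \<comment> \<open>Recentred at x, so that the phases become -\<omega>.(y - x).\<close>
    define F where "F \<omega> = E \<omega> * cis (- (\<omega> \<bullet> x))" for \<omega>
    define I where "I \<omega> = (indicator (cball 0 (1 / H)) \<omega> :: real)" for \<omega> :: 'a
    define g where "g \<omega> y = I \<omega> * (?D \<omega> * Re (F \<omega> * cis_taylor l (\<omega> \<bullet> (y - x))))" for \<omega> y
    define P where "P y = (LINT \<omega>|lborel. g \<omega> y)" for y
    \<comment> \<open>A crude bound on |F| for integrability and for \<open>A\<close>; the constant
      B is independent of it.\<close>
    define L where "L = 1 + (\<Sum>k<n. \<bar>w k\<bar>)"
    have [measurable]: "I \<in> borel_measurable borel"
      unfolding I_def[abs_def] by (intro borel_measurable_indicator) simp
    have [measurable]: "E \<in> borel_measurable borel" "F \<in> borel_measurable borel"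
      unfolding E_def[abs_def] F_def[abs_def] by measurable
    have FE: "cmod (F \<omega>) = cmod (E \<omega>)" for \<omega> by (simp add: F_def norm_mult)
    have FL: "cmod (F \<omega>) \<le> L" for \<omega>
    proof -
      have "cmod (exp_sum n p w \<omega>) \<le> (\<Sum>k<n. \<bar>w k\<bar>)"
        unfolding exp_sum_def by (rule order.trans[OF norm_sum]) simp
      thus ?thesis unfolding FE E_def L_def by (intro order.trans[OF norm_triangle_ineq4]) simp
    qed
    have L0: "L \<ge> 0" by (simp add: L_def sum_nonneg)
    have D0: "?D \<omega> \<ge> 0" for \<omega> by (rule matern_density_nonneg[OF \<nu>])
    have Dint: "integrable lborel ?D" "(LINT \<omega>|lborel. ?D \<omega>) = 1"
      using integrable_matern_density[OF a \<nu>, where 'a='a] by (auto simp: has_bochner_integral_iff)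
    have gb: "\<bar>g \<omega> y\<bar> \<le> ?D \<omega> * (L * exp (norm (y - x) / H))" for \<omega> y
    proof (cases "\<omega> \<in> cball 0 (1 / H)")
      case True
      hence "norm \<omega> \<le> 1 / H" by simp
      hence "norm \<omega> * norm (y - x) \<le> 1 / H * norm (y - x)" by (intro mult_right_mono) auto
      hence "\<bar>\<omega> \<bullet> (y - x)\<bar> \<le> norm (y - x) / H"
        using Cauchy_Schwarz_ineq2[of \<omega> "y - x"] by simp
      hence "cmod (cis_taylor l (\<omega> \<bullet> (y - x))) \<le> exp (norm (y - x) / H)"
        by (intro order.trans[OF cis_taylor_bound]) simp
      hence "cmod (F \<omega>) * cmod (cis_taylor l (\<omega> \<bullet> (y - x))) \<le> L * exp (norm (y - x) / H)"
        by (intro mult_mono FL L0) auto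
      hence "\<bar>Re (F \<omega> * cis_taylor l (\<omega> \<bullet> (y - x)))\<bar> \<le> L * exp (norm (y - x) / H)"
        using abs_Re_le_cmod[of "F \<omega> * cis_taylor l (\<omega> \<bullet> (y - x))"] unfolding norm_mult by linarith
      thus ?thesis
        using True D0[of \<omega>] by (simp add: g_def I_def abs_mult mult_left_mono)
    qed (use D0[of \<omega>] L0 in \<open>simp add: g_def I_def\<close>)
    have gint: "integrable lborel (\<lambda>\<omega>. g \<omega> y)" for y
    proof (rule Bochner_Integration.integrable_bound)
      show "integrable lborel (\<lambda>\<omega>. ?D \<omega> * (L * exp (norm (y - x) / H)))" using Dint by simp
      show "(\<lambda>\<omega>. g \<omega> y) \<in> borel_measurable lborel" unfolding g_def by measurable
      show "AE \<omega> in lborel. norm (g \<omega> y) \<le> norm (?D \<omega> * (L * exp (norm (y - x) / H)))"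
        using gb[of _ y] by (intro AE_I2) (auto intro: order.trans[OF _ abs_ge_self])
    qed
    have "line_poly l P"
      unfolding P_def
    proof (rule line_poly_integral[OF _ gint])
      fix \<omega>
      have "g \<omega> = (\<lambda>y. \<Sum>j<l. (I \<omega> * (?D \<omega> * Re (F \<omega> * ((- \<i>) ^ j / fact j)))) * (\<omega> \<bullet> (y - x)) ^ j)"
        unfolding g_def Re_mult_cis_taylor by (simp only: sum_distrib_left mult.assoc)
      thus "line_poly l (g \<omega>)" by (simp only: line_poly_ridge)
    qed
    moreover have "\<forall>y\<in>cball x (2 * H). \<bar>P y\<bar> \<le> L * exp 2"
    proof
      fix y assume "y \<in> cball x (2 * H)"
      hence "norm (y - x) / H \<le> 2" using H by (simp add: dist_norm norm_minus_commute field_simps)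
      hence "L * exp (norm (y - x) / H) \<le> L * exp 2" using L0 by (intro mult_left_mono) auto
      moreover have "\<bar>P y\<bar> \<le> 1 * (L * exp (norm (y - x) / H))"
      proof (rule has_bochner_integral_abs_le[OF _ _ gb])
        show "has_bochner_integral lborel (\<lambda>\<omega>. g \<omega> y) (P y)"
          unfolding P_def using gint by (simp add: has_bochner_integral_iff)
        show "has_bochner_integral lborel (\<lambda>\<omega>. ?D \<omega> * (L * exp (norm (y - x) / H))) (1 * (L * exp (norm (y - x) / H)))"
          by (intro has_bochner_integral_mult_left integrable_matern_density a \<nu>)
      qed
      ultimately show "\<bar>P y\<bar> \<le> L * exp 2" by linarith
    qed
    moreover have "\<forall>y\<in>cball x (2 * H). (?f y - P y)\<^sup>2 \<le> B * H powr (2 * \<nu>) * pred_var (gauss_mix a \<nu>) n p w x"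
    proof
      fix y assume "y \<in> cball x (2 * H)"
      hence y: "norm (y - x) \<le> 2 * H" by (simp add: dist_norm norm_minus_commute)
      let ?\<theta> = "\<lambda>\<omega>. \<omega> \<bullet> (y - x)"
      define Q where "Q = pred_var (gauss_mix a \<nu>) n p w x"
      define B' where "B' = B * H powr (2 * \<nu>)"
      have B': "B' > 0" using B H by (simp add: B'_def)
      have f: "has_bochner_integral lborel (\<lambda>\<omega>. ?D \<omega> * Re (F \<omega> * cis (- ?\<theta> \<omega>))) (?f y)"
      proof -
        have "has_bochner_integral lborel (\<lambda>\<omega>. ?D \<omega> * Re (cis (\<omega> \<bullet> (x - y))) - (\<Sum>k<n. w k * (?D \<omega> * Re (cis (\<omega> \<bullet> (p k - y)))))) (?f y)"
          by (intro has_bochner_integral_diff has_bochner_integral_sum has_bochner_integral_mult_right gauss_mix_spectral_Re a \<nu>)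
        moreover have "?D \<omega> * Re (cis (\<omega> \<bullet> (x - y))) - (\<Sum>k<n. w k * (?D \<omega> * Re (cis (\<omega> \<bullet> (p k - y))))) = ?D \<omega> * Re (F \<omega> * cis (- ?\<theta> \<omega>))" for \<omega>
        proof -
          have "F \<omega> * cis (- ?\<theta> \<omega>) = E \<omega> * cis (- (\<omega> \<bullet> y))"
            unfolding F_def mult.assoc cis_mult by (simp add: inner_diff_right)
          also have "\<dots> = cis (\<omega> \<bullet> (x - y)) - (\<Sum>k<n. w k *\<^sub>R cis (\<omega> \<bullet> (p k - y)))"
            unfolding E_def exp_sum_def left_diff_distrib sum_distrib_right mult_scaleR_left cis_mult
            by (simp add: inner_diff_right)
          finally show ?thesis by (simp add: right_diff_distrib sum_distrib_left mult_ac)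
        qed
        ultimately show ?thesis by simp
      qed
      have diff: "has_bochner_integral lborel (\<lambda>\<omega>. ?D \<omega> * Re (F \<omega> * cis (- ?\<theta> \<omega>)) - g \<omega> y) (?f y - P y)"
        by (intro has_bochner_integral_diff f) (simp add: P_def has_bochner_integral_iff gint)
      have "\<bar>?f y - P y\<bar>\<^sup>2 \<le> B' * Q"
      proof (rule square_le_of_am_gm)
        show "Q \<ge> 0" unfolding Q_def by (rule pred_var_nonneg[OF a \<nu>])
        fix \<eta> :: real assume \<eta>: "\<eta> > 0"
        show "\<bar>?f y - P y\<bar> \<le> (\<eta> * Q + B' / \<eta>) / 2"
        proof (rule has_bochner_integral_abs_le[OF diff])
          \<comment> \<open>The auxiliary density with \<open>a = 1 / H\<close> has mass 1, so the
            Taylor weight contributes just \<open>B'\<close>.\<close>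
          have "has_bochner_integral lborel (\<lambda>\<omega>. (\<eta> * (?D \<omega> * (cmod (E \<omega>))\<^sup>2) + B' * matern_density (1 / H) \<nu> \<omega> / \<eta>) / 2) ((\<eta> * Q + B' * 1 / \<eta>) / 2)"
            unfolding Q_def E_def
            by (intro has_bochner_integral_divide_zero has_bochner_integral_add has_bochner_integral_mult_right pred_var_spectral integrable_matern_density a \<nu>)
               (use H in auto)
          thus "has_bochner_integral lborel (\<lambda>\<omega>. (\<eta> * (?D \<omega> * (cmod (E \<omega>))\<^sup>2) + B' * matern_density (1 / H) \<nu> \<omega> / \<eta>) / 2) ((\<eta> * Q + B' / \<eta>) / 2)"
            by simp
          fix \<omega> :: 'a
          define G where "G = (if norm \<omega> \<le> 1 / H then (2 * H * norm \<omega>) ^ l else 1)"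
          have G0: "G \<ge> 0" using H by (simp add: G_def)
          have th: "\<bar>?\<theta> \<omega>\<bar> \<le> 2 * H * norm \<omega>"
            using Cauchy_Schwarz_ineq2[of \<omega> "y - x"] mult_left_mono[OF y norm_ge_zero[of \<omega>]] by (simp add: mult_ac)
          have "cmod (cis (- ?\<theta> \<omega>) - I \<omega> *\<^sub>R cis_taylor l (?\<theta> \<omega>)) \<le> G"
          proof (cases "norm \<omega> \<le> 1 / H")
            case True
            have "cmod (cis (- ?\<theta> \<omega>) - cis_taylor l (?\<theta> \<omega>)) \<le> \<bar>?\<theta> \<omega>\<bar> ^ l" by (rule cis_taylor_error[OF l0])
            also have "\<dots> \<le> (2 * H * norm \<omega>) ^ l" by (intro power_mono th) auto
            finally show ?thesis using True by (simp add: G_def I_def)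
          qed (simp add: G_def I_def)
          hence "cmod (F \<omega>) * cmod (cis (- ?\<theta> \<omega>) - I \<omega> *\<^sub>R cis_taylor l (?\<theta> \<omega>)) \<le> cmod (E \<omega>) * G"
            unfolding FE by (intro mult_left_mono) auto
          hence 1: "\<bar>Re (F \<omega> * (cis (- ?\<theta> \<omega>) - I \<omega> *\<^sub>R cis_taylor l (?\<theta> \<omega>)))\<bar> \<le> cmod (E \<omega>) * G"
            using abs_Re_le_cmod[of "F \<omega> * (cis (- ?\<theta> \<omega>) - I \<omega> *\<^sub>R cis_taylor l (?\<theta> \<omega>))"] unfolding norm_mult by linarith
          have eq: "?D \<omega> * Re (F \<omega> * cis (- ?\<theta> \<omega>)) - g \<omega> y = ?D \<omega> * Re (F \<omega> * (cis (- ?\<theta> \<omega>) - I \<omega> *\<^sub>R cis_taylor l (?\<theta> \<omega>)))"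
            unfolding g_def right_diff_distrib mult_scaleR_right by (simp add: right_diff_distrib)
          have 2: "cmod (E \<omega>) * G \<le> (\<eta> * (cmod (E \<omega>))\<^sup>2 + G\<^sup>2 / \<eta>) / 2"
          proof -
            have "0 \<le> (\<eta> * cmod (E \<omega>) - G)\<^sup>2 / \<eta>" using \<eta> by simp
            also have "\<dots> = \<eta> * (cmod (E \<omega>))\<^sup>2 + G\<^sup>2 / \<eta> - 2 * (cmod (E \<omega>) * G)"
              using \<eta> by (simp add: power2_eq_square field_simps)
            finally show ?thesis by simp
          qed
          have 3: "?D \<omega> * G\<^sup>2 \<le> B' * matern_density (1 / H) \<nu> \<omega>"
            unfolding G_def B'_def by (rule B(2)[OF H])
          have "\<bar>?D \<omega> * Re (F \<omega> * cis (- ?\<theta> \<omega>)) - g \<omega> y\<bar> \<le> ?D \<omega> * ((\<eta> * (cmod (E \<omega>))\<^sup>2 + G\<^sup>2 / \<eta>) / 2)"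
            unfolding eq abs_mult abs_of_nonneg[OF D0] by (intro mult_left_mono order.trans[OF 1 2] D0)
          also have "\<dots> = (\<eta> * (?D \<omega> * (cmod (E \<omega>))\<^sup>2) + ?D \<omega> * G\<^sup>2 / \<eta>) / 2" by (simp add: algebra_simps)
          also have "\<dots> \<le> (\<eta> * (?D \<omega> * (cmod (E \<omega>))\<^sup>2) + B' * matern_density (1 / H) \<nu> \<omega> / \<eta>) / 2"
            using 3 \<eta> by (intro divide_right_mono add_left_mono) auto
          finally show "\<bar>?D \<omega> * Re (F \<omega> * cis (- ?\<theta> \<omega>)) - g \<omega> y\<bar> \<le> (\<eta> * (?D \<omega> * (cmod (E \<omega>))\<^sup>2) + B' * matern_density (1 / H) \<nu> \<omega> / \<eta>) / 2" .
        qed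
      qed (use B' in auto)
      thus "(?f y - P y)\<^sup>2 \<le> B * H powr (2 * \<nu>) * pred_var (gauss_mix a \<nu>) n p w x"
        by (simp add: B'_def Q_def)
    qed
    ultimately show "\<exists>P A. line_poly l P \<and> (\<forall>y\<in>cball x (2 * H). \<bar>P y\<bar> \<le> A) \<and>
       (\<forall>y\<in>cball x (2 * H). (?f y - P y)\<^sup>2 \<le> B * H powr (2 * \<nu>) * pred_var (gauss_mix a \<nu>) n p w x)"
      by blast
  qed
qed

text \<open>The linear system for the weights, written in coordinates so that the analysis stays
  free of matrices.\<close>

definition normal_equations :: "('a::euclidean_space \<Rightarrow> real) \<Rightarrow> real \<Rightarrow> nat \<Rightarrow> (nat \<Rightarrow> 'a) \<Rightarrow> (nat \<Rightarrow> real) \<Rightarrow> 'a \<Rightarrow> bool" where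
  "normal_equations K \<mu> n p w x \<longleftrightarrow> (\<forall>k<n. (\<Sum>j<n. w j * K (p k - p j)) + \<mu> * w k = K (x - p k))"

text \<open>Multiplying equation k by w_k and summing shows that \<Sum> w_k K(x - p_k) is the
  quadratic form plus \<mu> |w|^2.\<close>

lemma normal_equations_pred_var:
  assumes ne: "normal_equations K \<mu> n p w x"
  shows "pred_var K n p w x + \<mu> * (\<Sum>k<n. (w k)\<^sup>2) = K 0 - (\<Sum>k<n. w k * K (x - p k))"
proof -
  have "(\<Sum>k<n. w k * K (x - p k)) = (\<Sum>k<n. w k * ((\<Sum>j<n. w j * K (p k - p j)) + \<mu> * w k))"
    using ne by (intro sum.cong) (auto simp: normal_equations_def)
  also have "\<dots> = quad_form K n p w + \<mu> * (\<Sum>k<n. (w k)\<^sup>2)"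
    by (simp add: quad_form_def distrib_left sum.distrib sum_distrib_left power2_eq_square mult_ac)
  finally show ?thesis by (simp add: pred_var_def)
qed

text \<open>The subtracted sum equals the quadratic form plus \<mu> |w|^2 and is therefore
  nonnegative. This a priori bound covers length scales beyond the reach of the cone
  condition.\<close>

lemma normal_equations_le_1:
  assumes "a > 0" "\<nu> > 0" "\<mu> \<ge> 0" and ne: "normal_equations (gauss_mix a \<nu>) \<mu> n p w x"
  shows "1 - (\<Sum>k<n. w k * gauss_mix a \<nu> (x - p k)) \<le> 1"
proof -
  let ?S = "\<Sum>k<n. w k * gauss_mix a \<nu> (x - p k)"
  have "pred_var (gauss_mix a \<nu>) n p w x + \<mu> * (\<Sum>k<n. (w k)\<^sup>2) = 1 - ?S"
    using normal_equations_pred_var[OF ne] assms by simp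
  moreover have "pred_var (gauss_mix a \<nu>) n p w x = 1 - 2 * ?S + quad_form (gauss_mix a \<nu>) n p w"
    using assms by (simp add: pred_var_def)
  ultimately have "?S = quad_form (gauss_mix a \<nu>) n p w + \<mu> * (\<Sum>k<n. (w k)\<^sup>2)" by simp
  moreover have "\<mu> * (\<Sum>k<n. (w k)\<^sup>2) \<ge> 0" using assms(3) by (simp add: sum_nonneg)
  ultimately show ?thesis using quad_form_nonneg[OF assms(1,2), of n p w] by linarith
qed

text \<open>A vector s \<xi> + e with |e| <= \<kappa> s has length at most (1 + \<kappa>) s and
  component at least (1 - \<kappa>) s along \<xi>, so it lies in the cone once (1 - \<kappa>)/(1 +
  \<kappa>) >= cos \<alpha>. Balls at every small scale are what the polynomial argument and the
  count of design points work with.\<close>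

lemma interior_cone_condition_balls:
  fixes \<Omega> :: "'a::euclidean_space set"
  assumes "interior_cone_condition \<Omega>"
  obtains \<kappa> R where "0 < \<kappa>" "\<kappa> \<le> 1" "0 < R"
    "\<And>x. x \<in> \<Omega> \<Longrightarrow> \<exists>\<xi>. norm \<xi> = 1 \<and> (\<forall>s. 0 < s \<and> s \<le> R \<longrightarrow> cball (x + s *\<^sub>R \<xi>) (\<kappa> * s) \<subseteq> \<Omega>)"
proof -
  obtain \<alpha> R where \<alpha>: "0 < \<alpha>" "\<alpha> < pi / 2" and R: "0 < R"
    and cone: "\<And>x. x \<in> \<Omega> \<Longrightarrow> \<exists>\<xi>. norm \<xi> = 1 \<and> {x + s *\<^sub>R y | s y. norm y = 1 \<and> y \<bullet> \<xi> \<ge> cos \<alpha> \<and> 0 \<le> s \<and> s \<le> R} \<subseteq> \<Omega>"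
    using assms unfolding interior_cone_condition_def by blast
  define c where "c = cos \<alpha>"
  have c: "0 < c" "c < 1"
    using \<alpha> cos_gt_zero[of \<alpha>] cos_monotone_0_pi[of 0 \<alpha>] by (auto simp: c_def)
  \<comment> \<open>Equality in the angle condition (1 - \<kappa>)/(1 + \<kappa>) >= cos
    \<alpha>.\<close>
  define \<kappa> where "\<kappa> = (1 - c) / (1 + c)"
  have \<kappa>: "0 < \<kappa>" "\<kappa> < 1" "1 - \<kappa> = c * (1 + \<kappa>)"
    using c by (auto simp: \<kappa>_def field_simps)
  show ?thesis
  \<comment> \<open>Half the cone height, since points of the ball are at distance up to (1 +
    \<kappa>) s <= 2 s from x.\<close>
  proof (rule that[of \<kappa> "R / 2"])
    fix x assume "x \<in> \<Omega>"
    then obtain \<xi> where \<xi>: "norm \<xi> = 1"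
      and sub: "{x + s *\<^sub>R y | s y. norm y = 1 \<and> y \<bullet> \<xi> \<ge> cos \<alpha> \<and> 0 \<le> s \<and> s \<le> R} \<subseteq> \<Omega>"
      using cone by blast
    have "cball (x + s *\<^sub>R \<xi>) (\<kappa> * s) \<subseteq> \<Omega>" if s: "0 < s" "s \<le> R / 2" for s
    proof
      fix v assume "v \<in> cball (x + s *\<^sub>R \<xi>) (\<kappa> * s)"
      define e where "e = v - (x + s *\<^sub>R \<xi>)"
      have e: "norm e \<le> \<kappa> * s"
        using \<open>v \<in> _\<close> by (simp add: e_def dist_norm norm_minus_commute)
      define u where "u = s *\<^sub>R \<xi> + e"
      have v: "v = x + u" by (simp add: u_def e_def)
      have up: "norm u \<le> (1 + \<kappa>) * s"
        unfolding u_def using norm_triangle_ineq[of "s *\<^sub>R \<xi>" e] e \<xi> s by (simp add: algebra_simps)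
      also have "\<dots> \<le> 2 * (R / 2)" using \<kappa> s by (intro mult_mono) auto
      finally have uR: "norm u \<le> R" by simp
      have "\<bar>e \<bullet> \<xi>\<bar> \<le> \<kappa> * s" using Cauchy_Schwarz_ineq2[of e \<xi>] e \<xi> by simp
      hence in_lo: "u \<bullet> \<xi> \<ge> (1 - \<kappa>) * s"
        using \<xi> by (simp add: u_def inner_add_left dot_square_norm algebra_simps)
      hence "u \<bullet> \<xi> > 0" using mult_pos_pos[of "1 - \<kappa>" s] \<kappa> s by linarith
      hence u0: "u \<noteq> 0" by auto
      have "cos \<alpha> * norm u \<le> cos \<alpha> * ((1 + \<kappa>) * s)"
        using up c by (intro mult_left_mono) (auto simp: c_def)
      also have "\<dots> = (1 - \<kappa>) * s" using \<kappa>(3) by (simp add: c_def)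
      finally have "cos \<alpha> * norm u \<le> u \<bullet> \<xi>" using in_lo by simp
      hence "cos \<alpha> \<le> (u \<bullet> \<xi>) / norm u" using u0 by (simp add: pos_le_divide_eq)
      hence "cos \<alpha> \<le> (u /\<^sub>R norm u) \<bullet> \<xi>" by (simp add: divide_inverse mult.commute)
      moreover have "v = x + norm u *\<^sub>R (u /\<^sub>R norm u)" using u0 by (simp add: v)
      moreover have "norm (u /\<^sub>R norm u) = 1" using u0 by simp
      ultimately show "v \<in> \<Omega>" using sub uR norm_ge_zero[of u] by blast
    qed
    thus "\<exists>\<xi>. norm \<xi> = 1 \<and> (\<forall>s. 0 < s \<and> s \<le> R / 2 \<longrightarrow> cball (x + s *\<^sub>R \<xi>) (\<kappa> * s) \<subseteq> \<Omega>)"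
      using \<xi> by blast
  qed (use \<kappa> R in auto)
qed

text \<open>The residual function f takes the values \<mu> w k at the design points, while f x bounds both its squared
  native norm and \<mu> |w|^2; a sampling inequality for f is therefore self-improving.\<close>
lemma normal_equations_local_bound:
  fixes \<Omega> :: "'a::euclidean_space set" and a \<nu> :: real
  assumes a: "a > 0" and \<nu>: "\<nu> > 0" and cone: "interior_cone_condition \<Omega>"
  obtains C \<eta> R where "C > 0" "\<eta> > 0" "R > 0"
    "\<And>(n::nat) p w \<mu> x H \<rho>. x \<in> \<Omega> \<Longrightarrow> 0 < H \<Longrightarrow> H \<le> R \<Longrightarrow> 0 < \<rho> \<Longrightarrow> \<rho> \<le> \<eta> * H \<Longrightarrow> 0 < \<mu> \<Longrightarrow>
       (\<And>y. y \<in> \<Omega> \<Longrightarrow> \<exists>k<n. dist y (p k) \<le> \<rho>) \<Longrightarrow> normal_equations (gauss_mix a \<nu>) \<mu> n p w x \<Longrightarrow>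
       1 - (\<Sum>k<n. w k * gauss_mix a \<nu> (x - p k)) \<le> C * (H powr (2 * \<nu>) + \<mu> * (\<rho> / H) ^ DIM('a))"
proof -
  obtain \<kappa> R where \<kappa>: "0 < \<kappa>" "\<kappa> \<le> 1" and R: "0 < R"
    and balls: "\<And>x. x \<in> \<Omega> \<Longrightarrow> \<exists>\<xi>. norm \<xi> = 1 \<and> (\<forall>s. 0 < s \<and> s \<le> R \<longrightarrow> cball (x + s *\<^sub>R \<xi>) (\<kappa> * s) \<subseteq> \<Omega>)"
    by (rule interior_cone_condition_balls[OF cone]) blast
  define l where "l = nat \<lceil>\<nu> + real DIM('a) / 2\<rceil>"
  have l: "real l \<ge> \<nu> + real DIM('a) / 2" unfolding l_def by (simp add: of_nat_ceiling)
  obtain B where B: "B > 0" and approx: "\<And>(n::nat) p w (x::'a) (H::real). H > 0 \<Longrightarrow>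
     \<exists>P A. line_poly l P \<and> (\<forall>y\<in>cball x (2 * H). \<bar>P y\<bar> \<le> A) \<and>
       (\<forall>y\<in>cball x (2 * H). (gauss_mix a \<nu> (x - y) - (\<Sum>k<n. w k * gauss_mix a \<nu> (p k - y)) - P y)\<^sup>2
           \<le> B * H powr (2 * \<nu>) * pred_var (gauss_mix a \<nu>) n p w x)"
    by (rule band_limited_approx[OF a \<nu> l]) blast
  obtain \<tau> \<Lambda> where \<tau>: "0 < \<tau>" "\<tau> < 1" and \<Lambda>: "\<Lambda> > 0"
    and norming: "\<And>(P :: 'a \<Rightarrow> real) z r x A. line_poly l P \<Longrightarrow> r > 0 \<Longrightarrow> (\<And>y. y \<in> cball z r \<Longrightarrow> \<bar>P y\<bar> \<le> A) \<Longrightarrow>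
       norm (z - x) = r / \<kappa> \<Longrightarrow>
       \<exists>y1 S. S \<ge> 0 \<and> cball y1 (\<tau> * r) \<subseteq> cball z r \<and> (\<forall>y\<in>cball y1 (\<tau> * r). S / 2 \<le> \<bar>P y\<bar>) \<and> \<bar>P x\<bar> \<le> \<Lambda> * S"
    by (rule line_poly_norming[OF \<kappa>(1), where 'a='a and l=l]) blast
  \<comment> \<open>One constant for each case below: either the polynomial is small compared with
    the approximation error \<open>e\<close>, or it is large and forces large values \<mu> w_k at
    many design points.\<close>
  define C1 where "C1 = (4 * \<Lambda> + 1)\<^sup>2 * B"
  define C2 where "C2 = 16 * (\<Lambda> + 1)\<^sup>2 * (2 / (\<tau> * \<kappa>)) ^ DIM('a)"
  have C12: "C1 > 0" "C2 > 0" using B \<Lambda> \<tau> \<kappa> by (auto simp: C1_def C2_def)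
  show ?thesis
  \<comment> \<open>\<eta> = \<tau> \<kappa> / 2 turns \<rho> <= \<eta> H into \<rho> <= \<tau> r /
    2, as the count of design points in the inner ball of radius \<tau> r requires.\<close>
  proof (rule that[of "C1 + C2" "\<tau> * \<kappa> / 2" R])
    fix n :: nat and p w \<mu> x H \<rho>
    assume x: "x \<in> \<Omega>" and H: "0 < H" "H \<le> R" and \<rho>: "0 < \<rho>" "\<rho> \<le> \<tau> * \<kappa> / 2 * H" and \<mu>: "0 < \<mu>"
      and fill: "\<And>y. y \<in> \<Omega> \<Longrightarrow> \<exists>k<n. dist y (p k) \<le> \<rho>" and ne: "normal_equations (gauss_mix a \<nu>) \<mu> n p w x"
    define J where "J = 1 - (\<Sum>k<n. w k * gauss_mix a \<nu> (x - p k))"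
    define f where "f y = gauss_mix a \<nu> (x - y) - (\<Sum>k<n. w k * gauss_mix a \<nu> (p k - y))" for y
    define Q where "Q = pred_var (gauss_mix a \<nu>) n p w x"
    have Q0: "Q \<ge> 0" unfolding Q_def by (rule pred_var_nonneg[OF a \<nu>])
    have JQ: "Q + \<mu> * (\<Sum>k<n. (w k)\<^sup>2) = J"
      unfolding Q_def J_def using normal_equations_pred_var[OF ne] \<nu> by simp
    have w0: "\<mu> * (\<Sum>k<n. (w k)\<^sup>2) \<ge> 0" using \<mu> by (simp add: sum_nonneg)
    have J0: "J \<ge> 0" "Q \<le> J" "\<mu> * (\<Sum>k<n. (w k)\<^sup>2) \<le> J" using JQ Q0 w0 by linarith+
    have sym: "gauss_mix a \<nu> (u - v) = gauss_mix a \<nu> (v - u)" for u v :: 'a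
      using gauss_mix_uminus[of a \<nu> "u - v"] by simp
    have fx: "f x = J" using \<nu> by (simp add: f_def J_def sym[of _ x])
    have fp: "f (p k) = \<mu> * w k" if "k < n" for k
    proof -
      have "(\<Sum>j<n. w j * gauss_mix a \<nu> (p j - p k)) = (\<Sum>j<n. w j * gauss_mix a \<nu> (p k - p j))"
        by (intro sum.cong refl arg_cong2[where f="(*)"] sym)
      thus ?thesis using ne that by (auto simp: f_def normal_equations_def)
    qed
    obtain \<xi> where \<xi>: "norm \<xi> = 1" "\<And>s. 0 < s \<Longrightarrow> s \<le> R \<Longrightarrow> cball (x + s *\<^sub>R \<xi>) (\<kappa> * s) \<subseteq> \<Omega>"
      using balls[OF x] by blast
    define z where "z = x + H *\<^sub>R \<xi>"
    define r where "r = \<kappa> * H"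
    have r: "r > 0" using \<kappa> H by (simp add: r_def)
    have zr\<Omega>: "cball z r \<subseteq> \<Omega>" unfolding z_def r_def using \<xi> H by blast
    have zx: "norm (z - x) = r / \<kappa>" using \<xi> H \<kappa> by (simp add: z_def r_def)
    have zr: "cball z r \<subseteq> cball x (2 * H)"
    proof
      fix y assume "y \<in> cball z r"
      moreover have "r \<le> H" using \<kappa> H by (simp add: r_def)
      moreover have "dist x z = H" using \<xi> H by (simp add: z_def dist_norm)
      ultimately show "y \<in> cball x (2 * H)" using dist_triangle[of x y z] by simp
    qed
    obtain P A where P: "line_poly l P" "\<And>y. y \<in> cball x (2 * H) \<Longrightarrow> \<bar>P y\<bar> \<le> A"
       "\<And>y. y \<in> cball x (2 * H) \<Longrightarrow> (f y - P y)\<^sup>2 \<le> B * H powr (2 * \<nu>) * Q"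
      using approx[OF H(1), where n=n and p=p and w=w and x=x] unfolding f_def Q_def by blast
    obtain y1 S where S: "S \<ge> 0" "cball y1 (\<tau> * r) \<subseteq> cball z r"
       "\<And>y. y \<in> cball y1 (\<tau> * r) \<Longrightarrow> S / 2 \<le> \<bar>P y\<bar>" "\<bar>P x\<bar> \<le> \<Lambda> * S"
      using norming[OF P(1) r _ zx, of A] P(2) zr by blast
    define e where "e = sqrt (B * H powr (2 * \<nu>) * J)"
    have e2: "e\<^sup>2 = B * H powr (2 * \<nu>) * J" unfolding e_def using B J0 by simp
    have e0: "e \<ge> 0" unfolding e_def using B J0 by simp
    have err: "\<bar>f y - P y\<bar> \<le> e" if "y \<in> cball x (2 * H)" for y
    proof -
      have "(f y - P y)\<^sup>2 \<le> B * H powr (2 * \<nu>) * J"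
        by (rule order.trans[OF P(3)[OF that]]) (use B J0 in \<open>auto intro!: mult_left_mono\<close>)
      thus ?thesis unfolding e_def by (intro real_le_rsqrt) simp
    qed
    have xin: "x \<in> cball x (2 * H)" using H by simp
    have "J \<le> C1 * H powr (2 * \<nu>) \<or> J \<le> C2 * (\<mu> * (\<rho> / H) ^ DIM('a))"
    proof (cases "J = 0")
      case True
      thus ?thesis using C12 by simp
    next
      case False
      hence J: "J > 0" using J0 by simp
      show ?thesis
      \<comment> \<open>The threshold leaves |f| >= S/2 - e >= S/4 on the inner ball in the second
        case.\<close>
      proof (cases "S \<le> 4 * e")
        case True
        have "J \<le> \<bar>P x\<bar> + e" using err[OF xin] fx by linarith
        also have "\<dots> \<le> \<Lambda> * (4 * e) + e" using S(4) mult_left_mono[OF True, of \<Lambda>] \<Lambda> by linarith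
        also have "\<dots> = (4 * \<Lambda> + 1) * e" by (simp add: algebra_simps)
        finally have "J\<^sup>2 \<le> ((4 * \<Lambda> + 1) * e)\<^sup>2" using J by (intro power_mono) auto
        hence "J * J \<le> (C1 * H powr (2 * \<nu>)) * J" unfolding power_mult_distrib e2 by (simp add: C1_def power2_eq_square mult_ac)
        thus ?thesis using J by simp
      next
        case Slarge: False
        define N where "N = {k. k < n \<and> p k \<in> cball y1 (\<tau> * r)}"
        define t where "t = (\<tau> * r / (2 * \<rho>)) ^ DIM('a)"
        have t0: "t > 0" using \<tau> r \<rho> by (simp add: t_def)
        have card: "t \<le> real (card N)"
          unfolding N_def t_def
        proof (rule card_cover_lower_bound)
          show "\<exists>k<n. dist y (p k) \<le> \<rho>" if "y \<in> cball y1 (\<tau> * r)" for y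
            by (rule fill) (use that S(2) zr\<Omega> in blast)
        qed (use \<rho> in \<open>simp_all add: r_def mult_ac\<close>)
        have "(S / 4)\<^sup>2 \<le> (\<mu> * w k)\<^sup>2" if "k \<in> N" for k
        proof -
          have k: "k < n" "p k \<in> cball y1 (\<tau> * r)" using that by (auto simp: N_def)
          hence "p k \<in> cball x (2 * H)" using S(2) zr by blast
          hence "S / 4 \<le> \<bar>f (p k)\<bar>" using err[of "p k"] S(3)[OF k(2)] Slarge by linarith
          thus ?thesis using S(1) fp[OF k(1)] by (metis divide_nonneg_pos power_mono power2_abs zero_less_numeral)
        qed
        hence "real (card N) * (S / 4)\<^sup>2 \<le> (\<Sum>k\<in>N. (\<mu> * w k)\<^sup>2)"
          by (rule sum_bounded_below[of N "(S / 4)\<^sup>2", simplified])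
        also have "\<dots> \<le> (\<Sum>k<n. (\<mu> * w k)\<^sup>2)" by (intro sum_mono2) (auto simp: N_def)
        also have "\<dots> = \<mu> * (\<mu> * (\<Sum>k<n. (w k)\<^sup>2))" by (simp add: power_mult_distrib sum_distrib_left power2_eq_square mult_ac)
        also have "\<dots> \<le> \<mu> * J" using \<mu> J0 by simp
        finally have "t * (S / 4)\<^sup>2 \<le> \<mu> * J" using mult_right_mono[OF card, of "(S / 4)\<^sup>2"] by simp
        hence S2: "S\<^sup>2 \<le> 16 * (\<mu> * J) / t" using t0 by (simp add: field_simps power2_eq_square)
        have "J \<le> \<bar>P x\<bar> + e" using err[OF xin] fx by linarith
        also have "\<dots> \<le> (\<Lambda> + 1) * S" using S(4) Slarge S(1) e0 by (simp add: algebra_simps)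
        finally have "J\<^sup>2 \<le> ((\<Lambda> + 1) * S)\<^sup>2" using J by (intro power_mono) auto
        also have "\<dots> \<le> (\<Lambda> + 1)\<^sup>2 * (16 * (\<mu> * J) / t)"
          unfolding power_mult_distrib by (intro mult_left_mono S2) auto
        finally have "J * J \<le> ((\<Lambda> + 1)\<^sup>2 * 16 * \<mu> / t) * J" by (simp add: power2_eq_square mult_ac)
        hence "J \<le> (\<Lambda> + 1)\<^sup>2 * 16 * \<mu> / t" using J by (simp only: mult_le_cancel_right_pos)
        also have "1 / t = (2 / (\<tau> * \<kappa>)) ^ DIM('a) * (\<rho> / H) ^ DIM('a)"
          unfolding t_def r_def power_mult_distrib[symmetric] power_one_over[symmetric] 
          by (rule arg_cong[where f="\<lambda>x. x ^ DIM('a)"]) (use \<tau> \<kappa> H \<rho> in \<open>simp add: field_simps\<close>)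
        hence "(\<Lambda> + 1)\<^sup>2 * 16 * \<mu> / t = C2 * (\<mu> * (\<rho> / H) ^ DIM('a))"
          by (simp add: C2_def divide_inverse mult_ac)
        finally show ?thesis by simp
      qed
    qed
    moreover have "C1 * H powr (2 * \<nu>) \<ge> 0" "C2 * (\<mu> * (\<rho> / H) ^ DIM('a)) \<ge> 0"
       "C1 * (\<mu> * (\<rho> / H) ^ DIM('a)) \<ge> 0" "C2 * H powr (2 * \<nu>) \<ge> 0"
      using C12 \<mu> \<rho> H by auto
    ultimately show "1 - (\<Sum>k<n. w k * gauss_mix a \<nu> (x - p k)) \<le> (C1 + C2) * (H powr (2 * \<nu>) + \<mu> * (\<rho> / H) ^ DIM('a))"
      unfolding J_def[symmetric] by (simp only: distrib_left distrib_right) linarith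
  qed (use C12 \<tau> \<kappa> R in auto)
qed

section \<open>Deterministic variance bounds\<close>

text \<open>Disjoint balls of radius q about the design points fit into the ball of radius 2r. This
  gives n q^d = O(1), an upper count opposite to the lower count obtained from the fill
  distance.\<close>

lemma packing_card_bound:
  fixes p :: "nat \<Rightarrow> 'a::euclidean_space"
  assumes sep: "\<And>j k. j < n \<Longrightarrow> k < n \<Longrightarrow> j \<noteq> k \<Longrightarrow> dist (p j) (p k) \<ge> 2 * q" and q: "0 < q" "q \<le> r"
    and inside: "\<And>k. k < n \<Longrightarrow> p k \<in> cball c r"
  shows "real n * q ^ DIM('a) \<le> (2 * r) ^ DIM('a)"
proof -
  define V where "V = unit_ball_vol (real DIM('a))"
  have V: "V > 0" by (simp add: V_def)
  let ?B = "\<lambda>k. ball (p k) q"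
  have fin: "emeasure lborel (?B k) \<noteq> \<infinity>" for k
    using emeasure_lborel_ball_finite[of "p k" q] by auto
  have disj: "disjoint_family_on ?B {..<n}"
    unfolding disjoint_family_on_def
  proof (intro ballI impI)
    fix j k assume "j \<in> {..<n}" "k \<in> {..<n}" "j \<noteq> k"
    hence "dist (p j) (p k) \<ge> 2 * q" by (intro sep) auto
    thus "?B j \<inter> ?B k = {}" by (intro disjoint_ballI) auto
  qed
  have "real n * (V * q ^ DIM('a)) = (\<Sum>k<n. measure lborel (?B k))"
    using q by (simp add: content_ball V_def)
  also have "\<dots> = measure lborel (\<Union>k<n. ?B k)"
    by (rule measure_finite_Union[symmetric]) (use disj fin in auto)
  also have "\<dots> \<le> measure lborel (cball c (2 * r))"
  proof (rule measure_mono_fmeasurable)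
    show "(\<Union>k<n. ?B k) \<subseteq> cball c (2 * r)"
    proof
      fix y assume "y \<in> (\<Union>k<n. ?B k)"
      then obtain k where k: "k < n" "dist (p k) y < q" by auto
      thus "y \<in> cball c (2 * r)" using inside[OF k(1)] dist_triangle[of c y "p k"] q by simp
    qed
  qed (use emeasure_lborel_cball_finite[of c "2 * r"] in \<open>auto intro!: fmeasurableI\<close>)
  also have "\<dots> = V * (2 * r) ^ DIM('a)" using q by (simp add: content_cball V_def)
  finally show ?thesis using V by simp
qed

text \<open>With \<open>n \<ge> 2\<close> and an injective design the set under \<open>Min\<close>
  is nonempty, finite and consists of positive numbers.\<close>

lemma separation_radius_bounds:
  fixes p :: "nat \<Rightarrow> 'a::euclidean_space"
  assumes inj: "inj_on p {..<n}" and n: "n \<ge> 2"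
  shows "separation_radius (p ` {..<n}) > 0"
    and "\<And>j k. j < n \<Longrightarrow> k < n \<Longrightarrow> j \<noteq> k \<Longrightarrow> dist (p j) (p k) \<ge> 2 * separation_radius (p ` {..<n})"
proof -
  let ?X = "p ` {..<n}"
  let ?S = "{dist a b / 2 | a b. a \<in> ?X \<and> b \<in> ?X \<and> a \<noteq> b}"
  have "?S \<subseteq> (\<lambda>(a, b). dist a b / 2) ` (?X \<times> ?X)" by fast
  hence fin: "finite ?S" by (rule finite_subset) auto
  have "p 0 \<noteq> p 1" using inj n by (auto dest: inj_onD)
  moreover have "p 0 \<in> ?X" "p 1 \<in> ?X" using n by auto
  ultimately have ne: "?S \<noteq> {}" by blast
  have "v > 0" if "v \<in> ?S" for v
    using that by clarify simp
  from this[OF Min_in[OF fin ne]] show "separation_radius ?X > 0"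
    unfolding separation_radius_def .
  show "dist (p j) (p k) \<ge> 2 * separation_radius ?X" if "j < n" "k < n" "j \<noteq> k" for j k
  proof -
    have "p j \<noteq> p k" using inj that by (auto dest: inj_onD)
    hence "dist (p j) (p k) / 2 \<in> ?S" using that by blast
    from Min_le[OF fin this] show ?thesis unfolding separation_radius_def by linarith
  qed
qed

text \<open>Boundedness keeps the supremum in \<open>fill_distance\<close> meaningful, and a finite
  set attains its distance to a point, so the fill distance itself serves as covering
  radius.\<close>

lemma fill_distance_cover:
  fixes \<Omega> :: "'a::euclidean_space set"
  assumes "bounded \<Omega>" "finite X" "X \<noteq> {}" "X \<subseteq> \<Omega>" "y \<in> \<Omega>"
  shows "\<exists>x\<in>X. dist y x \<le> fill_distance X \<Omega>"
proof -
  obtain x0 where x0: "x0 \<in> X" using assms by auto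
  have bdd: "bdd_above ((\<lambda>x. infdist x X) ` \<Omega>)"
  proof (rule bdd_aboveI2)
    fix x assume "x \<in> \<Omega>"
    thus "infdist x X \<le> diameter \<Omega>"
      using infdist_le[OF x0, of x] diameter_bounded_bound[OF assms(1), of x x0] x0 assms(4) by auto
  qed
  obtain x where "x \<in> X" "infdist y X = dist y x"
    using infdist_attains_inf[of X y] assms finite_imp_closed by auto
  moreover have "infdist y X \<le> fill_distance X \<Omega>"
    unfolding fill_distance_def by (rule cSUP_upper[OF assms(5) bdd])
  ultimately show ?thesis by auto
qed

text \<open>The local bound at H = K h with h = (\<mu>/n)^(1/2m), where both of its terms are
  multiples of h^(2\<nu>). The factor K secures \<rho> <= \<eta> H, and for K h > R the a priori
  bound 1 is itself at most a multiple of h^(2\<nu>).\<close>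

lemma kriging_residual_bound:
  fixes \<Omega> :: "'a::euclidean_space set" and p :: "nat \<Rightarrow> nat \<Rightarrow> 'a" and a \<nu> :: real and \<mu> :: "nat \<Rightarrow> real"
  defines "d \<equiv> real DIM('a)"
  defines "m \<equiv> \<nu> + d / 2"
  assumes a: "a > 0" and \<nu>: "\<nu> > 0" and cone: "interior_cone_condition \<Omega>"
    and fill: "Cf > 0" "\<And>n y. n \<ge> 1 \<Longrightarrow> y \<in> \<Omega> \<Longrightarrow> \<exists>k<n. dist y (p n k) \<le> Cf * real n powr (- 1 / d)"
    and \<mu>: "c > 0" "\<And>n. n \<ge> 1 \<Longrightarrow> \<mu> n \<ge> c * real n powr (1 - 2 * m / d)"
  obtains C where "C > 0" "\<And>n x w. n \<ge> 1 \<Longrightarrow> x \<in> \<Omega> \<Longrightarrow> normal_equations (gauss_mix a \<nu>) (\<mu> n) n (p n) w x \<Longrightarrow>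
    1 - (\<Sum>k<n. w k * gauss_mix a \<nu> (x - p n k)) \<le> C * (\<mu> n / real n) powr (\<nu> / m)"
proof -
  have d: "d > 0" by (simp add: d_def)
  have m: "m > 0" using \<nu> d by (simp add: m_def)
  obtain C \<eta> R where C: "C > 0" and \<eta>: "\<eta> > 0" and R: "R > 0" and
    bound: "\<And>(n::nat) p w \<mu> x H \<rho>. x \<in> \<Omega> \<Longrightarrow> 0 < H \<Longrightarrow> H \<le> R \<Longrightarrow> 0 < \<rho> \<Longrightarrow> \<rho> \<le> \<eta> * H \<Longrightarrow> 0 < \<mu> \<Longrightarrow>
       (\<And>y. y \<in> \<Omega> \<Longrightarrow> \<exists>k<n. dist y (p k) \<le> \<rho>) \<Longrightarrow> normal_equations (gauss_mix a \<nu>) \<mu> n p w x \<Longrightarrow>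
       1 - (\<Sum>k<n. w k * gauss_mix a \<nu> (x - p k)) \<le> C * (H powr (2 * \<nu>) + \<mu> * (\<rho> / H) ^ DIM('a))"
    by (rule normal_equations_local_bound[OF a \<nu> cone]) blast
  \<comment> \<open>Makes \<rho> <= \<eta> K h follow from h >= c^(1/2m) n^(-1/d).\<close>
  define K where "K = Cf / (\<eta> * c powr (1 / (2 * m)))"
  have K: "K > 0" using fill(1) \<eta> \<mu>(1) by (simp add: K_def)
  define C1 where "C1 = C * (K powr (2 * \<nu>) + (Cf / K) ^ DIM('a)) + (K / R) powr (2 * \<nu>)"
  have C1: "C1 > 0" unfolding C1_def using C K R fill(1) by (intro add_pos_pos mult_pos_pos) auto
  show ?thesis
  proof (rule that[OF C1])
    fix n :: nat and x w
    assume n: "n \<ge> 1" and x: "x \<in> \<Omega>" and ne: "normal_equations (gauss_mix a \<nu>) (\<mu> n) n (p n) w x"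
    define N where "N = real n"
    have N: "N > 0" using n by (simp add: N_def)
    have \<mu>0: "\<mu> n > 0" using \<mu>(2)[OF n] mult_pos_pos[OF \<mu>(1), of "real n powr (1 - 2 * m / d)"] n by simp
    define h where "h = (\<mu> n / N) powr (1 / (2 * m))"
    have h: "h > 0" using \<mu>0 N by (simp add: h_def)
    have h2\<nu>: "h powr (2 * \<nu>) = (\<mu> n / N) powr (\<nu> / m)" by (simp add: h_def powr_powr)
    define \<rho> where "\<rho> = Cf * N powr (- 1 / d)"
    have \<rho>: "\<rho> > 0" using fill(1) N by (simp add: \<rho>_def)
    have J1: "1 - (\<Sum>k<n. w k * gauss_mix a \<nu> (x - p n k)) \<le> 1"
      by (rule normal_equations_le_1[OF a \<nu> _ ne]) (use \<mu>0 in simp)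
    have h\<rho>: "\<rho> \<le> \<eta> * (K * h)"
    proof -
      have "c * N powr (- 2 * m / d) \<le> \<mu> n / N"
      proof -
        have "N powr (1 - 2 * m / d) = N * N powr (- 2 * m / d)" using N by (simp add: powr_diff powr_minus divide_inverse)
        thus ?thesis using \<mu>(2)[OF n] N by (simp add: N_def[symmetric] pos_le_divide_eq mult_ac)
      qed
      hence "(c * N powr (- 2 * m / d)) powr (1 / (2 * m)) \<le> h"
        unfolding h_def using \<mu>(1) m by (intro powr_mono2) auto
      also have "(c * N powr (- 2 * m / d)) powr (1 / (2 * m)) = c powr (1 / (2 * m)) * N powr (- 1 / d)"
        using m by (simp add: powr_mult powr_powr)
      finally have "\<eta> * (K * (c powr (1 / (2 * m)) * N powr (- 1 / d))) \<le> \<eta> * (K * h)"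
        using \<eta> K by (intro mult_left_mono) auto
      also have "\<eta> * (K * (c powr (1 / (2 * m)) * N powr (- 1 / d))) = \<rho>"
        using \<eta> \<mu>(1) by (simp add: K_def \<rho>_def)
      finally show ?thesis .
    qed
    have h2m: "h powr (2 * m) = \<mu> n / N" using m \<mu>0 N by (simp add: h_def powr_powr)
    show "1 - (\<Sum>k<n. w k * gauss_mix a \<nu> (x - p n k)) \<le> C1 * (\<mu> n / real n) powr (\<nu> / m)"
      unfolding N_def[symmetric] h2\<nu>[symmetric]
    proof (cases "K * h \<le> R")
      case True
      have "1 - (\<Sum>k<n. w k * gauss_mix a \<nu> (x - p n k)) \<le> C * ((K * h) powr (2 * \<nu>) + \<mu> n * (\<rho> / (K * h)) ^ DIM('a))"
        by (rule bound[OF x _ True \<rho> h\<rho> \<mu>0 _ ne]) (use K h fill(2)[OF n] in \<open>auto simp: \<rho>_def N_def\<close>)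
      also have "\<mu> n * (\<rho> / (K * h)) ^ DIM('a) = (Cf / K) ^ DIM('a) * h powr (2 * \<nu>)"
      proof -
        have "(N powr (- 1 / d)) ^ DIM('a) = 1 / N"
        proof -
          have "(N powr (- 1 / d)) ^ DIM('a) = (N powr (- 1 / d)) powr d" using N by (simp add: d_def powr_realpow)
          also have "\<dots> = N powr (- 1)" using d by (simp only: powr_powr) simp
          finally show ?thesis using N by (simp add: powr_minus_divide)
        qed
        moreover have "h ^ DIM('a) = h powr d" using h by (simp add: d_def powr_realpow)
        ultimately have "\<mu> n * (\<rho> / (K * h)) ^ DIM('a) = (Cf / K) ^ DIM('a) * ((\<mu> n / N) / h powr d)"
          by (simp add: \<rho>_def power_divide power_mult_distrib mult_ac)
        also have "(\<mu> n / N) / h powr d = h powr (2 * \<nu>)"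
          unfolding h2m[symmetric] powr_diff[symmetric] by (simp add: m_def)
        finally show ?thesis .
      qed
      also have "C * ((K * h) powr (2 * \<nu>) + (Cf / K) ^ DIM('a) * h powr (2 * \<nu>)) = C * (K powr (2 * \<nu>) + (Cf / K) ^ DIM('a)) * h powr (2 * \<nu>)"
        by (simp add: powr_mult distrib_right distrib_left)
      also have "\<dots> \<le> C1 * h powr (2 * \<nu>)" unfolding C1_def by (intro mult_right_mono) auto
      finally show "1 - (\<Sum>k<n. w k * gauss_mix a \<nu> (x - p n k)) \<le> C1 * h powr (2 * \<nu>)" .
    next
      case False
      have "1 \<le> (K * h / R) powr (2 * \<nu>)" using False R \<nu> by (intro ge_one_powr_ge_zero) auto
      also have "\<dots> = (K / R) powr (2 * \<nu>) * h powr (2 * \<nu>)" by (simp add: powr_mult powr_divide)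
      also have "\<dots> \<le> C1 * h powr (2 * \<nu>)" unfolding C1_def using C K fill(1) by (intro mult_right_mono) auto
      finally show "1 - (\<Sum>k<n. w k * gauss_mix a \<nu> (x - p n k)) \<le> C1 * h powr (2 * \<nu>)" using J1 by linarith
    qed
  qed
qed

text \<open>Put \<theta> = (\<mu> q^d)^(1/2m) and \<delta> = min(1, \<theta>). For \<theta> <= 1,
  P(x) <= J contributes \<open>T1\<close>, the constant 2 of \<open>pred_var_le_quad_form\<close>
  contributes \<open>T2\<close>, and the quadratic form of the weights is of order \<open>T1\<close>
  again. For \<theta> > 1 everything is bounded by a constant. The second claim is |w|^2 <=
  J/\<mu>.\<close>

lemma misspecified_variance_bound:
  fixes \<Omega> :: "'a::euclidean_space set" and p :: "nat \<Rightarrow> nat \<Rightarrow> 'a" and a0 a \<nu>0 \<nu> :: real and \<mu> :: "nat \<Rightarrow> real"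
  defines "d \<equiv> real DIM('a)"
  defines "m0 \<equiv> \<nu>0 + d / 2" and "m \<equiv> \<nu> + d / 2"
  assumes a0: "a0 > 0" and a: "a > 0" and \<nu>0: "\<nu>0 > 0" "\<nu>0 \<le> \<nu>" and cone: "interior_cone_condition \<Omega>" and \<Omega>: "bounded \<Omega>"
    and fill: "Cf > 0" "\<And>n y. n \<ge> 1 \<Longrightarrow> y \<in> \<Omega> \<Longrightarrow> \<exists>k<n. dist y (p n k) \<le> Cf * real n powr (- 1 / d)"
    and \<mu>: "c > 0" "\<And>n. n \<ge> 1 \<Longrightarrow> \<mu> n \<ge> c * real n powr (1 - 2 * m / d)"
    and design: "\<And>n k. k < n \<Longrightarrow> p n k \<in> \<Omega>" "\<And>n. inj_on (p n) {..<n}"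
  obtains C where "C > 0" "\<And>n x w q. n \<ge> 2 \<Longrightarrow> x \<in> \<Omega> \<Longrightarrow> q = separation_radius (p n ` {..<n}) \<Longrightarrow> normal_equations (gauss_mix a \<nu>) (\<mu> n) n (p n) w x \<Longrightarrow>
    pred_var (gauss_mix a0 \<nu>0) n (p n) w x \<le> C * (\<mu> n powr (- (m - m0) / m) * q powr (- (m - m0) * d / m)
                * (\<mu> n / real n) powr (1 - d / (2 * m))
              + \<mu> n powr ((2 * m0 - d) / (2 * m)) * q powr ((2 * m0 - d) * d / (2 * m))) \<and>
    (\<Sum>k<n. (w k)\<^sup>2) \<le> C * (\<mu> n powr (- d / (2 * m)) * real n powr (- (1 - d / (2 * m))))"
proof -
  have d: "d > 0" by (simp add: d_def)
  have \<nu>: "\<nu> > 0" using \<nu>0 by simp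
  have m: "m > 0" using \<nu> d by (simp add: m_def)
  obtain C1 where C1: "C1 > 0" "\<And>n x w. n \<ge> 1 \<Longrightarrow> x \<in> \<Omega> \<Longrightarrow> normal_equations (gauss_mix a \<nu>) (\<mu> n) n (p n) w x \<Longrightarrow>
    1 - (\<Sum>k<n. w k * gauss_mix a \<nu> (x - p n k)) \<le> C1 * (\<mu> n / real n) powr (\<nu> / m)"
    using kriging_residual_bound[OF a \<nu> cone fill[unfolded d_def] \<mu>[unfolded m_def d_def]] unfolding m_def d_def by blast
  obtain C2 where C2: "C2 > 0" "\<And>(\<delta>::real) n p w (x::'a). 0 < \<delta> \<Longrightarrow> \<delta> \<le> 1 \<Longrightarrow> pred_var (gauss_mix a0 \<nu>0) n p w x \<le>
    C2 * (\<delta> powr (- 2 * (\<nu> - \<nu>0)) * pred_var (gauss_mix a \<nu>) n p w x + \<delta> powr (2 * \<nu>0) * pred_var (gauss_mix (1 / \<delta>) \<nu>0) n p w x)"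
    by (rule pred_var_compare[OF a0 a \<nu>0]) blast
  define C3 where "C3 = exp 1 * (8 * pi) powr (real DIM('a) / 2) / unit_ball_vol (real DIM('a))"
  have C3: "C3 > 0" by (simp add: C3_def)
  define G where "G = Gamma (\<nu>0 + real DIM('a) / 2) / Gamma \<nu>0"
  have G: "G > 0" using \<nu>0 by (auto simp: G_def intro!: divide_pos_pos Gamma_real_pos add_pos_nonneg)
  obtain r0 z0 where r0: "\<Omega> \<subseteq> cball z0 r0" using \<Omega> bounded_subset_cball by blast
  define r where "r = max r0 1"
  have r: "\<Omega> \<subseteq> cball z0 r" "r > 0" using r0 by (auto simp: r_def)
  \<comment> \<open>The bound for n q^d supplied by the volume comparison.\<close>
  define Cq where "Cq = (2 * r) powr d"
  have Cq: "Cq > 0" using r by (simp add: Cq_def)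
  \<comment> \<open>From \<mu> >= c n^(1-2m/d) and n <= Cq q^(-d): the exponent is negative, so
    \<mu> q^d is at least a constant times q^(2m), which means c' q <= \<theta>.\<close>
  define c' where "c' = (c * Cq powr (1 - 2 * m / d)) powr (1 / (2 * m))"
  have c': "c' > 0" using \<mu>(1) Cq by (simp add: c'_def)
  define E1 where "E1 = C1 + 2 + 2 * C3 * ((1 / c') powr d + G) * C1"
  define E2 where "E2 = 3 + 2 * C3 * (r powr d + G)"
  have E: "E1 > 0" "E2 > 0" unfolding E1_def E2_def using C1 C3 G c' r by (auto intro!: add_pos_pos add_pos_nonneg)
  define C where "C = C2 * (E1 + E2) + C1"
  have C: "C > 0" "C1 \<le> C" "C2 * (E1 + E2) \<le> C" unfolding C_def using C1 C2 E by (auto intro!: add_pos_pos)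
  show ?thesis
  proof (rule that[OF C(1)])
    fix n :: nat and x w q
    assume n: "n \<ge> 2" and x: "x \<in> \<Omega>" and q_def: "q = separation_radius (p n ` {..<n})" and ne: "normal_equations (gauss_mix a \<nu>) (\<mu> n) n (p n) w x"
    define N where "N = real n"
    have N: "N > 0" using n by (simp add: N_def)
    have n1: "n \<ge> 1" using n by simp
    have \<mu>0: "\<mu> n > 0" using \<mu>(2)[OF n1] mult_pos_pos[OF \<mu>(1), of "real n powr (1 - 2 * m / d)"] n by simp
    have q: "q > 0" and sep: "\<And>j k. j < n \<Longrightarrow> k < n \<Longrightarrow> j \<noteq> k \<Longrightarrow> dist (p n j) (p n k) \<ge> 2 * q"
      unfolding q_def using separation_radius_bounds[OF design(2) n] by auto
    have qr: "q \<le> r"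
    proof -
      have "p n 0 \<in> cball z0 r" "p n 1 \<in> cball z0 r" using subsetD[OF r(1) design(1)[of 0 n]] subsetD[OF r(1) design(1)[of 1 n]] n by auto
      hence "dist (p n 0) (p n 1) \<le> 2 * r" using dist_triangle2[of "p n 0" "p n 1" z0] by (simp add: dist_commute)
      thus ?thesis using sep[of 0 1] n by simp
    qed
    have "real n * q ^ DIM('a) \<le> (2 * r) ^ DIM('a)"
    proof (rule packing_card_bound[OF _ q qr])
      show "p n k \<in> cball z0 r" if "k < n" for k by (rule subsetD[OF r(1) design(1)[OF that]])
    qed (rule sep)
    hence Nq: "N * q powr d \<le> Cq" using q r by (simp add: N_def Cq_def d_def powr_realpow)
    define h where "h = (\<mu> n / N) powr (1 / (2 * m))"
    define \<theta> where "\<theta> = (\<mu> n * q powr d) powr (1 / (2 * m))"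
    have h: "h > 0" and \<theta>: "\<theta> > 0" using \<mu>0 N q by (auto simp: h_def \<theta>_def)
    have h2\<nu>: "h powr (2 * \<nu>) = (\<mu> n / N) powr (\<nu> / m)" by (simp add: h_def powr_powr)
    \<comment> \<open>The identities between powers below are checked through logarithms, where they
      become linear.\<close>
    have eqI: "u = v" if "u > 0" "v > 0" "ln u = ln v" for u v :: real using that by simp
    have lns: "ln \<theta> = (ln (\<mu> n) + d * ln q) / (2 * m)" "ln h = (ln (\<mu> n) - ln N) / (2 * m)"
      using \<mu>0 q N by (simp_all add: \<theta>_def h_def ln_powr ln_mult ln_div)
    define T1 where "T1 = \<theta> powr (- 2 * (\<nu> - \<nu>0)) * h powr (2 * \<nu>)"
    define T2 where "T2 = \<theta> powr (2 * \<nu>0)"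
    have T: "T1 > 0" "T2 > 0" using \<theta> h by (auto simp: T1_def T2_def)
    have I1: "\<mu> n powr (- (m - m0) / m) * q powr (- (m - m0) * d / m) * (\<mu> n / N) powr (1 - d / (2 * m)) = T1"
    proof (rule eqI)
      have 1: "(1 - d / (2 * m)) = 2 * \<nu> / (2 * m)" using m by (simp add: m_def field_simps)
      have 2: "m - m0 = \<nu> - \<nu>0" by (simp add: m_def m0_def)
      show "ln (\<mu> n powr (- (m - m0) / m) * q powr (- (m - m0) * d / m) * (\<mu> n / N) powr (1 - d / (2 * m))) = ln T1"
        unfolding 1 2 T1_def using \<mu>0 q N \<theta> h m
        by (simp add: ln_mult ln_powr ln_div lns) (simp add: field_simps)
    qed (use \<mu>0 q N \<theta> h in \<open>auto simp: T1_def\<close>)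
    have I2: "\<mu> n powr ((2 * m0 - d) / (2 * m)) * q powr ((2 * m0 - d) * d / (2 * m)) = T2"
    proof (rule eqI)
      have 1: "2 * m0 - d = 2 * \<nu>0" by (simp add: m0_def)
      show "ln (\<mu> n powr ((2 * m0 - d) / (2 * m)) * q powr ((2 * m0 - d) * d / (2 * m))) = ln T2"
        unfolding 1 T2_def using \<mu>0 q N \<theta> h m
        by (simp add: ln_mult ln_powr ln_div lns) (simp add: field_simps)
    qed (use \<mu>0 q N \<theta> h in \<open>auto simp: T2_def\<close>)
    have I3: "h powr (2 * \<nu>) / \<mu> n = \<mu> n powr (- d / (2 * m)) * N powr (- (1 - d / (2 * m)))"
    proof (rule eqI)
      have 1: "2 * \<nu> = 2 * m - d" by (simp add: m_def)
      show "ln (h powr (2 * \<nu>) / \<mu> n) = ln (\<mu> n powr (- d / (2 * m)) * N powr (- (1 - d / (2 * m))))"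
        unfolding 1 using \<mu>0 q N \<theta> h m
        by (simp add: ln_mult ln_powr ln_div lns) (simp add: field_simps)
    qed (use \<mu>0 q N \<theta> h in auto)
    have I4: "\<mu> n * q powr d = \<theta> powr (2 * m)" using m \<mu>0 q by (simp add: \<theta>_def powr_powr)
    \<comment> \<open>This identity singles out \<theta>: at \<delta> = \<theta> the energy of the
      weights has the size of the first term.\<close>
    have I5: "\<theta> powr (2 * \<nu>0) * ((\<theta> / q) powr d * (h powr (2 * \<nu>) / \<mu> n)) = T1"
    proof (rule eqI)
      have 1: "ln (\<mu> n) = 2 * m * ln \<theta> - d * ln q" using m by (simp add: lns)
      show "ln (\<theta> powr (2 * \<nu>0) * ((\<theta> / q) powr d * (h powr (2 * \<nu>) / \<mu> n))) = ln T1"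
        unfolding T1_def using \<mu>0 q N \<theta> h m
        by (simp add: ln_mult ln_powr ln_div 1) (simp add: m_def algebra_simps)
    qed (use \<mu>0 q N \<theta> h in \<open>auto simp: T1_def\<close>)
    have \<theta>q: "c' * q \<le> \<theta>"
    proof -
      have "Cq powr (1 - 2 * m / d) * (1 / q powr d) powr (1 - 2 * m / d) \<le> N powr (1 - 2 * m / d)"
        unfolding powr_mult[symmetric]
      proof (rule powr_mono2')
        show "1 - 2 * m / d \<le> 0" using d \<nu> by (simp add: m_def field_simps)
        show "N \<le> Cq * (1 / q powr d)" using Nq q by (simp add: pos_le_divide_eq)
      qed (use N in auto)
      hence "c * (Cq powr (1 - 2 * m / d) * (1 / q powr d) powr (1 - 2 * m / d)) \<le> c * N powr (1 - 2 * m / d)"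
        using \<mu>(1) by (intro mult_left_mono) auto
      also have "\<dots> \<le> \<mu> n" using \<mu>(2)[OF n1] by (simp add: N_def)
      finally have cq: "c * (Cq powr (1 - 2 * m / d) * (1 / q powr d) powr (1 - 2 * m / d)) \<le> \<mu> n" .
      have "(c * (Cq powr (1 - 2 * m / d) * (1 / q powr d) powr (1 - 2 * m / d)) * q powr d) powr (1 / (2 * m)) \<le> \<theta>"
        unfolding \<theta>_def using \<mu>(1) m q cq by (intro powr_mono2 mult_right_mono) auto
      moreover have "(c * (Cq powr (1 - 2 * m / d) * (1 / q powr d) powr (1 - 2 * m / d)) * q powr d) powr (1 / (2 * m)) = c' * q"
      proof (rule eqI)
        show "ln ((c * (Cq powr (1 - 2 * m / d) * (1 / q powr d) powr (1 - 2 * m / d)) * q powr d) powr (1 / (2 * m))) = ln (c' * q)"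
          using q c' Cq \<mu>(1) m d by (simp add: c'_def ln_mult ln_powr ln_div) (simp add: field_simps)
      qed (use \<mu>(1) Cq q c' in auto)
      ultimately show ?thesis by simp
    qed
    define W where "W = (\<Sum>k<n. (w k)\<^sup>2)"
    define Q where "Q = pred_var (gauss_mix a \<nu>) n (p n) w x"
    define J where "J = 1 - (\<Sum>k<n. w k * gauss_mix a \<nu> (x - p n k))"
    have Q0: "Q \<ge> 0" unfolding Q_def by (rule pred_var_nonneg[OF a \<nu>])
    have W0: "W \<ge> 0" by (simp add: W_def sum_nonneg)
    have QW: "Q + \<mu> n * W = J"
      using normal_equations_pred_var[OF ne] \<nu> by (simp add: Q_def W_def J_def)
    have J1: "J \<le> 1" unfolding J_def by (rule normal_equations_le_1[OF a \<nu> _ ne]) (use \<mu>0 in simp)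
    have Jh: "J \<le> C1 * h powr (2 * \<nu>)"
      unfolding J_def h2\<nu> N_def by (rule C1(2)[OF n1 x ne])
    have QJ: "Q \<le> J" using QW mult_nonneg_nonneg[OF less_imp_le[OF \<mu>0] W0] by linarith
    have WJ: "W \<le> J / \<mu> n" using QW Q0 \<mu>0 by (simp add: pos_le_divide_eq mult.commute)
    have Wh: "W \<le> C1 * (h powr (2 * \<nu>) / \<mu> n)"
      using WJ divide_right_mono[OF Jh, of "\<mu> n"] \<mu>0 by simp
    have main: "pred_var (gauss_mix a0 \<nu>0) n (p n) w x \<le>
        C2 * (\<delta> powr (- 2 * (\<nu> - \<nu>0)) * Q + \<delta> powr (2 * \<nu>0) * (2 + 2 * (C3 * (1 + G * (\<delta> / q) powr d) * W)))"
      if \<delta>: "0 < \<delta>" "\<delta> \<le> 1" for \<delta>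
    proof -
      have "quad_form (gauss_mix (1 / \<delta>) \<nu>0) n (p n) w \<le> C3 * (1 + G * (\<delta> / q) ^ DIM('a)) * W"
        unfolding C3_def G_def W_def by (rule quad_form_gauss_mix_le[OF sep q \<delta>(1) \<nu>0(1)])
      also have "(\<delta> / q) ^ DIM('a) = (\<delta> / q) powr d" using \<delta> q by (simp add: d_def powr_realpow)
      finally have "pred_var (gauss_mix (1 / \<delta>) \<nu>0) n (p n) w x \<le> 2 + 2 * (C3 * (1 + G * (\<delta> / q) powr d) * W)"
        using pred_var_le_quad_form[of "1 / \<delta>" \<nu>0 n "p n" w x] \<delta> \<nu>0 by simp
      hence "C2 * (\<delta> powr (- 2 * (\<nu> - \<nu>0)) * Q + \<delta> powr (2 * \<nu>0) * pred_var (gauss_mix (1 / \<delta>) \<nu>0) n (p n) w x)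
        \<le> C2 * (\<delta> powr (- 2 * (\<nu> - \<nu>0)) * Q + \<delta> powr (2 * \<nu>0) * (2 + 2 * (C3 * (1 + G * (\<delta> / q) powr d) * W)))"
        using C2(1) by (intro mult_left_mono add_left_mono) auto
      with C2(2)[OF \<delta>, of n "p n" w x] show ?thesis unfolding Q_def by linarith
    qed
    have "pred_var (gauss_mix a0 \<nu>0) n (p n) w x \<le> C2 * ((E1 + E2) * (T1 + T2))"
    proof (cases "\<theta> \<le> 1")
      case True
      have A: "\<theta> powr (- 2 * (\<nu> - \<nu>0)) * Q \<le> C1 * T1"
        using mult_left_mono[OF order.trans[OF QJ Jh], of "\<theta> powr (- 2 * (\<nu> - \<nu>0))"] by (simp add: T1_def mult_ac)
      \<comment> \<open>\<open>c' * q \<le> \<theta>\<close> allows the summand 1 to be absorbed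
        into (\<theta>/q)^d.\<close>
      have "1 + G * (\<theta> / q) powr d \<le> ((1 / c') powr d + G) * (\<theta> / q) powr d"
      proof -
        have "1 \<le> (\<theta> / (c' * q)) powr d" using \<theta>q c' q d by (intro ge_one_powr_ge_zero) auto
        also have "\<dots> = (1 / c') powr d * (\<theta> / q) powr d" unfolding powr_mult[symmetric] by (simp add: mult.commute)
        finally show ?thesis by (simp add: distrib_right)
      qed
      hence "\<theta> powr (2 * \<nu>0) * (2 * (C3 * (1 + G * (\<theta> / q) powr d) * W)) \<le>
         \<theta> powr (2 * \<nu>0) * (2 * (C3 * (((1 / c') powr d + G) * (\<theta> / q) powr d) * (C1 * (h powr (2 * \<nu>) / \<mu> n))))"
        using C3 G W0 by (intro mult_left_mono mult_mono Wh) (auto intro!: add_nonneg_nonneg)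
      also have "\<dots> = 2 * C3 * ((1 / c') powr d + G) * C1 * (\<theta> powr (2 * \<nu>0) * ((\<theta> / q) powr d * (h powr (2 * \<nu>) / \<mu> n)))"
        by (simp only: mult_ac)
      finally have B: "\<theta> powr (2 * \<nu>0) * (2 * (C3 * (1 + G * (\<theta> / q) powr d) * W)) \<le> 2 * C3 * ((1 / c') powr d + G) * C1 * T1"
        unfolding I5 .
      have "\<theta> powr (- 2 * (\<nu> - \<nu>0)) * Q + \<theta> powr (2 * \<nu>0) * (2 + 2 * (C3 * (1 + G * (\<theta> / q) powr d) * W)) \<le>
         C1 * T1 + (2 * T2 + 2 * C3 * ((1 / c') powr d + G) * C1 * T1)"
        using A B by (simp add: distrib_left T2_def)
      also have "\<dots> \<le> E1 * T1 + E1 * T2"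
      proof -
        have "E1 * T1 = C1 * T1 + 2 * T1 + 2 * C3 * ((1 / c') powr d + G) * C1 * T1" by (simp only: E1_def distrib_right)
        moreover have "2 * T2 \<le> E1 * T2" unfolding E1_def using C1 C3 G T by (intro mult_right_mono) auto
        ultimately show ?thesis using T by linarith
      qed
      also have "\<dots> \<le> (E1 + E2) * (T1 + T2)" using E T by (simp add: algebra_simps)
      finally show ?thesis using C2(1) by (intro order.trans[OF main[OF \<theta> True]] mult_left_mono) auto
    next
      case False
      \<comment> \<open>Here \<delta> = 1 and the target is at least a constant, so constants
        suffice: J <= 1, and |w|^2 q^(-d) <= 1/(\<mu> q^d) = \<theta>^(-2m) <= 1.\<close>
      have T21: "T2 \<ge> 1" unfolding T2_def using False \<nu>0 by (intro ge_one_powr_ge_zero) auto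
      have "1 + G * (1 / q) powr d \<le> (r powr d + G) * (1 / q) powr d"
      proof -
        have "1 \<le> (r / q) powr d" using qr q d by (intro ge_one_powr_ge_zero) auto
        also have "\<dots> = r powr d * (1 / q) powr d" unfolding powr_mult[symmetric] by simp
        finally show ?thesis by (simp add: distrib_right)
      qed
      moreover have "W \<le> 1 / \<mu> n" using WJ divide_right_mono[OF J1, of "\<mu> n"] \<mu>0 by simp
      ultimately have "2 * (C3 * (1 + G * (1 / q) powr d) * W) \<le> 2 * (C3 * ((r powr d + G) * (1 / q) powr d) * (1 / \<mu> n))"
        using C3 G W0 by (intro mult_left_mono mult_mono) (auto intro!: add_nonneg_nonneg)
      also have "\<dots> = 2 * C3 * (r powr d + G) * (1 / \<theta> powr (2 * m))"
      proof -
        have "(1 / q) powr d * (1 / \<mu> n) = 1 / (\<mu> n * q powr d)" by (simp add: powr_divide mult.commute)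
        thus ?thesis unfolding I4[symmetric] by (simp only: mult.assoc)
      qed
      also have "\<dots> \<le> 2 * C3 * (r powr d + G) * 1"
      proof (intro mult_left_mono)
        have "1 \<le> \<theta> powr (2 * m)" using False m by (intro ge_one_powr_ge_zero) auto
        thus "1 / \<theta> powr (2 * m) \<le> 1" using \<theta> by (simp add: pos_divide_le_eq)
      qed (use C3 G in auto)
      finally have WG: "2 * (C3 * (1 + G * (1 / q) powr d) * W) \<le> 2 * C3 * (r powr d + G) * 1" .
      hence "1 * Q + 1 * (2 + 2 * (C3 * (1 + G * (1 / q) powr d) * W)) \<le> E2 * 1"
      proof -
        have "1 * u + 1 * (2 + v) \<le> (3 + z) * 1" if "v \<le> z * 1" "u \<le> 1" for u v z :: real using that by simp
        from this[OF WG order.trans[OF QJ J1]] show ?thesis unfolding E2_def .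
      qed
      also have "\<dots> \<le> (E1 + E2) * (T1 + T2)" using E T T21 by (intro mult_mono) auto
      finally show ?thesis using main[of 1] C2(1) by (simp add: mult_left_mono order_trans)
    qed
    also have "\<dots> = C2 * (E1 + E2) * (T1 + T2)" by simp
    also have "\<dots> \<le> C * (T1 + T2)" using C T by (intro mult_right_mono) auto
    finally have V: "pred_var (gauss_mix a0 \<nu>0) n (p n) w x \<le> C * (T1 + T2)" .
    have "W \<le> C * (h powr (2 * \<nu>) / \<mu> n)"
      by (rule order.trans[OF Wh mult_right_mono]) (use C \<mu>0 in auto)
    with V show "pred_var (gauss_mix a0 \<nu>0) n (p n) w x \<le> C * (\<mu> n powr (- (m - m0) / m) * q powr (- (m - m0) * d / m)
                * (\<mu> n / real n) powr (1 - d / (2 * m))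
              + \<mu> n powr ((2 * m0 - d) / (2 * m)) * q powr ((2 * m0 - d) * d / (2 * m))) \<and>
      (\<Sum>k<n. (w k)\<^sup>2) \<le> C * (\<mu> n powr (- d / (2 * m)) * real n powr (- (1 - d / (2 * m))))"
      unfolding N_def[symmetric] I1 I2 I3[symmetric] W_def by blast
  qed
qed

section \<open>Subgaussian fields\<close>

lemma nn_integral_std_normal_mgf:
  "(\<integral>\<^sup>+g. ennreal (std_normal_density g * exp (g * b)) \<partial>lborel) = ennreal (exp (b\<^sup>2 / 2))"
proof -
  have "std_normal_density g * exp (g * b) = exp (b\<^sup>2 / 2) * normal_density b 1 g" for g
    by (simp add: normal_density_def exp_add[symmetric] power2_eq_square) (simp add: field_simps)
  hence "(\<integral>\<^sup>+g. ennreal (std_normal_density g * exp (g * b)) \<partial>lborel) = (\<integral>\<^sup>+g. ennreal (exp (b\<^sup>2 / 2) * normal_density b 1 g) \<partial>lborel)"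
    by simp
  also have "\<dots> = ennreal (LINT g|lborel. exp (b\<^sup>2 / 2) * normal_density b 1 g)"
    by (intro nn_integral_eq_integral) auto
  finally show ?thesis by simp
qed

text \<open>Variance proxy in the sense of moment generating functions. The nonnegative integral
  builds in finiteness, and the notion covers the Gaussian and the noise part alike.\<close>

definition subgaussian :: "'w measure \<Rightarrow> ('w \<Rightarrow> real) \<Rightarrow> real \<Rightarrow> bool" where
  "subgaussian M X V \<longleftrightarrow> X \<in> borel_measurable M \<and>
     (\<forall>s. (\<integral>\<^sup>+\<omega>. ennreal (exp (s * X \<omega>)) \<partial>M) \<le> ennreal (exp (s\<^sup>2 * V / 2)))"

lemma subgaussian_mono: "subgaussian M X V \<Longrightarrow> V \<le> V' \<Longrightarrow> subgaussian M X V'"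
  unfolding subgaussian_def
  by (fastforce intro: order.trans ennreal_leI mult_left_mono divide_right_mono)

text \<open>Decoupling: exp(X^2/4V) is the average of exp(gX/sqrt(2V)) over a standard normal g.\<close>
lemma subgaussian_exp_square:
  assumes M: "prob_space M" and X: "subgaussian M X V" and V: "V > 0"
  shows "(\<integral>\<^sup>+\<omega>. ennreal (exp ((X \<omega>)\<^sup>2 / (4 * V))) \<partial>M) \<le> ennreal (sqrt 2)"
proof -
  interpret prob_space M by fact
  interpret pair_sigma_finite M "lborel :: real measure" by standard
  have [measurable]: "X \<in> borel_measurable M" using X by (simp add: subgaussian_def)
  have sq: "(x / sqrt (2 * V))\<^sup>2 / 2 = x\<^sup>2 / (4 * V)" for x using V by (simp add: power_divide)
  have "(\<integral>\<^sup>+\<omega>. ennreal (exp ((X \<omega>)\<^sup>2 / (4 * V))) \<partial>M) =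
     (\<integral>\<^sup>+\<omega>. \<integral>\<^sup>+g. ennreal (std_normal_density g * exp (g * (X \<omega> / sqrt (2 * V)))) \<partial>lborel \<partial>M)"
    unfolding nn_integral_std_normal_mgf sq ..
  also have "\<dots> = (\<integral>\<^sup>+g. \<integral>\<^sup>+\<omega>. ennreal (std_normal_density g * exp (g * (X \<omega> / sqrt (2 * V)))) \<partial>M \<partial>lborel)"
    by (rule Fubini'[symmetric]) measurable
  also have "\<dots> \<le> (\<integral>\<^sup>+g. ennreal (sqrt 2 * normal_density 0 (sqrt 2) g) \<partial>lborel)"
  proof (rule nn_integral_mono)
    fix g :: real
    have "(\<integral>\<^sup>+\<omega>. ennreal (std_normal_density g * exp (g * (X \<omega> / sqrt (2 * V)))) \<partial>M) =
        ennreal (std_normal_density g) * (\<integral>\<^sup>+\<omega>. ennreal (exp ((g / sqrt (2 * V)) * X \<omega>)) \<partial>M)"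
      by (subst nn_integral_cmult[symmetric]) (auto simp: ennreal_mult)
    also have "\<dots> \<le> ennreal (std_normal_density g) * ennreal (exp ((g / sqrt (2 * V))\<^sup>2 * V / 2))"
    proof (intro mult_left_mono)
      show "(\<integral>\<^sup>+\<omega>. ennreal (exp ((g / sqrt (2 * V)) * X \<omega>)) \<partial>M) \<le> ennreal (exp ((g / sqrt (2 * V))\<^sup>2 * V / 2))"
        using X unfolding subgaussian_def by blast
    qed simp
    \<comment> \<open>exp(-g^2/2) and exp(g^2/4) combine to a Gaussian of variance 2, whose mass in
      units of the standard normalisation is the sqrt 2 of the bound.\<close>
    also have "\<dots> = ennreal (sqrt 2 * normal_density 0 (sqrt 2) g)"
    proof -
      have e: "(g / sqrt (2 * V))\<^sup>2 * V / 2 = g\<^sup>2 / 4" using V by (simp add: power_divide)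
      have "exp (- g\<^sup>2 / 2) * exp (g\<^sup>2 / 4) = exp (- g\<^sup>2 / 4)" by (simp flip: exp_add)
      hence "std_normal_density g * exp (g\<^sup>2 / 4) = (1 / sqrt (2 * pi)) * exp (- g\<^sup>2 / 4)"
        by (simp add: normal_density_def)
      also have "\<dots> = sqrt 2 * normal_density 0 (sqrt 2) g"
      proof -
        have "sqrt (2 * pi * (sqrt 2)\<^sup>2) = sqrt 2 * sqrt (2 * pi)" by (simp add: real_sqrt_mult)
        thus ?thesis by (simp add: normal_density_def)
      qed
      finally have "std_normal_density g * exp ((g / sqrt (2 * V))\<^sup>2 * V / 2) = sqrt 2 * normal_density 0 (sqrt 2) g"
        unfolding e .
      thus ?thesis by (simp flip: ennreal_mult)
    qed
    finally show "(\<integral>\<^sup>+\<omega>. ennreal (std_normal_density g * exp (g * (X \<omega> / sqrt (2 * V)))) \<partial>M) \<le> ennreal (sqrt 2 * normal_density 0 (sqrt 2) g)" .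
  qed
  also have "\<dots> = ennreal (LINT g|lborel. sqrt 2 * normal_density 0 (sqrt 2) g)"
    by (intro nn_integral_eq_integral) auto
  finally show ?thesis by simp
qed

text \<open>Completing the square; the degenerate case \<open>v = 0\<close> has no density and is
  treated apart.\<close>

lemma normal_rv_subgaussian:
  assumes M: "prob_space M" and X: "normal_rv M X 0 v"
  shows "subgaussian M X v"
  unfolding subgaussian_def
proof (intro conjI allI)
  interpret prob_space M by fact
  show meas: "X \<in> borel_measurable M"
    using X unfolding normal_rv_def by (auto dest: distributed_measurable)
  fix s :: real
  show "(\<integral>\<^sup>+\<omega>. ennreal (exp (s * X \<omega>)) \<partial>M) \<le> ennreal (exp (s\<^sup>2 * v / 2))"
  proof (cases "v = 0")
    case True
    hence "AE \<omega> in M. X \<omega> = 0" using X unfolding normal_rv_def by auto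
    hence "AE \<omega> in M. ennreal (exp (s * X \<omega>)) = 1" by eventually_elim simp
    hence "(\<integral>\<^sup>+\<omega>. ennreal (exp (s * X \<omega>)) \<partial>M) = (\<integral>\<^sup>+\<omega>. 1 \<partial>M)" by (rule nn_integral_cong_AE)
    thus ?thesis using True by (simp add: emeasure_space_1)
  next
    case False
    hence v: "v > 0" and D: "distributed M lborel X (normal_density 0 (sqrt v))" using X unfolding normal_rv_def by auto
    have "(\<integral>\<^sup>+\<omega>. ennreal (exp (s * X \<omega>)) \<partial>M) = (\<integral>\<^sup>+x. ennreal (normal_density 0 (sqrt v) x) * ennreal (exp (s * x)) \<partial>lborel)"
      by (rule distributed_nn_integral[OF D, symmetric]) measurable
    also have "\<dots> = (\<integral>\<^sup>+x. ennreal (exp (s\<^sup>2 * v / 2) * normal_density (s * v) (sqrt v) x) \<partial>lborel)"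
    proof (intro nn_integral_cong)
      fix x :: real
      have "- x\<^sup>2 / (2 * v) + s * x = s\<^sup>2 * v / 2 + - (x - s * v)\<^sup>2 / (2 * v)"
        using v by (simp add: power2_eq_square field_simps)
      hence "normal_density 0 (sqrt v) x * exp (s * x) = exp (s\<^sup>2 * v / 2) * normal_density (s * v) (sqrt v) x"
        using v by (simp add: normal_density_def flip: exp_add)
      thus "ennreal (normal_density 0 (sqrt v) x) * ennreal (exp (s * x)) = ennreal (exp (s\<^sup>2 * v / 2) * normal_density (s * v) (sqrt v) x)"
        by (simp flip: ennreal_mult)
    qed
    also have "\<dots> = ennreal (LINT x|lborel. exp (s\<^sup>2 * v / 2) * normal_density (s * v) (sqrt v) x)"
      using v by (intro nn_integral_eq_integral) auto
    finally show ?thesis using v by simp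
  qed
qed

text \<open>Independence turns the moment generating function into a product, in which the exponents
  (s w_k)^2 V/2 add up.\<close>

lemma subgaussian_sum:
  fixes w :: "nat \<Rightarrow> real"
  assumes M: "prob_space M" and ind: "prob_space.indep_vars M (\<lambda>_. borel) \<epsilon> UNIV"
    and sub: "\<And>k. subgaussian M (\<epsilon> k) V"
  shows "subgaussian M (\<lambda>\<omega>. \<Sum>k<n. w k * \<epsilon> k \<omega>) (V * (\<Sum>k<n. (w k)\<^sup>2))"
  unfolding subgaussian_def
proof (intro conjI allI)
  interpret prob_space M by fact
  have [measurable]: "\<epsilon> k \<in> borel_measurable M" for k using sub by (simp add: subgaussian_def)
  show "(\<lambda>\<omega>. \<Sum>k<n. w k * \<epsilon> k \<omega>) \<in> borel_measurable M" by measurable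
  fix s :: real
  have ind2: "indep_vars (\<lambda>_. borel) (\<lambda>k \<omega>. ennreal (exp (s * (w k * \<epsilon> k \<omega>)))) {..<n}"
    by (rule indep_vars_compose2[OF indep_vars_subset[OF ind]]) auto
  have "(\<integral>\<^sup>+\<omega>. ennreal (exp (s * (\<Sum>k<n. w k * \<epsilon> k \<omega>))) \<partial>M) = (\<integral>\<^sup>+\<omega>. (\<Prod>k<n. ennreal (exp (s * (w k * \<epsilon> k \<omega>)))) \<partial>M)"
    by (simp add: prod_ennreal sum_distrib_left exp_sum)
  also have "\<dots> = (\<Prod>k<n. \<integral>\<^sup>+\<omega>. ennreal (exp (s * (w k * \<epsilon> k \<omega>))) \<partial>M)"
    by (rule indep_vars_nn_integral[OF _ ind2]) auto
  also have "\<dots> \<le> (\<Prod>k<n. ennreal (exp ((s * w k)\<^sup>2 * V / 2)))"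
  proof (induction n)
    case (Suc n)
    have "(\<integral>\<^sup>+\<omega>. ennreal (exp (s * (w n * \<epsilon> n \<omega>))) \<partial>M) \<le> ennreal (exp ((s * w n)\<^sup>2 * V / 2))"
      using sub[of n] unfolding subgaussian_def mult.assoc[symmetric] by blast
    with Suc show ?case by (simp only: prod.lessThan_Suc) (rule mult_mono, auto)
  qed simp
  also have "\<dots> = ennreal (exp (s\<^sup>2 * (V * (\<Sum>k<n. (w k)\<^sup>2)) / 2))"
    by (simp add: prod_ennreal sum_distrib_left sum_divide_distrib power_mult_distrib mult_ac flip: exp_sum)
  finally show "(\<integral>\<^sup>+\<omega>. ennreal (exp (s * (\<Sum>k<n. w k * \<epsilon> k \<omega>))) \<partial>M) \<le> ennreal (exp (s\<^sup>2 * (V * (\<Sum>k<n. (w k)\<^sup>2)) / 2))" .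
qed

text \<open>The linear term is kept exact because it vanishes in expectation for a centred
  variable.\<close>

lemma exp_le_quadratic: "exp x \<le> 1 + x + x\<^sup>2 * exp \<bar>x\<bar>" for x :: real
proof -
  obtain t where t: "\<bar>t\<bar> \<le> \<bar>x\<bar>" "exp x = (\<Sum>m<2. x ^ m / fact m) + exp t / fact 2 * x ^ 2"
    using Maclaurin_exp_le[of x 2] by blast
  have "exp t \<le> exp \<bar>x\<bar>" using t(1) by simp
  hence "exp t / 2 \<le> exp \<bar>x\<bar>" using exp_gt_zero[of t] by linarith
  hence "exp t / 2 * x\<^sup>2 \<le> exp \<bar>x\<bar> * x\<^sup>2" by (intro mult_right_mono) auto
  thus ?thesis using t(2) by (simp add: numeral_2_eq_2 mult.commute)
qed

text \<open>For |s| C <= 1 the quadratic bound and mean zero give 1 + 4 A s^2 C^2. For |s| C > 1 one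
  uses s X <= s^2 C^2/4 + X^2/C^2 and absorbs the prefactor A, since s^2 C^2 >= 1. In the proxy, 1/2
  pays for s^2 C^2/4, and 8 A for the absorbed prefactor and for small s.\<close>

lemma centered_subgaussian:
  fixes C A :: real
  assumes M: "prob_space M" and C: "C > 0" and int: "integrable M X" "integral\<^sup>L M X = 0"
    and sq: "integrable M (\<lambda>\<omega>. exp ((X \<omega>)\<^sup>2 / C\<^sup>2))" "integral\<^sup>L M (\<lambda>\<omega>. exp ((X \<omega>)\<^sup>2 / C\<^sup>2)) \<le> A"
  shows "subgaussian M X (C\<^sup>2 * (1 / 2 + 8 * A))"
  unfolding subgaussian_def
proof (intro conjI allI)
  interpret prob_space M by fact
  show [measurable]: "X \<in> borel_measurable M" using int by auto
  let ?E = "\<lambda>\<omega>. exp ((X \<omega>)\<^sup>2 / C\<^sup>2)"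
  have "1 \<le> integral\<^sup>L M ?E"
    using integral_mono[OF integrable_const[of 1] sq(1)] by (simp add: prob_space)
  hence A: "A \<ge> 1" using sq(2) by simp
  fix s :: real
  show "(\<integral>\<^sup>+\<omega>. ennreal (exp (s * X \<omega>)) \<partial>M) \<le> ennreal (exp (s\<^sup>2 * (C\<^sup>2 * (1 / 2 + 8 * A)) / 2))"
  proof (cases "\<bar>s\<bar> * C \<le> 1")
    case True
    have bnd: "exp (s * X \<omega>) \<le> 1 + s * X \<omega> + s\<^sup>2 * (4 * C\<^sup>2) * ?E \<omega>" for \<omega>
    proof -
      define x where "x = X \<omega> / C"
      have sx: "s * X \<omega> = (s * C) * x" using C by (simp add: x_def)
      have x2: "(X \<omega>)\<^sup>2 / C\<^sup>2 = x\<^sup>2" by (simp add: x_def power_divide)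
      \<comment> \<open>Only half of the exponent x^2 is used here; the other half absorbs the
        factor x^2 of the quadratic term.\<close>
      have "\<bar>s * X \<omega>\<bar> \<le> 1 * \<bar>x\<bar>" unfolding sx abs_mult using True C by (intro mult_right_mono) (auto simp: abs_mult)
      also have "\<dots> \<le> 1 / 2 + x\<^sup>2 / 2" using sum_squares_bound[of 1 "\<bar>x\<bar>"] by simp
      finally have "exp \<bar>s * X \<omega>\<bar> \<le> exp (1 / 2) * exp (x\<^sup>2 / 2)" by (simp flip: exp_add)
      also have "exp (1 / 2 :: real) \<le> 2" using exp_bound[of "1 / 2 :: real"] by (simp add: power2_eq_square)
      finally have 1: "exp \<bar>s * X \<omega>\<bar> \<le> 2 * exp (x\<^sup>2 / 2)" by simp
      have 2: "x\<^sup>2 \<le> 2 * exp (x\<^sup>2 / 2)" using exp_ge_add_one_self[of "x\<^sup>2 / 2"] by linarith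
      have "(s * X \<omega>)\<^sup>2 * exp \<bar>s * X \<omega>\<bar> = s\<^sup>2 * C\<^sup>2 * (x\<^sup>2 * exp \<bar>s * X \<omega>\<bar>)" unfolding sx by (simp add: power_mult_distrib)
      also have "\<dots> \<le> s\<^sup>2 * C\<^sup>2 * ((2 * exp (x\<^sup>2 / 2)) * (2 * exp (x\<^sup>2 / 2)))"
        by (intro mult_left_mono mult_mono 1 2) auto
      also have "(2 * exp (x\<^sup>2 / 2)) * (2 * exp (x\<^sup>2 / 2)) = 4 * exp (x\<^sup>2)" by (simp flip: exp_add)
      finally show ?thesis using exp_le_quadratic[of "s * X \<omega>"] unfolding x2 by (simp add: mult_ac)
    qed
    have "(\<integral>\<^sup>+\<omega>. ennreal (exp (s * X \<omega>)) \<partial>M) \<le> (\<integral>\<^sup>+\<omega>. ennreal (1 + s * X \<omega> + s\<^sup>2 * (4 * C\<^sup>2) * ?E \<omega>) \<partial>M)"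
      by (intro nn_integral_mono ennreal_leI bnd)
    also have "\<dots> = ennreal (integral\<^sup>L M (\<lambda>\<omega>. 1 + s * X \<omega> + s\<^sup>2 * (4 * C\<^sup>2) * ?E \<omega>))"
      using int sq by (intro nn_integral_eq_integral) (auto intro!: AE_I2 order.trans[OF _ bnd])
    also have "integral\<^sup>L M (\<lambda>\<omega>. 1 + s * X \<omega> + s\<^sup>2 * (4 * C\<^sup>2) * ?E \<omega>) = 1 + s\<^sup>2 * (4 * C\<^sup>2) * integral\<^sup>L M ?E"
      using int sq by (simp add: prob_space)
    also have "\<dots> \<le> 1 + s\<^sup>2 * (4 * C\<^sup>2) * A" using sq by (intro add_left_mono mult_left_mono) auto
    also have "\<dots> \<le> exp (s\<^sup>2 * (4 * C\<^sup>2) * A)" by (rule exp_ge_add_one_self)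
    also have "\<dots> \<le> exp (s\<^sup>2 * (C\<^sup>2 * (1 / 2 + 8 * A)) / 2)"
    proof -
      have "0 \<le> s\<^sup>2 * C\<^sup>2" by simp
      thus ?thesis by (simp add: algebra_simps)
    qed
    finally show ?thesis by (simp add: ennreal_leI)
  next
    case False
    have bnd: "exp (s * X \<omega>) \<le> exp (s\<^sup>2 * C\<^sup>2 / 4) * ?E \<omega>" for \<omega>
    proof -
      define x where "x = X \<omega> / C"
      have sx: "s * X \<omega> = (s * C) * x" using C by (simp add: x_def)
      have "0 \<le> ((s * C) / 2 - x)\<^sup>2" by simp
      hence "(s * C) * x \<le> s\<^sup>2 * C\<^sup>2 / 4 + x\<^sup>2" by (simp add: power2_eq_square field_simps)
      thus ?thesis unfolding sx exp_add[symmetric] by (simp add: x_def power_divide)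
    qed
    have "(\<integral>\<^sup>+\<omega>. ennreal (exp (s * X \<omega>)) \<partial>M) \<le> (\<integral>\<^sup>+\<omega>. ennreal (exp (s\<^sup>2 * C\<^sup>2 / 4) * ?E \<omega>) \<partial>M)"
      by (intro nn_integral_mono ennreal_leI bnd)
    also have "\<dots> = ennreal (integral\<^sup>L M (\<lambda>\<omega>. exp (s\<^sup>2 * C\<^sup>2 / 4) * ?E \<omega>))"
      using sq by (intro nn_integral_eq_integral) auto
    also have "integral\<^sup>L M (\<lambda>\<omega>. exp (s\<^sup>2 * C\<^sup>2 / 4) * ?E \<omega>) \<le> exp (s\<^sup>2 * C\<^sup>2 / 4) * exp (4 * A * (s\<^sup>2 * C\<^sup>2))"
    proof -
      have "1\<^sup>2 \<le> (\<bar>s\<bar> * C)\<^sup>2" using False by (intro power_mono) auto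
      hence "1 \<le> s\<^sup>2 * C\<^sup>2" by (simp add: power_mult_distrib)
      hence "A * 1 \<le> 4 * A * (s\<^sup>2 * C\<^sup>2)" using A by (intro mult_mono) auto
      hence "A \<le> exp (4 * A * (s\<^sup>2 * C\<^sup>2))" using exp_ge_add_one_self[of "4 * A * (s\<^sup>2 * C\<^sup>2)"] by linarith
      thus ?thesis using sq by simp
    qed
    also have "\<dots> = exp (s\<^sup>2 * (C\<^sup>2 * (1 / 2 + 8 * A)) / 2)"
      by (simp add: algebra_simps flip: exp_add)
    finally show ?thesis by (simp add: ennreal_leI)
  qed
qed

text \<open>The integral of Y^2 over the domain is controlled through Markov's inequality for the integral of exp(Y^2/4V);
  the tangent inequality exp(u) >= exp(r)(1 + u - r) plays the role of Jensen's inequality.\<close>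
lemma subgaussian_field_tail:
  fixes Y :: "'a::euclidean_space \<Rightarrow> 'w \<Rightarrow> real" and V t vol :: real
  assumes M: "prob_space M" and [measurable]: "case_prod Y \<in> borel_measurable (lborel \<Otimes>\<^sub>M M)"
    and [measurable]: "\<Omega> \<in> sets borel" and vol: "emeasure lborel \<Omega> = ennreal vol" "vol > 0"
    and sub: "\<And>x. x \<in> \<Omega> \<Longrightarrow> subgaussian M (Y x) V" and V: "V > 0" and t: "t \<ge> 1"
  shows "measure M {\<omega> \<in> space M. \<not> (\<integral>\<^sup>+x\<in>\<Omega>. ennreal ((Y x \<omega>)\<^sup>2) \<partial>lborel) \<le> ennreal (8 * V * vol * t\<^sup>2)} \<le> exp (- t\<^sup>2)"
proof -
  interpret prob_space M by fact
  interpret pair_sigma_finite "lborel :: 'a measure" M by standard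
  have \<Omega>_sets: "\<Omega> \<in> sets lborel" using assms(3) by simp
  \<comment> \<open>The threshold is 4 V r vol, so on the bad event the mean of Y^2/4V over the
    domain is at least r. Half of the exponent 2 t^2 is given up at the end for the factor sqrt
    2.\<close>
  define r where "r = 2 * t\<^sup>2"
  have r: "r \<ge> 0" by (simp add: r_def)
  let ?e = "\<lambda>x \<omega>. ennreal (exp ((Y x \<omega>)\<^sup>2 / (4 * V)))"
  define S where "S = {\<omega> \<in> space M. \<not> (\<integral>\<^sup>+x\<in>\<Omega>. ennreal ((Y x \<omega>)\<^sup>2) \<partial>lborel) \<le> ennreal (8 * V * vol * t\<^sup>2)}"
  have [measurable]: "(\<lambda>(\<omega>, x). Y x \<omega>) \<in> borel_measurable (M \<Otimes>\<^sub>M lborel)"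
    using measurable_pair_swap[OF assms(2)] by (simp add: split_def)
  have S[measurable]: "S \<in> sets M" unfolding S_def by measurable
  have total: "(\<integral>\<^sup>+\<omega>. (\<integral>\<^sup>+x\<in>\<Omega>. ?e x \<omega> \<partial>lborel) \<partial>M) \<le> ennreal (sqrt 2 * vol)"
  proof -
    have "(\<integral>\<^sup>+\<omega>. (\<integral>\<^sup>+x\<in>\<Omega>. ?e x \<omega> \<partial>lborel) \<partial>M) = (\<integral>\<^sup>+x. \<integral>\<^sup>+\<omega>. ?e x \<omega> * indicator \<Omega> x \<partial>M \<partial>lborel)"
      by (rule Fubini') measurable
    also have "\<dots> \<le> (\<integral>\<^sup>+x. ennreal (sqrt 2) * indicator \<Omega> x \<partial>lborel)"
    proof (rule nn_integral_mono)
      fix x :: 'a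
      show "(\<integral>\<^sup>+\<omega>. ?e x \<omega> * indicator \<Omega> x \<partial>M) \<le> ennreal (sqrt 2) * indicator \<Omega> x"
        using subgaussian_exp_square[OF M sub V, of x] by (cases "x \<in> \<Omega>") auto
    qed
    also have "\<dots> = ennreal (sqrt 2 * vol)"
      using vol by (subst nn_integral_cmult_indicator) (auto simp: ennreal_mult)
    finally show ?thesis .
  qed
  have low: "ennreal (exp r * vol) \<le> (\<integral>\<^sup>+x\<in>\<Omega>. ?e x \<omega> \<partial>lborel)" if "\<omega> \<in> S" for \<omega>
  proof -
    have \<omega>: "\<omega> \<in> space M" and gt: "ennreal (8 * V * vol * t\<^sup>2) \<le> (\<integral>\<^sup>+x\<in>\<Omega>. ennreal ((Y x \<omega>)\<^sup>2) \<partial>lborel)"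
      using that by (auto simp: S_def)
    have [measurable]: "(\<lambda>x. Y x \<omega>) \<in> borel_measurable lborel"
      using measurable_Pair1[OF assms(2) \<omega>] by simp
    \<comment> \<open>The term r exp(r) vol appears on both sides because the tangent inequality
      would otherwise require a subtraction in \<open>ennreal\<close>.\<close>
    have "ennreal (exp r * vol) + ennreal (r * exp r * vol) = ennreal (exp r / (4 * V)) * ennreal (8 * V * vol * t\<^sup>2) + ennreal (exp r) * ennreal vol"
      using V vol by (simp add: r_def mult_ac flip: ennreal_mult ennreal_plus)
    also have "\<dots> \<le> ennreal (exp r / (4 * V)) * (\<integral>\<^sup>+x\<in>\<Omega>. ennreal ((Y x \<omega>)\<^sup>2) \<partial>lborel) + ennreal (exp r) * emeasure lborel \<Omega>"
      unfolding vol(1) by (intro add_right_mono mult_left_mono gt) auto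
    also have "\<dots> = (\<integral>\<^sup>+x. ennreal (exp r / (4 * V)) * (ennreal ((Y x \<omega>)\<^sup>2) * indicator \<Omega> x) + ennreal (exp r) * indicator \<Omega> x \<partial>lborel)"
    proof -
      have 1: "(\<lambda>x. ennreal ((Y x \<omega>)\<^sup>2) * indicator \<Omega> x) \<in> borel_measurable lborel" by measurable
      have 2: "(\<lambda>x. ennreal (exp r / (4 * V)) * (ennreal ((Y x \<omega>)\<^sup>2) * indicator \<Omega> x)) \<in> borel_measurable lborel"
        by measurable
      have 3: "(\<lambda>x. ennreal (exp r) * indicator \<Omega> x) \<in> borel_measurable lborel" by measurable
      show ?thesis
        unfolding nn_integral_add[OF 2 3] nn_integral_cmult[OF 1] nn_integral_cmult_indicator[OF \<Omega>_sets] ..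
    qed
    also have "\<dots> = (\<integral>\<^sup>+x\<in>\<Omega>. ennreal (exp r / (4 * V) * (Y x \<omega>)\<^sup>2 + exp r) \<partial>lborel)"
    proof (rule nn_integral_cong)
      fix x :: 'a
      have "ennreal (k * (Y x \<omega>)\<^sup>2 + exp r) = ennreal k * ennreal ((Y x \<omega>)\<^sup>2) + ennreal (exp r)" if "k \<ge> 0" for k
        using that by (subst ennreal_plus) (auto simp: ennreal_mult)
      moreover have "exp r / (4 * V) \<ge> 0" using V by simp
      ultimately have e: "ennreal (exp r / (4 * V) * (Y x \<omega>)\<^sup>2 + exp r) =
        ennreal (exp r / (4 * V)) * ennreal ((Y x \<omega>)\<^sup>2) + ennreal (exp r)" by blast
      show "ennreal (exp r / (4 * V)) * (ennreal ((Y x \<omega>)\<^sup>2) * indicator \<Omega> x) + ennreal (exp r) * indicator \<Omega> x =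
         ennreal (exp r / (4 * V) * (Y x \<omega>)\<^sup>2 + exp r) * indicator \<Omega> x"
        unfolding e by (simp only: distrib_right mult.assoc)
    qed
    also have "\<dots> \<le> (\<integral>\<^sup>+x\<in>\<Omega>. ennreal (exp ((Y x \<omega>)\<^sup>2 / (4 * V)) + r * exp r) \<partial>lborel)"
    proof (intro nn_integral_mono mult_right_mono ennreal_leI)
      fix x
      define u where "u = (Y x \<omega>)\<^sup>2 / (4 * V)"
      have "exp r * (1 + (u - r)) \<le> exp r * exp (u - r)" by (intro mult_left_mono exp_ge_add_one_self) auto
      also have "\<dots> = exp u" by (simp flip: exp_add)
      finally show "exp r / (4 * V) * (Y x \<omega>)\<^sup>2 + exp r \<le> exp ((Y x \<omega>)\<^sup>2 / (4 * V)) + r * exp r"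
        by (simp add: u_def algebra_simps)
    qed auto
    also have "\<dots> = (\<integral>\<^sup>+x. ?e x \<omega> * indicator \<Omega> x + ennreal (r * exp r) * indicator \<Omega> x \<partial>lborel)"
      using r by (intro nn_integral_cong) (subst ennreal_plus, auto simp: distrib_right)
    also have "\<dots> = (\<integral>\<^sup>+x\<in>\<Omega>. ?e x \<omega> \<partial>lborel) + ennreal (r * exp r) * emeasure lborel \<Omega>"
    proof -
      have 1: "(\<lambda>x. ?e x \<omega> * indicator \<Omega> x) \<in> borel_measurable lborel" by measurable
      have 2: "(\<lambda>x. ennreal (r * exp r) * indicator \<Omega> x) \<in> borel_measurable lborel" by measurable
      show ?thesis
        unfolding nn_integral_add[OF 1 2] nn_integral_cmult_indicator[OF \<Omega>_sets] ..
    qed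
    also have "ennreal (r * exp r) * emeasure lborel \<Omega> = ennreal (r * exp r * vol)"
      using vol r by (simp add: ennreal_mult)
    finally show ?thesis by simp
  qed
  have "ennreal (exp r * vol) * emeasure M S = (\<integral>\<^sup>+\<omega>. ennreal (exp r * vol) * indicator S \<omega> \<partial>M)"
    by (subst nn_integral_cmult_indicator) auto
  also have "\<dots> \<le> (\<integral>\<^sup>+\<omega>. (\<integral>\<^sup>+x\<in>\<Omega>. ?e x \<omega> \<partial>lborel) \<partial>M)"
    using low by (intro nn_integral_mono) (auto simp: indicator_def)
  also note total
  finally have "ennreal (exp r * vol * measure M S) \<le> ennreal (sqrt 2 * vol)"
    using vol by (simp add: emeasure_eq_measure ennreal_mult)
  hence "exp r * vol * measure M S \<le> sqrt 2 * vol" using vol by (subst (asm) ennreal_le_iff) auto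
  hence "measure M S \<le> sqrt 2 / exp r" using vol by (simp add: field_simps)
  also have "\<dots> \<le> exp (- t\<^sup>2)"
  proof -
    have "sqrt 2 \<le> sqrt (2\<^sup>2)" by (rule real_sqrt_le_mono) simp
    also have "\<dots> \<le> exp 1" using exp_ge_add_one_self[of 1] by simp
    \<comment> \<open>Here \<open>t \<ge> 1\<close> absorbs the constant.\<close>
    also have "\<dots> \<le> exp (t\<^sup>2)" using t by simp
    finally have "sqrt 2 / exp r \<le> exp (t\<^sup>2) / exp r" by (intro divide_right_mono) auto
    also have "\<dots> = exp (- t\<^sup>2)" by (simp add: r_def flip: exp_diff)
    finally show ?thesis .
  qed
  finally show ?thesis by (simp add: S_def)
qed

section \<open>The error bound\<close>

lemma gauss_mix_measurable [measurable]: "gauss_mix a \<nu> \<in> borel_measurable borel"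
  unfolding gauss_mix_def[abs_def] by measurable

text \<open>R + \<mu> I is positive definite, so \<open>mat_inverse\<close> succeeds and
  \<open>the\<close> in the predictor denotes a genuine inverse. Its entries depend neither on x nor
  on the data, which makes the weights explicit, hence measurable, functions of x.\<close>

lemma kernel_predictor_weights:
  fixes p :: "nat \<Rightarrow> 'a::euclidean_space"
  assumes a: "a > 0" and \<nu>: "\<nu> > 0" and \<mu>: "\<mu> > 0"
  obtains B where
    "\<And>x y. kernel_predictor (gauss_mix a \<nu>) \<mu> n p y x = (\<Sum>k<n. (\<Sum>j<n. gauss_mix a \<nu> (x - p j) * B j k) * y k)"
    "\<And>x. normal_equations (gauss_mix a \<nu>) \<mu> n p (\<lambda>k. \<Sum>j<n. gauss_mix a \<nu> (x - p j) * B j k) x"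
proof -
  let ?K = "gauss_mix a \<nu> :: 'a \<Rightarrow> real"
  define A where "A = mat n n (\<lambda>(j, k). ?K (p j - p k)) + \<mu> \<cdot>\<^sub>m 1\<^sub>m n"
  have A: "A \<in> carrier_mat n n" by (simp add: A_def)
  have Ajk: "A $$ (j, k) = ?K (p j - p k) + (if j = k then \<mu> else 0)" if "j < n" "k < n" for j k
    using that by (simp add: A_def)
  \<comment> \<open>A null vector v would make v^T A v = 0, which is the quadratic form plus \<mu>
    |v|^2.\<close>
  have "Determinant.det A \<noteq> 0"
  proof
    assume "Determinant.det A = 0"
    then obtain v where v: "v \<in> carrier_vec n" "v \<noteq> 0\<^sub>v n" "A *\<^sub>v v = 0\<^sub>v n"
      using det_0_iff_vec_prod_zero[OF A] by blast
    have Av: "(\<Sum>k<n. A $$ (j, k) * vec_index v k) = 0" if "j < n" for j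
    proof -
      have "vec_index (A *\<^sub>v v) j = 0" using v that by simp
      thus ?thesis using that A v by (simp add: mult_mat_vec_def scalar_prod_def lessThan_atLeast0)
    qed
    have "0 = (\<Sum>j<n. vec_index v j * (\<Sum>k<n. A $$ (j, k) * vec_index v k))"
      using Av by simp
    also have "\<dots> = (\<Sum>j<n. \<Sum>k<n. vec_index v j * vec_index v k * ?K (p j - p k) + (if j = k then \<mu> * (vec_index v j)\<^sup>2 else 0))"
      unfolding sum_distrib_left by (intro sum.cong refl) (auto simp: Ajk algebra_simps power2_eq_square)
    also have "\<dots> = quad_form ?K n p (vec_index v) + \<mu> * (\<Sum>j<n. (vec_index v j)\<^sup>2)"
      by (simp add: sum.distrib quad_form_def sum_distrib_left)
    finally have "\<mu> * (\<Sum>j<n. (vec_index v j)\<^sup>2) \<le> 0"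
      using quad_form_nonneg[OF a \<nu>, of n p "vec_index v"] by linarith
    hence "(\<Sum>j<n. (vec_index v j)\<^sup>2) \<le> 0" using \<mu> by (simp add: mult_le_0_iff)
    hence "(\<Sum>j<n. (vec_index v j)\<^sup>2) = 0" by (simp add: order_antisym sum_nonneg)
    hence "\<forall>j<n. vec_index v j = 0" by (simp add: sum_nonneg_eq_0_iff)
    hence "v = 0\<^sub>v n" using v(1) by (intro eq_vecI) auto
    thus False using v(2) by simp
  qed
  then obtain B where B: "mat_inverse A = Some B"
    using det_non_zero_imp_unit[OF A, of "()"] mat_inverse(1)[OF A, of "()"] by (cases "mat_inverse A") auto
  have BA: "B * A = 1\<^sub>m n" "B \<in> carrier_mat n n" using mat_inverse(2)[OF A B] by auto
  show ?thesis
  proof (rule that[of "\<lambda>j k. B $$ (j, k)"])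
    fix x y
    have "kernel_predictor ?K \<mu> n p y x = (\<Sum>j<n. ?K (x - p j) * (\<Sum>k<n. B $$ (j, k) * y k))"
      unfolding kernel_predictor_def Let_def A_def[symmetric] B option.sel
      by (intro sum.cong refl) (use BA in \<open>simp add: mult_mat_vec_def scalar_prod_def lessThan_atLeast0\<close>)
    also have "\<dots> = (\<Sum>k<n. (\<Sum>j<n. ?K (x - p j) * B $$ (j, k)) * y k)"
      unfolding sum_distrib_left sum_distrib_right by (subst sum.swap) (simp only: mult.assoc)
    finally show "kernel_predictor ?K \<mu> n p y x = (\<Sum>k<n. (\<Sum>j<n. ?K (x - p j) * B $$ (j, k)) * y k)" .
  next
    fix x
    let ?w = "\<lambda>k. \<Sum>j<n. ?K (x - p j) * B $$ (j, k)"
    show "normal_equations ?K \<mu> n p ?w x"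
      unfolding normal_equations_def
    proof (intro allI impI)
      fix k assume k: "k < n"
      \<comment> \<open>The weights are r(x) multiplied by B from the right, so they solve the
        system with columns of A; symmetry of the kernel turns columns into rows.\<close>
      have sym: "?K (u - v) = ?K (v - u)" for u v using gauss_mix_uminus[of a \<nu> "u - v"] by simp
      have "(\<Sum>j<n. ?w j * ?K (p k - p j)) + \<mu> * ?w k = (\<Sum>j<n. ?w j * ?K (p k - p j)) + (\<Sum>j<n. if j = k then \<mu> * ?w j else 0)"
        using k by simp
      also have "\<dots> = (\<Sum>j<n. ?w j * A $$ (j, k))"
        unfolding sum.distrib[symmetric] using k sym[of "p k"]
        by (intro sum.cong refl) (auto simp: Ajk distrib_left distrib_right mult.commute)
      also have "\<dots> = (\<Sum>i<n. ?K (x - p i) * (\<Sum>j<n. B $$ (i, j) * A $$ (j, k)))"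
        unfolding sum_distrib_left sum_distrib_right by (subst sum.swap) (simp only: mult.assoc)
      also have "\<dots> = (\<Sum>i<n. ?K (x - p i) * (1\<^sub>m n $$ (i, k)))"
        unfolding BA(1)[symmetric]
        by (intro sum.cong refl) (use k A BA(2) in \<open>simp add: times_mat_def scalar_prod_def lessThan_atLeast0\<close>)
      also have "\<dots> = (\<Sum>i<n. if i = k then ?K (x - p i) else 0)"
        using k by (intro sum.cong refl) auto
      finally show "(\<Sum>j<n. ?w j * ?K (p k - p j)) + \<mu> * ?w k = ?K (x - p k)" using k by simp
    qed
  qed
qed

text \<open>\<open>centered_gaussian_process\<close> speaks of linear combinations over finite sets,
  in which every point occurs once. Since x may coincide with a design point, coefficients at equal
  points are collected first.\<close>

lemma gaussian_process_prediction_error: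
  fixes K :: "'a::euclidean_space \<Rightarrow> real"
  assumes Z: "centered_gaussian_process M Z (\<lambda>x x'. \<sigma>\<^sup>2 * K (x - x'))" and sym: "\<And>y. K (- y) = K y"
  shows "normal_rv M (\<lambda>\<omega>. Z x \<omega> - (\<Sum>k<n. w k * Z (p k) \<omega>)) 0 (\<sigma>\<^sup>2 * pred_var K n p w x)"
proof -
  define F where "F = insert x (p ` {..<n})"
  \<comment> \<open>The total coefficient at \<open>y\<close>; repeated design points are merged as
    well.\<close>
  define c where "c y = (if y = x then 1 else 0) - (\<Sum>k<n. if p k = y then w k else 0)" for y
  have fin: "finite F" by (simp add: F_def)
  have comb: "(\<Sum>y\<in>F. c y * g y) = g x - (\<Sum>k<n. w k * g (p k))" for g :: "'a \<Rightarrow> real"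
  proof -
    have "(\<Sum>y\<in>F. c y * g y) = (\<Sum>y\<in>F. if y = x then g y else 0) - (\<Sum>y\<in>F. \<Sum>k<n. if p k = y then w k * g y else 0)"
      unfolding sum_subtractf[symmetric]
      by (intro sum.cong refl) (auto simp: c_def left_diff_distrib sum_distrib_right intro!: sum.cong)
    also have "(\<Sum>y\<in>F. if y = x then g y else 0) = g x" using fin by (simp add: F_def)
    also have "(\<Sum>y\<in>F. \<Sum>k<n. if p k = y then w k * g y else 0) = (\<Sum>k<n. \<Sum>y\<in>F. if p k = y then w k * g y else 0)"
      by (rule sum.swap)
    also have "\<dots> = (\<Sum>k<n. w k * g (p k))"
      using fin by (intro sum.cong refl) (auto simp: F_def)
    finally show ?thesis .
  qed
  have sym2: "K (p k - x) = K (x - p k)" for k using sym[of "x - p k"] by simp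
  have "(\<Sum>y\<in>F. \<Sum>y'\<in>F. c y * c y' * (\<sigma>\<^sup>2 * K (y - y'))) = \<sigma>\<^sup>2 * (\<Sum>y\<in>F. c y * (\<Sum>y'\<in>F. c y' * K (y - y')))"
    by (simp add: sum_distrib_left mult_ac)
  also have "(\<Sum>y\<in>F. c y * (\<Sum>y'\<in>F. c y' * K (y - y'))) = pred_var K n p w x"
    unfolding comb pred_var_def quad_form_def
    by (simp add: sym2 right_diff_distrib sum_subtractf sum_negf sum_distrib_left mult.assoc)
  finally have "(\<Sum>y\<in>F. \<Sum>y'\<in>F. c y * c y' * (\<sigma>\<^sup>2 * K (y - y'))) = \<sigma>\<^sup>2 * pred_var K n p w x" .
  moreover have "normal_rv M (\<lambda>\<omega>. \<Sum>y\<in>F. c y * Z y \<omega>) 0 (\<Sum>y\<in>F. \<Sum>y'\<in>F. c y * c y' * (\<sigma>\<^sup>2 * K (y - y')))"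
    using Z fin unfolding centered_gaussian_process_def by blast
  ultimately show ?thesis unfolding comb by simp
qed

text \<open>\<open>n \<ge> 2\<close> because the separation radius is a minimum over pairs of
  distinct points. The squared norm is a nonnegative integral, so its finiteness is part of the
  event.\<close>

theorem theorem1:
  fixes M :: "'w measure"
    and \<Omega> :: "'a::euclidean_space set"
    and Z :: "'a \<Rightarrow> 'w \<Rightarrow> real"
    and \<epsilon> :: "nat \<Rightarrow> 'w \<Rightarrow> real"
    and xs :: "nat \<Rightarrow> nat \<Rightarrow> 'a"
    and \<mu> :: "nat \<Rightarrow> real"
    and \<sigma> \<phi>\<^sub>0 \<nu>\<^sub>0 \<phi> \<nu> m\<^sub>0 m :: real
  defines "d \<equiv> real DIM('a)"
    and "\<Psi> \<equiv> matern \<phi>\<^sub>0 \<nu>\<^sub>0 :: 'a \<Rightarrow> real"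
    and "\<Phi> \<equiv> matern \<phi> \<nu> :: 'a \<Rightarrow> real"
  assumes M: "prob_space M"
    and \<Omega>_compact: "compact \<Omega>"
    and \<Omega>_pos: "emeasure lborel \<Omega> > 0"
    and \<Omega>_lip: "lipschitz_boundary \<Omega>"
    and \<Omega>_cone: "interior_cone_condition \<Omega>"
    and \<sigma>_pos: "\<sigma> > 0"
    and Z_gp: "centered_gaussian_process M Z (\<lambda>x x'. \<sigma>\<^sup>2 * \<Psi> (x - x'))"
    and Z_meas: "(\<lambda>(x, \<omega>). Z x \<omega>) \<in> borel_measurable (lborel \<Otimes>\<^sub>M M)"
    and \<epsilon>_indep: "prob_space.indep_vars M (\<lambda>_. borel) \<epsilon> UNIV"
    and \<epsilon>_ident: "\<forall>k. distr M borel (\<epsilon> k) = distr M borel (\<epsilon> 0)"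
    and \<epsilon>_mean: "\<forall>k. integrable M (\<epsilon> k) \<and> integral\<^sup>L M (\<epsilon> k) = 0"
    and \<epsilon>_subgauss: "\<exists>C C'. C > 0 \<and> (\<forall>k.
           integrable M (\<lambda>\<omega>. exp ((\<epsilon> k \<omega>)\<^sup>2 / C\<^sup>2)) \<and>
           C\<^sup>2 * (integral\<^sup>L M (\<lambda>\<omega>. exp ((\<epsilon> k \<omega>)\<^sup>2 / C\<^sup>2)) - 1) \<le> C')"
    and Z_\<epsilon>_indep: "prob_space.indep_set M
           (sigma_sets (space M) (\<Union>x. {Z x -` A \<inter> space M | A. A \<in> sets borel}))
           (sigma_sets (space M) (\<Union>k. {\<epsilon> k -` A \<inter> space M | A. A \<in> sets borel}))"
    and matern_params: "\<phi>\<^sub>0 > 0" "\<nu>\<^sub>0 > 0" "\<phi> > 0" "\<nu> > 0"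
    and \<Psi>_fourier: "\<exists>c\<^sub>1 c\<^sub>2. c\<^sub>1 > 0 \<and> c\<^sub>2 > 0 \<and> (\<forall>\<omega>::'a.
           fourier_transform \<Psi> \<omega> \<in> \<real> \<and>
           c\<^sub>1 * (1 + (norm \<omega>)\<^sup>2) powr (- m\<^sub>0) \<le> Re (fourier_transform \<Psi> \<omega>) \<and>
           Re (fourier_transform \<Psi> \<omega>) \<le> c\<^sub>2 * (1 + (norm \<omega>)\<^sup>2) powr (- m\<^sub>0))"
    and \<Phi>_fourier: "\<exists>c\<^sub>3 c\<^sub>4. c\<^sub>3 > 0 \<and> c\<^sub>4 > 0 \<and> (\<forall>\<omega>::'a.
           fourier_transform \<Phi> \<omega> \<in> \<real> \<and>
           c\<^sub>3 * (1 + (norm \<omega>)\<^sup>2) powr (- m) \<le> Re (fourier_transform \<Phi> \<omega>) \<and>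
           Re (fourier_transform \<Phi> \<omega>) \<le> c\<^sub>4 * (1 + (norm \<omega>)\<^sup>2) powr (- m))"
    and m_bounds: "d / 2 < m\<^sub>0" "m\<^sub>0 \<le> m"
    and design_in: "\<forall>n. \<forall>k<n. xs n k \<in> \<Omega>"
    and design_distinct: "\<forall>n. inj_on (xs n) {..<n}"
    and fill: "\<exists>C. \<forall>n\<ge>1. fill_distance (xs n ` {..<n}) \<Omega> \<le> C * real n powr (- 1 / d)"
    and \<mu>_pos: "\<forall>n. \<mu> n > 0"
    and \<mu>_lower: "\<exists>c>0. \<forall>n\<ge>1. \<mu> n \<ge> c * real n powr (1 - 2 * m / d)"
  shows "\<exists>C C\<^sub>0. \<forall>t\<^sub>1 t\<^sub>2 n. t\<^sub>1 \<ge> C\<^sub>0 \<longrightarrow> t\<^sub>2 \<ge> C\<^sub>0 \<longrightarrow> n \<ge> 2 \<longrightarrow>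
     (let q = separation_radius (xs n ` {..<n});
          T = \<mu> n powr (- (m - m\<^sub>0) / m) * q powr (- (m - m\<^sub>0) * d / m)
                * (\<mu> n / real n) powr (1 - d / (2 * m))
              + \<mu> n powr ((2 * m\<^sub>0 - d) / (2 * m)) * q powr ((2 * m\<^sub>0 - d) * d / (2 * m))
      in measure M {\<omega> \<in> space M.
           (\<integral>\<^sup>+ x\<in>\<Omega>. ennreal ((Z x \<omega> - kernel_predictor \<Phi> (\<mu> n) n (xs n)
                                     (\<lambda>k. Z (xs n k) \<omega> + \<epsilon> k \<omega>) x)\<^sup>2) \<partial>lborel)
           \<le> ennreal (C * ((1 + t\<^sub>1)\<^sup>2 * T
                 + t\<^sub>2\<^sup>2 * \<mu> n powr (- d / (2 * m)) * real n powr (- (1 - d / (2 * m)))))}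
         \<ge> 1 - exp (- t\<^sub>1\<^sup>2) - exp (- t\<^sub>2\<^sup>2))"
proof -
  interpret prob_space M by (rule M)
  have d: "d > 0" by (simp add: d_def)
  \<comment> \<open>The Fourier hypotheses fix both exponents, so that
    \<open>m\<^sub>0 \<le> m\<close> becomes \<open>\<nu>\<^sub>0 \<le> \<nu>\<close>.\<close>
  have m0: "m\<^sub>0 = \<nu>\<^sub>0 + d / 2"
    using \<Psi>_fourier matern_smoothness_unique[OF matern_params(1,2), where 'a='a and m="m\<^sub>0"] unfolding \<Psi>_def d_def by blast
  have m: "m = \<nu> + d / 2"
    using \<Phi>_fourier matern_smoothness_unique[OF matern_params(3,4), where 'a='a and m=m] unfolding \<Phi>_def d_def by blast
  define a0 where "a0 = 2 * sqrt \<nu>\<^sub>0 * \<phi>\<^sub>0"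
  define a where "a = 2 * sqrt \<nu> * \<phi>"
  have a: "a0 > 0" "a > 0" using matern_params by (auto simp: a0_def a_def)
  have \<nu>: "\<nu>\<^sub>0 \<le> \<nu>" using m_bounds m m0 by simp
  have \<Psi>: "\<Psi> = gauss_mix a0 \<nu>\<^sub>0" and \<Phi>: "\<Phi> = gauss_mix a \<nu>"
    unfolding \<Psi>_def \<Phi>_def a0_def a_def using matern_params by (auto intro!: ext matern_eq_gauss_mix)
  obtain Cf0 where Cf0: "\<And>n. n \<ge> 1 \<Longrightarrow> fill_distance (xs n ` {..<n}) \<Omega> \<le> Cf0 * real n powr (- 1 / d)"
    using fill by blast
  \<comment> \<open>The constant in the fill distance hypothesis comes without a sign, hence the
    maximum.\<close>
  define Cf where "Cf = max 1 Cf0"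
  have Cf: "Cf > 0" by (simp add: Cf_def)
  have cover: "\<exists>k<n. dist y (xs n k) \<le> Cf * real n powr (- 1 / d)" if "n \<ge> 1" "y \<in> \<Omega>" for n y
  proof -
    have "\<exists>x\<in>xs n ` {..<n}. dist y x \<le> fill_distance (xs n ` {..<n}) \<Omega>"
      using that design_in \<Omega>_compact by (intro fill_distance_cover compact_imp_bounded) (auto simp: lessThan_empty_iff bot_nat_def)
    then obtain k where k: "k < n" "dist y (xs n k) \<le> fill_distance (xs n ` {..<n}) \<Omega>" by auto
    have "Cf0 * real n powr (- 1 / d) \<le> Cf * real n powr (- 1 / d)"
      by (intro mult_right_mono) (auto simp: Cf_def)
    hence "dist y (xs n k) \<le> Cf * real n powr (- 1 / d)" using k(2) Cf0[OF that(1)] by linarith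
    with k(1) show ?thesis by blast
  qed
  obtain c where c: "c > 0" "\<And>n. n \<ge> 1 \<Longrightarrow> \<mu> n \<ge> c * real n powr (1 - 2 * m / d)"
    using \<mu>_lower by blast
  obtain C where C: "C > 0" and bound: "\<And>n x w q. n \<ge> 2 \<Longrightarrow> x \<in> \<Omega> \<Longrightarrow> q = separation_radius (xs n ` {..<n}) \<Longrightarrow>
     normal_equations (gauss_mix a \<nu>) (\<mu> n) n (xs n) w x \<Longrightarrow>
     pred_var (gauss_mix a0 \<nu>\<^sub>0) n (xs n) w x \<le> C * (\<mu> n powr (- (m - m\<^sub>0) / m) * q powr (- (m - m\<^sub>0) * d / m)
                * (\<mu> n / real n) powr (1 - d / (2 * m))
              + \<mu> n powr ((2 * m\<^sub>0 - d) / (2 * m)) * q powr ((2 * m\<^sub>0 - d) * d / (2 * m))) \<and>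
    (\<Sum>k<n. (w k)\<^sup>2) \<le> C * (\<mu> n powr (- d / (2 * m)) * real n powr (- (1 - d / (2 * m))))"
    using misspecified_variance_bound[OF a(1,2) matern_params(2) \<nu> \<Omega>_cone compact_imp_bounded[OF \<Omega>_compact] Cf cover[unfolded d_def] c(1)
      c(2)[unfolded m d_def] design_in[rule_format] design_distinct[rule_format]]
    unfolding d_def[symmetric] m[symmetric] m0[symmetric] by blast
  obtain Ce Ce' where Ce: "Ce > 0" and sg: "\<And>k. integrable M (\<lambda>\<omega>. exp ((\<epsilon> k \<omega>)\<^sup>2 / Ce\<^sup>2))"
      "\<And>k. Ce\<^sup>2 * (integral\<^sup>L M (\<lambda>\<omega>. exp ((\<epsilon> k \<omega>)\<^sup>2 / Ce\<^sup>2)) - 1) \<le> Ce'"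
    using \<epsilon>_subgauss by blast
  \<comment> \<open>The noise hypothesis bounds the mean of the exponential by 1 + C'/C^2; the
    maximum makes positivity of the proxy immediate.\<close>
  define Ae where "Ae = max 1 (1 + Ce' / Ce\<^sup>2)"
  have Ae: "Ae \<ge> 1" by (simp add: Ae_def)
  define Ve where "Ve = Ce\<^sup>2 * (1 / 2 + 8 * Ae)"
  have Ve: "Ve > 0" unfolding Ve_def using Ce Ae by (intro mult_pos_pos) auto
  have noise: "subgaussian M (\<epsilon> k) Ve" for k
    unfolding Ve_def
  proof (rule centered_subgaussian[OF M Ce])
    have "integral\<^sup>L M (\<lambda>\<omega>. exp ((\<epsilon> k \<omega>)\<^sup>2 / Ce\<^sup>2)) - 1 \<le> Ce' / Ce\<^sup>2"
      using sg(2)[of k] Ce by (simp add: pos_le_divide_eq mult.commute)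
    thus "integral\<^sup>L M (\<lambda>\<omega>. exp ((\<epsilon> k \<omega>)\<^sup>2 / Ce\<^sup>2)) \<le> Ae" by (simp add: Ae_def)
  qed (use \<epsilon>_mean sg in auto)
  define vol where "vol = measure lborel \<Omega>"
  have "emeasure lborel \<Omega> < \<infinity>" by (rule emeasure_compact_finite[OF \<Omega>_compact])
  hence vol: "emeasure lborel \<Omega> = ennreal vol" unfolding vol_def by (intro emeasure_eq_ennreal_measure) auto
  with \<Omega>_pos have vol0: "vol > 0" by simp
  have \<Omega>_sets: "\<Omega> \<in> sets borel" using \<Omega>_compact by (simp add: borel_compact)
  \<comment> \<open>16 is 2 times 8: the 2 from (u - v)^2 <= 2 u^2 + 2 v^2, the 8 from the tail
    bound.\<close>
  define Cfin where "Cfin = 16 * vol * C * (\<sigma>\<^sup>2 + Ve)"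
  note [measurable] = Z_meas \<Omega>_sets
  have Zm[measurable]: "Z x \<in> borel_measurable M" for x
    using measurable_Pair2[OF Z_meas, of x] by simp
  have em[measurable]: "\<epsilon> k \<in> borel_measurable M" for k using noise by (simp add: subgaussian_def)
  show ?thesis
  \<comment> \<open>The tail bound is available for t >= 1, hence C_0 = 1.\<close>
  proof (rule exI[of _ Cfin], rule exI[of _ 1], intro allI impI)
    fix t1 t2 :: real and n :: nat
    assume t1: "t1 \<ge> 1" and t2: "t2 \<ge> 1" and n: "n \<ge> 2"
    define q where "q = separation_radius (xs n ` {..<n})"
    define T where "T = \<mu> n powr (- (m - m\<^sub>0) / m) * q powr (- (m - m\<^sub>0) * d / m) * (\<mu> n / real n) powr (1 - d / (2 * m))
              + \<mu> n powr ((2 * m\<^sub>0 - d) / (2 * m)) * q powr ((2 * m\<^sub>0 - d) * d / (2 * m))"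
    define D where "D = \<mu> n powr (- d / (2 * m)) * real n powr (- (1 - d / (2 * m)))"
    have \<mu>0: "\<mu> n > 0" using \<mu>_pos by simp
    have q0: "q > 0" unfolding q_def using separation_radius_bounds(1)[OF design_distinct[rule_format] n] .
    have T: "T > 0" unfolding T_def using \<mu>0 q0 n by (intro add_pos_pos mult_pos_pos) auto
    have D: "D > 0" unfolding D_def using \<mu>0 n by simp
    obtain B where pred: "\<And>x y. kernel_predictor \<Phi> (\<mu> n) n (xs n) y x = (\<Sum>k<n. (\<Sum>j<n. \<Phi> (x - xs n j) * B j k) * y k)"
      and ne: "\<And>x. normal_equations \<Phi> (\<mu> n) n (xs n) (\<lambda>k. \<Sum>j<n. \<Phi> (x - xs n j) * B j k) x"
      using kernel_predictor_weights[OF a(2) matern_params(4) \<mu>0, of n "xs n"] unfolding \<Phi> by blast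
    define w where "w x k = (\<Sum>j<n. \<Phi> (x - xs n j) * B j k)" for x k
    have wm[measurable]: "(\<lambda>x. w x k) \<in> borel_measurable borel" for k
      unfolding w_def \<Phi> by measurable
    define Y1 where "Y1 x \<omega> = Z x \<omega> - (\<Sum>k<n. w x k * Z (xs n k) \<omega>)" for x \<omega>
    define Y2 where "Y2 x \<omega> = (\<Sum>k<n. w x k * \<epsilon> k \<omega>)" for x \<omega>
    have Y1m[measurable]: "case_prod Y1 \<in> borel_measurable (lborel \<Otimes>\<^sub>M M)"
      unfolding Y1_def by measurable
    have Y2m[measurable]: "case_prod Y2 \<in> borel_measurable (lborel \<Otimes>\<^sub>M M)"
      unfolding Y2_def by measurable
    have var: "pred_var \<Psi> n (xs n) (w x) x \<le> C * T" "(\<Sum>k<n. (w x k)\<^sup>2) \<le> C * D" if "x \<in> \<Omega>" for x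
      using bound[OF n that q_def ne[of x, folded w_def, unfolded \<Phi>]] unfolding T_def D_def \<Psi> by auto
    have s1: "subgaussian M (Y1 x) (\<sigma>\<^sup>2 * (C * T))" if "x \<in> \<Omega>" for x
    proof (rule subgaussian_mono)
      have "normal_rv M (Y1 x) 0 (\<sigma>\<^sup>2 * pred_var \<Psi> n (xs n) (w x) x)"
        unfolding Y1_def by (rule gaussian_process_prediction_error[OF Z_gp]) (simp add: \<Psi> gauss_mix_uminus)
      thus "subgaussian M (Y1 x) (\<sigma>\<^sup>2 * pred_var \<Psi> n (xs n) (w x) x)" by (rule normal_rv_subgaussian[OF M])
      show "\<sigma>\<^sup>2 * pred_var \<Psi> n (xs n) (w x) x \<le> \<sigma>\<^sup>2 * (C * T)" by (intro mult_left_mono var that) simp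
    qed
    have s2: "subgaussian M (Y2 x) (Ve * (C * D))" if "x \<in> \<Omega>" for x
    proof (rule subgaussian_mono)
      show "subgaussian M (Y2 x) (Ve * (\<Sum>k<n. (w x k)\<^sup>2))"
        unfolding Y2_def by (rule subgaussian_sum[OF M \<epsilon>_indep noise])
      show "Ve * (\<Sum>k<n. (w x k)\<^sup>2) \<le> Ve * (C * D)" using Ve by (intro mult_left_mono var that) simp
    qed
    let ?I = "\<lambda>Y \<omega>. \<integral>\<^sup>+x\<in>\<Omega>. ennreal ((Y x \<omega>)\<^sup>2) \<partial>lborel"
    let ?b1 = "8 * (\<sigma>\<^sup>2 * (C * T)) * vol * t1\<^sup>2" and ?b2 = "8 * (Ve * (C * D)) * vol * t2\<^sup>2"
    define S1 where "S1 = {\<omega> \<in> space M. \<not> ?I Y1 \<omega> \<le> ennreal ?b1}"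
    define S2 where "S2 = {\<omega> \<in> space M. \<not> ?I Y2 \<omega> \<le> ennreal ?b2}"
    have P1: "measure M S1 \<le> exp (- t1\<^sup>2)"
      unfolding S1_def using \<sigma>_pos C T
      by (intro subgaussian_field_tail[OF M Y1m \<Omega>_sets vol vol0 s1 _ t1]) auto
    have P2: "measure M S2 \<le> exp (- t2\<^sup>2)"
      unfolding S2_def using Ve C D
      by (intro subgaussian_field_tail[OF M Y2m \<Omega>_sets vol vol0 s2 _ t2]) auto
    have [measurable]: "(\<lambda>(\<omega>, x). Y1 x \<omega>) \<in> borel_measurable (M \<Otimes>\<^sub>M lborel)" "(\<lambda>(\<omega>, x). Y2 x \<omega>) \<in> borel_measurable (M \<Otimes>\<^sub>M lborel)"
      using measurable_pair_swap[OF Y1m] measurable_pair_swap[OF Y2m] by (simp_all add: split_def)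
    have Ssets[measurable]: "S1 \<in> sets M" "S2 \<in> sets M" unfolding S1_def S2_def by measurable
    define good where "good = {\<omega> \<in> space M.
           (\<integral>\<^sup>+ x\<in>\<Omega>. ennreal ((Z x \<omega> - kernel_predictor \<Phi> (\<mu> n) n (xs n) (\<lambda>k. Z (xs n k) \<omega> + \<epsilon> k \<omega>) x)\<^sup>2) \<partial>lborel)
           \<le> ennreal (Cfin * ((1 + t1)\<^sup>2 * T + t2\<^sup>2 * \<mu> n powr (- d / (2 * m)) * real n powr (- (1 - d / (2 * m)))))}"
    have err: "Z x \<omega> - kernel_predictor \<Phi> (\<mu> n) n (xs n) (\<lambda>k. Z (xs n k) \<omega> + \<epsilon> k \<omega>) x = Y1 x \<omega> - Y2 x \<omega>" for x \<omega>
      unfolding pred w_def[symmetric] Y1_def Y2_def by (simp add: distrib_left sum.distrib)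
    have goodsets: "good \<in> sets M" unfolding good_def err by measurable
    have "space M - (S1 \<union> S2) \<subseteq> good"
    proof
      fix \<omega> assume "\<omega> \<in> space M - (S1 \<union> S2)"
      hence \<omega>: "\<omega> \<in> space M" and I: "?I Y1 \<omega> \<le> ennreal ?b1" "?I Y2 \<omega> \<le> ennreal ?b2"
        by (auto simp: S1_def S2_def)
      have [measurable]: "(\<lambda>x. Y1 x \<omega>) \<in> borel_measurable lborel" "(\<lambda>x. Y2 x \<omega>) \<in> borel_measurable lborel"
        using measurable_Pair1[OF Y1m \<omega>] measurable_Pair1[OF Y2m \<omega>] by simp_all
      have f1: "(\<lambda>x. ennreal ((Y1 x \<omega>)\<^sup>2) * indicator \<Omega> x) \<in> borel_measurable lborel"
        and f2: "(\<lambda>x. ennreal ((Y2 x \<omega>)\<^sup>2) * indicator \<Omega> x) \<in> borel_measurable lborel"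
        by measurable
      have g1: "(\<lambda>x. 2 * (ennreal ((Y1 x \<omega>)\<^sup>2) * indicator \<Omega> x)) \<in> borel_measurable lborel"
        and g2: "(\<lambda>x. 2 * (ennreal ((Y2 x \<omega>)\<^sup>2) * indicator \<Omega> x)) \<in> borel_measurable lborel"
        by measurable
      have "(\<integral>\<^sup>+x\<in>\<Omega>. ennreal ((Y1 x \<omega> - Y2 x \<omega>)\<^sup>2) \<partial>lborel) \<le>
        (\<integral>\<^sup>+x. 2 * (ennreal ((Y1 x \<omega>)\<^sup>2) * indicator \<Omega> x) + 2 * (ennreal ((Y2 x \<omega>)\<^sup>2) * indicator \<Omega> x) \<partial>lborel)"
      proof (rule nn_integral_mono)
        fix x :: 'a
        have "(Y1 x \<omega> - Y2 x \<omega>)\<^sup>2 \<le> 2 * (Y1 x \<omega>)\<^sup>2 + 2 * (Y2 x \<omega>)\<^sup>2"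
          using zero_le_power2[of "Y1 x \<omega> + Y2 x \<omega>"] by (simp add: power2_eq_square algebra_simps)
        hence "ennreal ((Y1 x \<omega> - Y2 x \<omega>)\<^sup>2) \<le> ennreal (2 * (Y1 x \<omega>)\<^sup>2 + 2 * (Y2 x \<omega>)\<^sup>2)" by (rule ennreal_leI)
        also have "\<dots> = 2 * ennreal ((Y1 x \<omega>)\<^sup>2) + 2 * ennreal ((Y2 x \<omega>)\<^sup>2)"
          by (subst ennreal_plus) (auto simp: ennreal_mult)
        finally show "ennreal ((Y1 x \<omega> - Y2 x \<omega>)\<^sup>2) * indicator \<Omega> x \<le>
           2 * (ennreal ((Y1 x \<omega>)\<^sup>2) * indicator \<Omega> x) + 2 * (ennreal ((Y2 x \<omega>)\<^sup>2) * indicator \<Omega> x)"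
          by (cases "x \<in> \<Omega>") auto
      qed
      also have "\<dots> = 2 * ?I Y1 \<omega> + 2 * ?I Y2 \<omega>"
        unfolding nn_integral_add[OF g1 g2] nn_integral_cmult[OF f1] nn_integral_cmult[OF f2] ..
      also have "\<dots> \<le> 2 * ennreal ?b1 + 2 * ennreal ?b2"
        using I by (intro add_mono mult_left_mono) auto
      also have "\<dots> = ennreal (2 * ?b1 + 2 * ?b2)"
      proof -
        have "2 * ennreal u + 2 * ennreal v = ennreal (2 * u + 2 * v)" if "u \<ge> 0" "v \<ge> 0" for u v
          using that by (subst ennreal_plus) (auto simp: ennreal_mult)
        moreover have "?b1 \<ge> 0" "?b2 \<ge> 0" using C T D Ve vol0 by auto
        ultimately show ?thesis by blast
      qed
      also have "\<dots> \<le> ennreal (Cfin * ((1 + t1)\<^sup>2 * T + t2\<^sup>2 * D))"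
      proof (rule ennreal_leI)
        have k: "16 * vol * C \<ge> 0" using vol0 C by simp
        have "t1\<^sup>2 \<le> (1 + t1)\<^sup>2" using t1 by (intro power_mono) auto
        hence "\<sigma>\<^sup>2 * (t1\<^sup>2 * T) \<le> (\<sigma>\<^sup>2 + Ve) * ((1 + t1)\<^sup>2 * T)"
          using T Ve by (intro mult_mono) auto
        moreover have "Ve * (t2\<^sup>2 * D) \<le> (\<sigma>\<^sup>2 + Ve) * (t2\<^sup>2 * D)"
          using D by (intro mult_right_mono) auto
        ultimately have "\<sigma>\<^sup>2 * (t1\<^sup>2 * T) + Ve * (t2\<^sup>2 * D) \<le> (\<sigma>\<^sup>2 + Ve) * ((1 + t1)\<^sup>2 * T + t2\<^sup>2 * D)"
          by (simp only: distrib_left)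
        hence "16 * vol * C * (\<sigma>\<^sup>2 * (t1\<^sup>2 * T) + Ve * (t2\<^sup>2 * D)) \<le> 16 * vol * C * ((\<sigma>\<^sup>2 + Ve) * ((1 + t1)\<^sup>2 * T + t2\<^sup>2 * D))"
          by (rule mult_left_mono[OF _ k])
        thus "2 * ?b1 + 2 * ?b2 \<le> Cfin * ((1 + t1)\<^sup>2 * T + t2\<^sup>2 * D)"
          by (simp add: Cfin_def algebra_simps)
      qed
      finally show "\<omega> \<in> good" using \<omega> unfolding good_def err D_def by (simp add: mult.assoc)
    qed
    \<comment> \<open>A union bound over the two exceptional events.\<close>
    hence "measure M (space M - (S1 \<union> S2)) \<le> measure M good" by (intro finite_measure_mono goodsets)
    moreover have "measure M (space M - (S1 \<union> S2)) = 1 - measure M (S1 \<union> S2)"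
      by (rule prob_compl) measurable
    moreover have "measure M (S1 \<union> S2) \<le> measure M S1 + measure M S2"
      by (rule measure_subadditive) (use Ssets in auto)
    ultimately have "measure M good \<ge> 1 - exp (- t1\<^sup>2) - exp (- t2\<^sup>2)" using P1 P2 by linarith
    thus "let q = separation_radius (xs n ` {..<n});
          T = \<mu> n powr (- (m - m\<^sub>0) / m) * q powr (- (m - m\<^sub>0) * d / m)
                * (\<mu> n / real n) powr (1 - d / (2 * m))
              + \<mu> n powr ((2 * m\<^sub>0 - d) / (2 * m)) * q powr ((2 * m\<^sub>0 - d) * d / (2 * m))
      in measure M {\<omega> \<in> space M.
           (\<integral>\<^sup>+ x\<in>\<Omega>. ennreal ((Z x \<omega> - kernel_predictor \<Phi> (\<mu> n) n (xs n)
                                     (\<lambda>k. Z (xs n k) \<omega> + \<epsilon> k \<omega>) x)\<^sup>2) \<partial>lborel)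
           \<le> ennreal (Cfin * ((1 + t1)\<^sup>2 * T
                 + t2\<^sup>2 * \<mu> n powr (- d / (2 * m)) * real n powr (- (1 - d / (2 * m)))))}
         \<ge> 1 - exp (- t1\<^sup>2) - exp (- t2\<^sup>2)"
      unfolding Let_def q_def[symmetric] T_def[symmetric] good_def[symmetric] .
  qed
qed

end
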